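(* Let $k$ be a field of characteristic $2$ and let $E/k$ be an elliptic curve in $\mathbf{Z}/4\mathbf{Z}$-normal form, i.e. for some $c\in k$, $E$ is the curve in $\mathbb{P}^3$ $$(X_0+X_1+X_2+X_3)^2 = c\,X_0X_2 = c\,X_1X_3,$$ with identity $\mathrm{O}=(1:0:0:1)$. Put $T=(1:1:0:0)$. Then: 1. The embedding divisor class of $E$ is $3(\mathrm{O})+(S)$, where $S=(0:1:1:0)=2T$. 2. The point $T$ is a rational $4$-torsion point. 3. The translation-by-$T$ and inverse morphisms are given by $$\tau_T(X_0:X_1:X_2:X_3)=(X_3:X_0:X_1:X_2),\qquad [-1](X_0:X_1:X_2:X_3)=(X_3:X_2:X_1:X_0).$$ 4. $E$ admits a factorization through $\mathbb{P}^1\times\mathbb{P}^1$, where $\pi_1,\pi_2:E\to\mathbb{P}^1$ are the morphisms $$\pi_1(X_0:X_1:X_2:X_3)=\begin{cases}(X_0:X_1),\\(X_3:X_2),\end{cases}\qquad \pi_2(X_0:X_1:X_2:X_3)=\begin{cases}(X_0:X_3),\\(X_1:X_2).\end{cases}$$ More precisely, if $(U_0,U_1)$ and $(V_0,V_1)$ are the coordinate functions on $\mathbb{P}^1\times\mathbb{P}^1$, the product morphism $\pi_1\times\pi_2$ determines an isomorphism $E\to E_1$, where $E_1\subset \mathbb{P}^1\times\mathbb{P}^1$ is the curve $$(U_0+U_1)^2(V_0+V_1)^2=c\,U_0U_1V_0V_1,$$ whose inverse is the restriction of the skew-Segre embedding $$((U_0:U_1),(V_0:V_1))\longmapsto(U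_0V_0:U_1V_0:U_1V_1:U_0V_1).$$
   Context: An elliptic curve is a nonsingular projective curve of genus 1 with a chosen rational point $\mathrm{O}$ (so in particular $c\neq 0$ here); $\tau_T(P)=P+T$. Embedding divisor class: if $E\subset\mathbb{P}^r$ is an elliptic curve over $k$ embedded by a complete linear system of degree $d=r+1$, there is a point $S\in E(k)$ such that, for every hyperplane $H$ not containing $E$, the points of $E\cap H$ (over $\bar k$, with multiplicity) sum to $S$ in the group $E$; the embedding divisor class of $E$ is $(d-1)(\mathrm{O})+(S)$. A morphism written with a brace and several tuples of polynomials means: each tuple defines the morphism on the open complement of the common zeros of its entries, the tuples agree on overlaps, and these open sets cover the curve. *)

theory Defs
  imports "HOL-Algebra.Algebra" "HOL-Algebra.Algebraic_Closure_Type" "HOL-Library.Poly_Mapping"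
    "HOL-Library.More_List"
begin

section \<open>Multivariate polynomials\<close>

type_synonym 'a mpol = "(nat \<Rightarrow>\<^sub>0 nat) \<Rightarrow>\<^sub>0 'a"

definition mvar :: "nat \<Rightarrow> 'a::zero_neq_one mpol" where
  "mvar i = Poly_Mapping.single (Poly_Mapping.single i 1) 1"

definition mconst :: "'a::zero \<Rightarrow> 'a mpol" where
  "mconst a = Poly_Mapping.single 0 a"

text \<open>Coordinate vectors are lists; the variable \<open>i\<close> is evaluated at the \<open>i\<close>-th entry.\<close>

definition meval :: "'a::comm_semiring_1 mpol \<Rightarrow> 'a list \<Rightarrow> 'a" where
  "meval p x = (\<Sum>m\<in>Poly_Mapping.keys p.
     Poly_Mapping.lookup p m *
       (\<Prod>i\<in>Poly_Mapping.keys m. nth_default 0 x i ^ Poly_Mapping.lookup m i))"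

definition mpartial :: "nat \<Rightarrow> 'a::comm_semiring_1 mpol \<Rightarrow> 'a mpol" where
  "mpartial i p = (\<Sum>m\<in>Poly_Mapping.keys p.
     Poly_Mapping.single (m - Poly_Mapping.single i 1)
       (of_nat (Poly_Mapping.lookup m i) * Poly_Mapping.lookup p m))"

text \<open>Homogeneous polynomials of degree \<open>d\<close> in the variables \<open>0, \<dots>, r\<close> (including \<open>0\<close>).\<close>

definition is_form :: "nat \<Rightarrow> nat \<Rightarrow> 'a::zero mpol \<Rightarrow> bool" where
  "is_form r d p \<longleftrightarrow> (\<forall>m\<in>Poly_Mapping.keys p. Poly_Mapping.keys m \<subseteq> {..r} \<and>
     (\<Sum>i\<le>r. Poly_Mapping.lookup m i) = d)"

text \<open>Bihomogeneous polynomials of bidegree \<open>(d, e)\<close> on the product of projective spaces of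
  dimensions \<open>r\<close> and \<open>s\<close>: the first block of variables is \<open>0, \<dots>, r\<close>, the second one is
  \<open>r + 1, \<dots>, r + 1 + s\<close>.\<close>

definition is_biform :: "nat \<Rightarrow> nat \<Rightarrow> nat \<Rightarrow> nat \<Rightarrow> 'a::zero mpol \<Rightarrow> bool" where
  "is_biform r s d e p \<longleftrightarrow> (\<forall>m\<in>Poly_Mapping.keys p. Poly_Mapping.keys m \<subseteq> {..r + 1 + s} \<and>
     (\<Sum>i\<le>r. Poly_Mapping.lookup m i) = d \<and> (\<Sum>i\<le>s. Poly_Mapping.lookup m (r + 1 + i)) = e)"

definition ideal_span :: "'a::comm_ring_1 set \<Rightarrow> 'a set" where
  "ideal_span S = Modules.module.span (*) S"

lemma module_times: "Modules.module ((*) :: 'a::comm_ring_1 \<Rightarrow> 'a \<Rightarrow> 'a)"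
  by unfold_locales (simp_all add: algebra_simps)

definition base_change :: "'k::field mpol \<Rightarrow> 'k alg_closure mpol" where
  "base_change p = Poly_Mapping.map to_ac p"


section \<open>Projective varieties over an algebraically closed field\<close>

text \<open>A point of projective space is the set of all its coordinate vectors.\<close>

type_synonym 'a ppoint = "'a list set"

definition proj :: "'a::field list \<Rightarrow> 'a ppoint" where
  "proj x = {map ((*) t) x | t. t \<noteq> 0}"

definition proj_space :: "nat \<Rightarrow> 'a::field ppoint set" where
  "proj_space r = proj ` {x. length x = r + 1 \<and> (\<exists>a\<in>set x. a \<noteq> 0)}"

definition rational_point :: "'k::field alg_closure ppoint \<Rightarrow> bool" where
  "rational_point P \<longleftrightarrow> (\<exists>x. P = proj (map to_ac x))"

definition vanishes_at :: "'a::field mpol \<Rightarrow> 'a ppoint \<Rightarrow> bool" where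
  "vanishes_at F P \<longleftrightarrow> (\<forall>x\<in>P. meval F x = 0)"

definition vanishes_on :: "'a::field mpol \<Rightarrow> 'a ppoint set \<Rightarrow> bool" where
  "vanishes_on F V \<longleftrightarrow> (\<forall>P\<in>V. vanishes_at F P)"

definition zero_locus :: "nat \<Rightarrow> 'a::field mpol set \<Rightarrow> 'a ppoint set" where
  "zero_locus r S = {P \<in> proj_space r. \<forall>F\<in>S. vanishes_at F P}"

definition forms_vanishing_on :: "nat \<Rightarrow> 'a::field ppoint set \<Rightarrow> 'a mpol set" where
  "forms_vanishing_on r V = {F. (\<exists>d. is_form r d F) \<and> vanishes_on F V}"

definition ideal_of :: "nat \<Rightarrow> 'a::field ppoint set \<Rightarrow> 'a mpol set" where
  "ideal_of r V = ideal_span (forms_vanishing_on r V)"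

text \<open>Irreducibility is expressed as primality of the homogeneous ideal of \<open>V\<close>.\<close>

definition proj_variety :: "nat \<Rightarrow> 'a::alg_closed_field ppoint set \<Rightarrow> bool" where
  "proj_variety r V \<longleftrightarrow> V \<noteq> {} \<and>
     (\<exists>S. (\<forall>F\<in>S. \<exists>d. is_form r d F) \<and> V = zero_locus r S) \<and>
     (\<forall>F G d e. is_form r d F \<and> is_form r e G \<and> vanishes_on (F * G) V \<longrightarrow>
        vanishes_on F V \<or> vanishes_on G V)"

text \<open>Krull dimension 1: the proper closed irreducible subsets are the points.\<close>

definition proj_curve :: "nat \<Rightarrow> 'a::alg_closed_field ppoint set \<Rightarrow> bool" where
  "proj_curve r C \<longleftrightarrow> proj_variety r C \<and> (\<forall>P. C \<noteq> {P}) \<and>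
     (\<forall>Z. proj_variety r Z \<and> Z \<subset> C \<longrightarrow> (\<exists>P. Z = {P}))"

text \<open>Jacobian criterion for a curve: \<open>r - 1\<close> forms vanishing on \<open>C\<close> have linearly independent
  gradients at \<open>P\<close>. The rank of the Jacobian matrix can never exceed \<open>r - 1\<close>.\<close>

definition nonsingular_at :: "nat \<Rightarrow> 'a::alg_closed_field ppoint set \<Rightarrow> 'a ppoint \<Rightarrow> bool" where
  "nonsingular_at r C P \<longleftrightarrow>
     (\<exists>Fs. length Fs = r - 1 \<and> set Fs \<subseteq> forms_vanishing_on r C \<and>
        (\<forall>x\<in>P. \<forall>a :: nat \<Rightarrow> 'a.
           (\<forall>j\<le>r. (\<Sum>i<r - 1. a i * meval (mpartial j (Fs ! i)) x) = 0) \<longrightarrow>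
           (\<forall>i<r - 1. a i = 0)))"


section \<open>Divisors on a nonsingular projective curve\<close>

definition point_ideal_power :: "nat \<Rightarrow> 'a::field ppoint \<Rightarrow> nat \<Rightarrow> 'a mpol set" where
  "point_ideal_power r P d =
     ideal_span {prod_list Fs | Fs. length Fs = d \<and> set Fs \<subseteq> forms_vanishing_on r {P}}"

text \<open>The order of vanishing at \<open>P\<close> of a form \<open>F\<close> restricted to \<open>C\<close> is the largest \<open>d\<close> such that
  \<open>F\<close>, divided by a form of the same degree not vanishing at \<open>P\<close>, lies in the \<open>d\<close>-th power of the
  maximal ideal of the local ring of \<open>C\<close> at \<open>P\<close>. The form \<open>H\<close> below clears denominators.\<close>

definition ord_ge :: "nat \<Rightarrow> 'a::field ppoint set \<Rightarrow> 'a ppoint \<Rightarrow> 'a mpol \<Rightarrow> nat \<Rightarrow> bool" where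
  "ord_ge r C P F d \<longleftrightarrow>
     (\<exists>H e A. is_form r e H \<and> \<not> vanishes_at H P \<and> A \<in> point_ideal_power r P d \<and>
        H * F - A \<in> ideal_of r C)"

definition ord_form :: "nat \<Rightarrow> 'a::field ppoint set \<Rightarrow> 'a ppoint \<Rightarrow> 'a mpol \<Rightarrow> nat" where
  "ord_form r C P F = (GREATEST d. ord_ge r C P F d)"

type_synonym 'a pdivisor = "'a ppoint \<Rightarrow>\<^sub>0 int"

definition divisor_on :: "'a ppoint set \<Rightarrow> 'a pdivisor \<Rightarrow> bool" where
  "divisor_on C D \<longleftrightarrow> Poly_Mapping.keys D \<subseteq> C"

definition div_degree :: "'a pdivisor \<Rightarrow> int" where
  "div_degree D = (\<Sum>P\<in>Poly_Mapping.keys D. Poly_Mapping.lookup D P)"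

definition effective :: "'a pdivisor \<Rightarrow> bool" where
  "effective D \<longleftrightarrow> (\<forall>P. 0 \<le> Poly_Mapping.lookup D P)"

definition form_div :: "nat \<Rightarrow> 'a::field ppoint set \<Rightarrow> 'a mpol \<Rightarrow> 'a pdivisor" where
  "form_div r C F = Abs_poly_mapping (\<lambda>P. if P \<in> C then int (ord_form r C P F) else 0)"

text \<open>Nonzero rational functions on \<open>C\<close> are the quotients \<open>F / G\<close> of two forms of equal degree,
  neither vanishing on \<open>C\<close>.\<close>

definition principal_divisor :: "nat \<Rightarrow> 'a::field ppoint set \<Rightarrow> 'a pdivisor \<Rightarrow> bool" where
  "principal_divisor r C D \<longleftrightarrow>
     (\<exists>m F G. is_form r m F \<and> is_form r m G \<and> \<not> vanishes_on F C \<and> \<not> vanishes_on G C \<and>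
        D = form_div r C F - form_div r C G)"

definition lin_equiv :: "nat \<Rightarrow> 'a::field ppoint set \<Rightarrow> 'a pdivisor \<Rightarrow> 'a pdivisor \<Rightarrow> bool" where
  "lin_equiv r C D D' \<longleftrightarrow> principal_divisor r C (D - D')"

definition divisor_class :: "nat \<Rightarrow> 'a::field ppoint set \<Rightarrow> 'a pdivisor \<Rightarrow> 'a pdivisor set" where
  "divisor_class r C D = {D'. divisor_on C D' \<and> lin_equiv r C D' D}"

text \<open>The dimension of the Riemann--Roch space of \<open>D\<close>: the largest number of linearly independent
  rational functions \<open>f\<close> on \<open>C\<close> with \<open>div f + D \<ge> 0\<close>, written with a common denominator \<open>G\<close>.\<close>

definition rr_dim :: "nat \<Rightarrow> 'a::field ppoint set \<Rightarrow> 'a pdivisor \<Rightarrow> nat" where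
  "rr_dim r C D = (GREATEST n. \<exists>m G Fs. is_form r m G \<and> \<not> vanishes_on G C \<and> length Fs = n \<and>
     (\<forall>F\<in>set Fs. is_form r m F \<and>
        (\<forall>P\<in>C. 0 \<le> int (ord_form r C P F) - int (ord_form r C P G) + Poly_Mapping.lookup D P)) \<and>
     (\<forall>a :: nat \<Rightarrow> 'a. vanishes_on (\<Sum>i<n. mconst (a i) * Fs ! i) C \<longrightarrow> (\<forall>i<n. a i = 0)))"

text \<open>The genus is the maximum of \<open>deg D + 1 - l(D)\<close> over all divisors \<open>D\<close> on \<open>C\<close>.\<close>

definition has_genus :: "nat \<Rightarrow> 'a::field ppoint set \<Rightarrow> int \<Rightarrow> bool" where
  "has_genus r C g \<longleftrightarrow>
     (\<forall>D. divisor_on C D \<longrightarrow> div_degree D + 1 - int (rr_dim r C D) \<le> g) \<and>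
     (\<exists>D. divisor_on C D \<and> div_degree D + 1 - int (rr_dim r C D) = g)"


section \<open>Elliptic curves\<close>

text \<open>Curves over \<open>k\<close> are represented by their points over the algebraic closure.\<close>

definition defined_over_base :: "nat \<Rightarrow> 'k::field alg_closure ppoint set \<Rightarrow> bool" where
  "defined_over_base r V \<longleftrightarrow>
     ideal_of r V = ideal_span (forms_vanishing_on r V \<inter> range base_change)"

definition elliptic_curve ::
    "nat \<Rightarrow> 'k::field alg_closure ppoint set \<Rightarrow> 'k alg_closure ppoint \<Rightarrow> bool" where
  "elliptic_curve r E Z \<longleftrightarrow>
     proj_curve r E \<and> defined_over_base r E \<and> (\<forall>P\<in>E. nonsingular_at r E P) \<and> has_genus r E 1 \<and>
     Z \<in> E \<and> rational_point Z"

text \<open>The group law with identity \<open>Z\<close>: the sum of \<open>P\<close> and \<open>Q\<close> is the point \<open>R\<close> for which the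
  divisors \<open>(P) + (Q)\<close> and \<open>(R) + (Z)\<close> are linearly equivalent.\<close>

definition ec_add :: "nat \<Rightarrow> 'a::field ppoint set \<Rightarrow> 'a ppoint \<Rightarrow> 'a ppoint \<Rightarrow> 'a ppoint \<Rightarrow> 'a ppoint"
  where "ec_add r E Z P Q =
    (THE R. R \<in> E \<and> lin_equiv r E (frag_of P + frag_of Q) (frag_of R + frag_of Z))"

definition ec_group :: "nat \<Rightarrow> 'a::field ppoint set \<Rightarrow> 'a ppoint \<Rightarrow> 'a ppoint monoid" where
  "ec_group r E Z = \<lparr>carrier = E, monoid.mult = ec_add r E Z, one = Z\<rparr>"

text \<open>\<open>E\<close> is embedded in projective \<open>r\<close>-space by a complete linear system of degree \<open>d\<close>: linear
  forms restrict injectively to \<open>E\<close>, hyperplane sections have degree \<open>d\<close>, and every effective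
  divisor linearly equivalent to a hyperplane section is a hyperplane section.\<close>

definition embedded_by_complete_linear_system ::
    "nat \<Rightarrow> 'a::field ppoint set \<Rightarrow> nat \<Rightarrow> bool" where
  "embedded_by_complete_linear_system r E d \<longleftrightarrow>
     (\<forall>L. is_form r 1 L \<and> L \<noteq> 0 \<longrightarrow> \<not> vanishes_on L E) \<and>
     (\<forall>L. is_form r 1 L \<and> \<not> vanishes_on L E \<longrightarrow>
        div_degree (form_div r E L) = int d \<and>
        (\<forall>D. divisor_on E D \<and> effective D \<and> lin_equiv r E D (form_div r E L) \<longrightarrow>
           (\<exists>L'. is_form r 1 L' \<and> \<not> vanishes_on L' E \<and> D = form_div r E L')))"

text \<open>The group law is written multiplicatively; the points of a hyperplane section are counted with
  their multiplicities.\<close>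

definition hyperplane_sections_sum_to ::
    "nat \<Rightarrow> 'a::field ppoint set \<Rightarrow> 'a ppoint \<Rightarrow> 'a ppoint \<Rightarrow> bool" where
  "hyperplane_sections_sum_to r E Z S \<longleftrightarrow>
     (\<forall>L. is_form r 1 L \<and> \<not> vanishes_on L E \<longrightarrow>
        finprod (ec_group r E Z) (\<lambda>P. P [^]\<^bsub>ec_group r E Z\<^esub> ord_form r E P L)
          {P \<in> E. vanishes_at L P} = S)"

definition is_embedding_divisor_class ::
    "nat \<Rightarrow> 'k::field alg_closure ppoint set \<Rightarrow> 'k alg_closure ppoint \<Rightarrow>
     'k alg_closure pdivisor set \<Rightarrow> bool" where
  "is_embedding_divisor_class r E Z c \<longleftrightarrow>
     embedded_by_complete_linear_system r E (r + 1) \<and>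
     (\<exists>S\<in>E. rational_point S \<and> hyperplane_sections_sum_to r E Z S \<and>
        c = divisor_class r E (frag_cmul (int r) (frag_of Z) + frag_of S))"


section \<open>Morphisms given by tuples of polynomials over the base field\<close>

definition meval_ac :: "'k::field mpol \<Rightarrow> 'k alg_closure list \<Rightarrow> 'k alg_closure" where
  "meval_ac p x = meval (base_change p) x"

definition morphism_given_by ::
    "nat \<Rightarrow> 'k::field alg_closure ppoint set \<Rightarrow> nat \<Rightarrow> 'k alg_closure ppoint set \<Rightarrow>
     ('k alg_closure ppoint \<Rightarrow> 'k alg_closure ppoint) \<Rightarrow> 'k mpol list list \<Rightarrow> bool" where
  "morphism_given_by r V s W \<phi> ts \<longleftrightarrow>
     \<phi> \<in> V \<rightarrow> W \<and>
     (\<forall>t\<in>set ts. length t = s + 1 \<and> (\<exists>d. \<forall>p\<in>set t. is_form r d p)) \<and>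
     (\<forall>P\<in>V. \<forall>x\<in>P. (\<exists>t\<in>set ts. \<exists>p\<in>set t. meval_ac p x \<noteq> 0) \<and>
        (\<forall>t\<in>set ts. (\<exists>p\<in>set t. meval_ac p x \<noteq> 0) \<longrightarrow> \<phi> P = proj (map (\<lambda>p. meval_ac p x) t)))"

text \<open>The same for a source contained in the product of two projective spaces.\<close>

definition bimorphism_given_by ::
    "nat \<Rightarrow> nat \<Rightarrow> ('k::field alg_closure ppoint \<times> 'k alg_closure ppoint) set \<Rightarrow>
     nat \<Rightarrow> 'k alg_closure ppoint set \<Rightarrow>
     ('k alg_closure ppoint \<times> 'k alg_closure ppoint \<Rightarrow> 'k alg_closure ppoint) \<Rightarrow>
     'k mpol list list \<Rightarrow> bool" where
  "bimorphism_given_by r r' V s W \<phi> ts \<longleftrightarrow>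
     \<phi> \<in> V \<rightarrow> W \<and>
     (\<forall>t\<in>set ts. length t = s + 1 \<and> (\<exists>d e. \<forall>p\<in>set t. is_biform r r' d e p)) \<and>
     (\<forall>(P, Q)\<in>V. \<forall>x\<in>P. \<forall>y\<in>Q. (\<exists>t\<in>set ts. \<exists>p\<in>set t. meval_ac p (x @ y) \<noteq> 0) \<and>
        (\<forall>t\<in>set ts. (\<exists>p\<in>set t. meval_ac p (x @ y) \<noteq> 0) \<longrightarrow>
           \<phi> (P, Q) = proj (map (\<lambda>p. meval_ac p (x @ y)) t)))"

definition bi_zero_locus ::
    "nat \<Rightarrow> nat \<Rightarrow> 'a::field mpol set \<Rightarrow> ('a ppoint \<times> 'a ppoint) set" where
  "bi_zero_locus r s S =
     {(P, Q). P \<in> proj_space r \<and> Q \<in> proj_space s \<and>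
        (\<forall>F\<in>S. \<forall>x\<in>P. \<forall>y\<in>Q. meval F (x @ y) = 0)}"


section \<open>The \<open>\<int>/4\<int>\<close>-normal form\<close>

definition z4_curve :: "'k::field \<Rightarrow> 'k alg_closure ppoint set" where
  "z4_curve c = zero_locus 3 (base_change `
     {(mvar 0 + mvar 1 + mvar 2 + mvar 3) ^ 2 - mconst c * mvar 0 * mvar 2,
      (mvar 0 + mvar 1 + mvar 2 + mvar 3) ^ 2 - mconst c * mvar 1 * mvar 3})"

text \<open>The variables 0, 1, 2, 3 are \<open>U\<^sub>0\<close>, \<open>U\<^sub>1\<close>, \<open>V\<^sub>0\<close>, \<open>V\<^sub>1\<close>.\<close>

definition z4_biquadratic_curve ::
    "'k::field \<Rightarrow> ('k alg_closure ppoint \<times> 'k alg_closure ppoint) set" where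
  "z4_biquadratic_curve c = bi_zero_locus 1 1 (base_change `
     {(mvar 0 + mvar 1) ^ 2 * (mvar 2 + mvar 3) ^ 2
        - mconst c * mvar 0 * mvar 1 * mvar 2 * mvar 3})"

end

(*
  The normalisation X_0 + X_3 = 1 turns E minus the points O and S into the affine curve
  c u (y^2 + y) = (1 + u)^2, on which [-1] is y |-> y + 1 and whose functions are A(u) + B(u) y
  with Laurent polynomials A and B. The function u has divisor 2 (O) - 2 (S); at O and S the
  terms of A and of B y have distinct orders, which determines all functions with prescribed
  poles there.

  Multiplying a form by its conjugate under [-1] gives a binary form in X_0 + X_3 and X_1 + X_2.
  This norm shows that orders are finite and that plane sections have degree 4. If f / g has no
  poles outside a plane section, clearing the roots of the norm of g one at a time (both points
  above a root must be zeros) shows that f / g is a linear form, so E is embedded by a complete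
  linear system. Uniqueness in the group law follows by applying this to the planes through
  O and S, existence by taking planes through three given points.

  Translation by T is read off from the plane through O, T, [-1] P and tau_T(P), whose norm factors.
*)

theory Submission
  imports Defs
begin

section \<open>Evaluation of polynomials\<close>

text \<open>\<open>ord_form\<close> is defined by powers of the ideal of a point, with polynomial
  witnesses that need not be homogeneous, and this shapes the proof. Forms are treated as functions
  on the affine cone, orders are measured by local factorisations h * f = t^n * g with h a unit and
  t a uniformiser, and \<open>ord_form_eq\<close> translates back. Common factors can be cancelled
  because the homogeneous ideal of E is prime, which the hypothesis on E supplies.

  With u = (X1 + X2) / (X0 + X3), the quotient of E by [-1] is an Artin-Schreier cover of the line:
  y^2 + y is a function of u, so the cover is unramified above every u other than 0 and infinity,
  and u - u(p) is a uniformiser at each affine point p. Ramification occurs only at O and S, which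
  need uniformisers of their own.

  The orders at (O, S) are (1, 3) for X0 + X3, (3, 1) for X1 + X2 and (0, 2) for X3. Since u has
  even order at both points, parity separates the terms of A from those of B y. The plane X1 + X2 =
  0 cuts out 3 (O) + (S), whence the embedding class; the plane X3 = 0 cuts out 2 (S) + 2 (T),
  whence 2T = S.\<close>

definition mon_eval :: "(nat \<Rightarrow>\<^sub>0 nat) \<Rightarrow> 'a::comm_semiring_1 list \<Rightarrow> 'a" where
  "mon_eval m x = (\<Prod>i\<in>Poly_Mapping.keys m. nth_default 0 x i ^ Poly_Mapping.lookup m i)"

lemma mon_eval_superset:
  assumes "finite A" "Poly_Mapping.keys m \<subseteq> A"
  shows "mon_eval m x = (\<Prod>i\<in>A. nth_default 0 x i ^ Poly_Mapping.lookup m i)"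
  unfolding mon_eval_def using assms
  by (intro prod.mono_neutral_left) (auto simp: in_keys_iff)

lemma mon_eval_add: "mon_eval (m + n) x = mon_eval m x * mon_eval n x"
proof -
  let ?A = "Poly_Mapping.keys m \<union> Poly_Mapping.keys n"
  have "Poly_Mapping.keys (m + n) \<subseteq> ?A" by (rule keys_add)
  then have "mon_eval (m + n) x = (\<Prod>i\<in>?A. nth_default 0 x i ^ Poly_Mapping.lookup (m + n) i)"
    by (intro mon_eval_superset) auto
  also have "\<dots> = mon_eval m x * mon_eval n x"
    by (simp add: lookup_add power_add prod.distrib mon_eval_superset[of ?A])
  finally show ?thesis .
qed

lemma mon_eval_0 [simp]: "mon_eval 0 x = 1"
  by (simp add: mon_eval_def)

lemma meval_superset:
  assumes "finite A" "Poly_Mapping.keys p \<subseteq> A"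
  shows "meval p x = (\<Sum>m\<in>A. Poly_Mapping.lookup p m * mon_eval m x)"
  unfolding meval_def mon_eval_def[symmetric] using assms
  by (intro sum.mono_neutral_left) (auto simp: in_keys_iff)

lemma meval_0 [simp]: "meval 0 x = 0"
  by (simp add: meval_def)

lemma meval_add [simp]: "meval (p + q) x = meval p x + meval q x"
proof -
  let ?A = "Poly_Mapping.keys p \<union> Poly_Mapping.keys q"
  have "Poly_Mapping.keys (p + q) \<subseteq> ?A" by (rule keys_add)
  then show ?thesis
    by (simp add: meval_superset[of ?A] lookup_add ring_distribs sum.distrib)
qed

lemma meval_single [simp]: "meval (Poly_Mapping.single m a) x = a * mon_eval m x"
  by (subst meval_superset[of "{m}"]) auto

text \<open>The new monomial has a fresh exponent, so nothing cancels and conditions on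
  \<open>keys\<close>, such as homogeneity, pass to both summands.\<close>

lemma mpol_induct [case_names zero add]:
  fixes p :: "'b \<Rightarrow>\<^sub>0 'a::comm_monoid_add"
  assumes "P 0" "\<And>m a p. P p \<Longrightarrow> m \<notin> Poly_Mapping.keys p \<Longrightarrow> a \<noteq> 0 \<Longrightarrow> P (Poly_Mapping.single m a + p)"
  shows "P p"
proof (induction p rule: update_induct)
  case const
  then show ?case using assms(1) by simp
next
  case (update f a b)
  have "Poly_Mapping.update a b f = Poly_Mapping.single a b + f"
    using update
    by (intro poly_mapping_eqI)
      (auto simp: lookup_update lookup_add lookup_single in_keys_iff when_def)
  with assms(2) update show ?case by metis
qed

lemma meval_mult [simp]:
  fixes p q :: "'a::comm_ring_1 mpol"
  shows "meval (p * q) x = meval p x * meval q x"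
proof (induction p rule: mpol_induct)
  case (add m a p)
  have "meval (Poly_Mapping.single m a * q) x = a * mon_eval m x * meval q x"
    by (induction q rule: mpol_induct) (auto simp: ring_distribs mult_single mon_eval_add)
  with add show ?case by (simp add: ring_distribs)
qed auto

lemma meval_1 [simp]: "meval 1 x = 1"
proof -
  have "(1 :: 'a mpol) = Poly_Mapping.single 0 1" by simp
  then show ?thesis by (metis meval_single mon_eval_0 mult.right_neutral)
qed

lemma meval_uminus [simp]: "meval (- p :: 'a::comm_ring_1 mpol) x = - meval p x"
  by (metis add.right_inverse add_eq_0_iff2 meval_0 meval_add)

lemma meval_diff [simp]: "meval (p - q :: 'a::comm_ring_1 mpol) x = meval p x - meval q x"
  using meval_add[of p "- q" x] by simp

lemma meval_power [simp]: "meval (p ^ n :: 'a::comm_ring_1 mpol) x = meval p x ^ n"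
  by (induction n) auto

lemma meval_sum [simp]: "meval (sum f A) x = (\<Sum>a\<in>A. meval (f a) x)"
  by (induction A rule: infinite_finite_induct) auto

lemma meval_mconst [simp]: "meval (mconst a) x = a"
  by (simp add: mconst_def)

lemma meval_mvar [simp]: "meval (mvar i) x = nth_default 0 x i"
  by (simp add: mvar_def mon_eval_def)

lemma base_change_0 [simp]: "base_change 0 = 0"
  by (simp add: base_change_def map_eq_zero_iff)

lemma lookup_base_change: "Poly_Mapping.lookup (base_change p) m = to_ac (Poly_Mapping.lookup p m)"
  by (simp add: base_change_def map.rep_eq when_def)

lemma base_change_add [simp]: "base_change (p + q) = base_change p + base_change q"
  by (intro poly_mapping_eqI) (simp add: lookup_base_change lookup_add)

lemma base_change_diff [simp]: "base_change (p - q) = base_change p - base_change q"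
  by (intro poly_mapping_eqI) (simp add: lookup_base_change lookup_minus)

lemma base_change_single [simp]:
  "base_change (Poly_Mapping.single m a) = Poly_Mapping.single m (to_ac a)"
  by (intro poly_mapping_eqI) (simp add: lookup_base_change lookup_single when_def)

lemma base_change_mult [simp]: "base_change (p * q) = base_change p * base_change q"
proof (induction p rule: mpol_induct)
  case (add m a p)
  have "base_change (Poly_Mapping.single m a * q) = Poly_Mapping.single m (to_ac a) * base_change q"
    by (induction q rule: mpol_induct) (auto simp: ring_distribs mult_single)
  with add show ?case by (simp add: ring_distribs)
qed auto

lemma base_change_mvar [simp]: "base_change (mvar i) = mvar i"
  by (simp add: mvar_def)

lemma base_change_mconst [simp]: "base_change (mconst a) = mconst (to_ac a)"
  by (simp add: mconst_def)

lemma base_change_power2 [simp]: "base_change (p ^ 2) = base_change p ^ 2"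
  by (simp add: power2_eq_square)

section \<open>Forms in four variables as functions\<close>

lemma is_form_0 [simp]: "is_form r d 0"
  by (simp add: is_form_def)

lemma is_form_add: "is_form r d p \<Longrightarrow> is_form r d q \<Longrightarrow> is_form r d (p + q)"
  using keys_add[of p q] unfolding is_form_def by blast

lemma is_form_diff: "is_form r d p \<Longrightarrow> is_form r d q \<Longrightarrow> is_form r d (p - q :: 'a::comm_ring_1 mpol)"
  using keys_diff[of p q] unfolding is_form_def by blast

lemma is_form_mult:
  fixes p q :: "'a::comm_ring_1 mpol"
  assumes "is_form r d p" "is_form r e q"
  shows "is_form r (d + e) (p * q)"
  unfolding is_form_def
proof
  fix m assume "m \<in> Poly_Mapping.keys (p * q)"
  with keys_mult[of p q] obtain a b
    where ab: "m = a + b" "a \<in> Poly_Mapping.keys p" "b \<in> Poly_Mapping.keys q" by blast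
  then show "Poly_Mapping.keys m \<subseteq> {..r} \<and> (\<Sum>i\<le>r. Poly_Mapping.lookup m i) = d + e"
    using assms subset_trans[OF keys_add[of a b], of "{..r}"] unfolding is_form_def
    by (simp add: lookup_add sum.distrib)
qed

lemma is_form_mconst: "is_form r 0 (mconst a)"
  by (simp add: is_form_def mconst_def)

lemma is_form_mvar: "i \<le> r \<Longrightarrow> is_form r 1 (mvar i :: 'a::field mpol)"
  by (auto simp: is_form_def mvar_def lookup_single when_def)

lemma is_form_1: "is_form r 0 (1 :: 'a::field mpol)"
  by (simp add: is_form_def)

lemma is_form_power: "is_form r d p \<Longrightarrow> is_form r (n * d) (p ^ n :: 'a::field mpol)"
  by (induction n) (auto intro: is_form_mult is_form_1)

text \<open>A form is identified with the function it induces on vectors of length four. Values on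
  other lists are left open, so congruence on such vectors is part of every argument.\<close>

definition form_fun :: "nat \<Rightarrow> ('a::field list \<Rightarrow> 'a) \<Rightarrow> bool" where
  "form_fun m f \<longleftrightarrow> (\<exists>F. is_form 3 m F \<and> (\<forall>x. length x = 4 \<longrightarrow> f x = meval F x))"

lemma form_fun_meval: "is_form 3 m F \<Longrightarrow> form_fun m (meval F)"
  by (auto simp: form_fun_def)

lemma form_fun_const: "form_fun 0 (\<lambda>_. a)"
  unfolding form_fun_def by (intro exI[of _ "mconst a"]) (simp add: is_form_mconst)

lemma form_fun_zero: "form_fun m (\<lambda>_. 0)"
  unfolding form_fun_def by (intro exI[of _ 0]) simp

lemma form_fun_nth: "i < 4 \<Longrightarrow> form_fun 1 (\<lambda>x. x ! i)"
  unfolding form_fun_def by (intro exI[of _ "mvar i"]) (simp add: is_form_mvar[of i 3, simplified] nth_default_nth)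

lemma form_fun_add: "form_fun m f \<Longrightarrow> form_fun m g \<Longrightarrow> form_fun m (\<lambda>x. f x + g x)"
  unfolding form_fun_def by (metis is_form_add meval_add)

lemma form_fun_diff: "form_fun m f \<Longrightarrow> form_fun m g \<Longrightarrow> form_fun m (\<lambda>x. f x - g x)"
  unfolding form_fun_def by (metis is_form_diff meval_diff)

lemma form_fun_mult: "form_fun m f \<Longrightarrow> form_fun n g \<Longrightarrow> form_fun (m + n) (\<lambda>x. f x * g x)"
  unfolding form_fun_def by (metis is_form_mult meval_mult)

lemma form_fun_scale: "form_fun m f \<Longrightarrow> form_fun m (\<lambda>x. a * f x)"
  using form_fun_mult[OF form_fun_const] by fastforce

lemma form_fun_power: "form_fun m f \<Longrightarrow> form_fun (n * m) (\<lambda>x. f x ^ n)"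
  unfolding form_fun_def by (metis is_form_power meval_power)

lemma form_fun_power1: "form_fun 1 f \<Longrightarrow> form_fun n (\<lambda>x. f x ^ n)"
  using form_fun_power[of 1 f n] by simp

lemma form_fun_sum: "(\<And>i. i \<in> A \<Longrightarrow> form_fun m (f i)) \<Longrightarrow> form_fun m (\<lambda>x. \<Sum>i\<in>A. f i x)"
  by (induction A rule: infinite_finite_induct) (auto intro: form_fun_zero form_fun_add)

lemma form_fun_cong: "(\<And>x. length x = 4 \<Longrightarrow> f x = g x) \<Longrightarrow> form_fun m f \<Longrightarrow> form_fun m g"
  unfolding form_fun_def by metis

lemma mon_eval_4:
  assumes "Poly_Mapping.keys m \<subseteq> {..3}" "length x = 4"
  shows "mon_eval m x = x!0 ^ Poly_Mapping.lookup m 0 * x!1 ^ Poly_Mapping.lookup m 1 *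
     x!2 ^ Poly_Mapping.lookup m 2 * x!3 ^ Poly_Mapping.lookup m 3"
proof -
  have "mon_eval m x = (\<Prod>i\<in>{..3}. nth_default 0 x i ^ Poly_Mapping.lookup m i)"
    using assms by (intro mon_eval_superset) auto
  also have "{..3::nat} = {0,1,2,3}" by auto
  finally show ?thesis using assms by (simp add: nth_default_nth mult_ac)
qed

text \<open>Forms are built by multiplying with one coordinate at a time instead of adding whole
  monomials. Properties of Leibniz type, such as a first-order expansion at a point, then need only
  be checked for a single coordinate.\<close>

lemma form_fun_induct [consumes 1, case_names zero const var add cong]:
  assumes "form_fun m f"
    and "\<And>m. P m (\<lambda>_. 0)" "\<And>a. P 0 (\<lambda>_. a)"
    and var: "\<And>m f i. i < 4 \<Longrightarrow> form_fun m f \<Longrightarrow> P m f \<Longrightarrow> P (Suc m) (\<lambda>x. x ! i * f x)"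
    and "\<And>m f g. form_fun m f \<Longrightarrow> form_fun m g \<Longrightarrow> P m f \<Longrightarrow> P m g \<Longrightarrow> P m (\<lambda>x. f x + g x)"
    and cong: "\<And>m f g. (\<And>x. length x = 4 \<Longrightarrow> f x = g x) \<Longrightarrow> P m f \<Longrightarrow> P m g"
  shows "P m f"
proof -
  from assms(1) obtain F where F: "is_form 3 m F" "\<And>x. length x = 4 \<Longrightarrow> f x = meval F x"
    unfolding form_fun_def by blast
  have pow: "P (n + k) (\<lambda>x. x ! i ^ n * f x)" if "i < 4" "form_fun k f" "P k f" for i n k f
  proof (induction n)
    case 0
    then show ?case using that by simp
  next
    case (Suc n)
    have "form_fun (n + k) (\<lambda>x. x ! i ^ n * f x)"
      using form_fun_mult[OF form_fun_power1[OF form_fun_nth] that(2)] that(1) by blast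
    from var[OF that(1) this Suc] show ?case by (simp add: mult_ac)
  qed
  have mon: "P m (meval (Poly_Mapping.single e a))"
    if "Poly_Mapping.keys e \<subseteq> {..3}" "(\<Sum>i\<le>3. Poly_Mapping.lookup e i) = m" for e a m
  proof -
    let ?l = "Poly_Mapping.lookup e"
    note fp = form_fun_mult[OF form_fun_power1[OF form_fun_nth]]
    have 0: "form_fun 0 (\<lambda>x. a)" "P 0 (\<lambda>x. a)" by (rule form_fun_const, rule assms(3))
    have 1: "form_fun (?l 3 + 0) (\<lambda>x. x!3 ^ ?l 3 * a)" "P (?l 3 + 0) (\<lambda>x. x!3 ^ ?l 3 * a)"
      by (rule fp[of 3, OF _ 0(1)], simp, rule pow[of 3, OF _ 0], simp)
    have 2: "form_fun (?l 2 + (?l 3 + 0)) (\<lambda>x. x!2 ^ ?l 2 * (x!3 ^ ?l 3 * a))"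
      "P (?l 2 + (?l 3 + 0)) (\<lambda>x. x!2 ^ ?l 2 * (x!3 ^ ?l 3 * a))"
      by (rule fp[of 2, OF _ 1(1)], simp, rule pow[of 2, OF _ 1], simp)
    have 3: "form_fun (?l 1 + (?l 2 + (?l 3 + 0))) (\<lambda>x. x!1 ^ ?l 1 * (x!2 ^ ?l 2 * (x!3 ^ ?l 3 * a)))"
      "P (?l 1 + (?l 2 + (?l 3 + 0))) (\<lambda>x. x!1 ^ ?l 1 * (x!2 ^ ?l 2 * (x!3 ^ ?l 3 * a)))"
      by (rule fp[of 1, OF _ 2(1)], simp, rule pow[of 1, OF _ 2], simp)
    have 4: "P (?l 0 + (?l 1 + (?l 2 + (?l 3 + 0)))) (\<lambda>x. x!0 ^ ?l 0 * (x!1 ^ ?l 1 * (x!2 ^ ?l 2 * (x!3 ^ ?l 3 * a))))"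
      by (rule pow[of 0, OF _ 3]) simp
    have deg: "?l 0 + (?l 1 + (?l 2 + (?l 3 + 0))) = m"
    proof -
      have "{..3::nat} = {0,1,2,3}" by auto
      then show ?thesis using that(2) by simp
    qed
    show ?thesis
      by (rule cong[OF _ 4[unfolded deg]]) (simp add: mon_eval_4[OF that(1)] mult_ac)
  qed
  have "P m (meval F)"
    using F(1)
  proof (induction F rule: mpol_induct)
    case zero
    have "meval (0 :: 'a mpol) = (\<lambda>_. 0)" by (simp add: fun_eq_iff)
    then show ?case using assms(2) by metis
  next
    case (add e a p)
    have keys: "Poly_Mapping.keys (Poly_Mapping.single e a + p) = insert e (Poly_Mapping.keys p)"
      using add(2,3) by (auto simp: in_keys_iff lookup_add lookup_single when_def split: if_splits)
    from add(4) have e: "Poly_Mapping.keys e \<subseteq> {..3}" "(\<Sum>i\<le>3. Poly_Mapping.lookup e i) = m"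
      and p: "is_form 3 m p"
      unfolding is_form_def keys by auto
    have se: "is_form 3 m (Poly_Mapping.single e a)"
      using e by (auto simp: is_form_def)
    have "P m (\<lambda>x. meval (Poly_Mapping.single e a) x + meval p x)"
      by (rule assms(5)[OF form_fun_meval[OF se] form_fun_meval[OF p] mon[OF e] add(1)[OF p]])
    then show ?case by (simp del: meval_single flip: meval_add)
  qed
  from cong[OF _ this] F(2) show ?thesis by simp
qed

lemma form_fun_scaled:
  assumes "form_fun m f" "length x = 4"
  shows "f (map ((*) t) x) = t ^ m * f x"
  using assms(1)
proof (induction rule: form_fun_induct)
  case (var m f i)
  then show ?case using assms(2) by (simp add: mult_ac)
next
  case (cong m f g)
  then show ?case using assms(2) by (metis length_map)
qed (auto simp: ring_distribs)

lemma form_fun_rev: "form_fun m f \<Longrightarrow> form_fun m (\<lambda>x. f (rev x))"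
proof (induction rule: form_fun_induct)
  case (var m f i)
  have "form_fun (1 + m) (\<lambda>x. x ! (3 - i) * f (rev x))"
    using var by (intro form_fun_mult form_fun_nth) auto
  then have "form_fun (Suc m) (\<lambda>x. x ! (3 - i) * f (rev x))" by simp
  then show ?case by (rule form_fun_cong[rotated]) (use var(1) in \<open>simp add: rev_nth numeral_eq_Suc\<close>)
next
  case (cong m f g)
  show ?case by (rule form_fun_cong[OF _ cong(2)]) (simp add: cong(1))
next
  case (add m f g)
  then show ?case by (intro form_fun_add)
qed (rule form_fun_zero form_fun_const)+

lemma form_fun_1_iff: "form_fun 1 f \<longleftrightarrow> (\<exists>a b c d. \<forall>x. length x = 4 \<longrightarrow> f x = a * x!0 + b * x!1 + c * x!2 + d * x!3)"
proof
  assume "form_fun 1 f"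
  \<comment> \<open>Degrees 0 and 1 are treated together, since a linear form arises from a
    coordinate times a form of degree 0.\<close>
  have *: "if m = 0 then \<exists>a. \<forall>x. length x = 4 \<longrightarrow> f x = a else m = 1 \<longrightarrow>
     (\<exists>a b c d. \<forall>x. length x = 4 \<longrightarrow> f x = a * x!0 + b * x!1 + c * x!2 + d * x!3)"
    if "form_fun m f" for m and f :: "'a list \<Rightarrow> 'a"
    using that
  proof (induction rule: form_fun_induct)
    case (zero m)
    show ?case by (auto intro!: exI[of _ 0])
  next
    case (var m f i)
    show ?case
    proof (cases "m = 0")
      case True
      with var obtain a where a: "\<And>x. length x = 4 \<Longrightarrow> f x = a" by auto
      from var(1) consider "i = 0" | "i = 1" | "i = 2" | "i = 3" by linarith
      then have "\<exists>b0 b1 b2 b3. \<forall>x. length x = 4 \<longrightarrow>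
          x ! i * f x = b0 * x!0 + b1 * x!1 + b2 * x!2 + b3 * x!3"
        by cases (rule exI[of _ "if i = 0 then a else 0"], rule exI[of _ "if i = 1 then a else 0"],
            rule exI[of _ "if i = 2 then a else 0"], rule exI[of _ "if i = 3 then a else 0"],
            simp add: a)+
      then show ?thesis by simp
    qed simp
  next
    case (add m f g)
    show ?case
    proof (cases "m = 0")
      case True
      with add show ?thesis by fastforce
    next
      case False
      show ?thesis
      proof (cases "m = 1")
        case True
        with add obtain a b c d a' b' c' d'
          where "\<And>x. length x = 4 \<Longrightarrow> f x = a * x!0 + b * x!1 + c * x!2 + d * x!3"
            "\<And>x. length x = 4 \<Longrightarrow> g x = a' * x!0 + b' * x!1 + c' * x!2 + d' * x!3" by auto
        then have "\<forall>x. length x = 4 \<longrightarrow> f x + g x =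
           (a + a') * x!0 + (b + b') * x!1 + (c + c') * x!2 + (d + d') * x!3"
          by (simp add: ring_distribs)
        with True show ?thesis by auto
      qed (use False in auto)
    qed
  next
    case (cong m f g)
    then show ?case by (auto split: if_splits)
  qed auto
  from *[OF \<open>form_fun 1 f\<close>] show "\<exists>a b c d. \<forall>x. length x = 4 \<longrightarrow> f x = a * x!0 + b * x!1 + c * x!2 + d * x!3"
    by simp
next
  assume "\<exists>a b c d. \<forall>x. length x = 4 \<longrightarrow> f x = a * x!0 + b * x!1 + c * x!2 + d * x!3"
  then obtain a b c d where *: "\<And>x. length x = 4 \<Longrightarrow> f x = a * x!0 + b * x!1 + c * x!2 + d * x!3"
    by blast
  have "form_fun 1 (\<lambda>x. a * x!0 + b * x!1 + c * x!2 + d * x!3)"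
    by (intro form_fun_add form_fun_scale form_fun_nth) auto
  then show "form_fun 1 f" by (rule form_fun_cong[rotated]) (simp add: *)
qed

text \<open>Variables beyond the fourth vanish on lists of length four.\<close>

lemma meval_form_fun_decomposition:
  fixes Q :: "'a::field mpol"
  shows "\<exists>B g. (\<forall>n. form_fun n (g n)) \<and> (\<forall>x. length x = 4 \<longrightarrow> meval Q x = (\<Sum>n\<le>B. g n x))"
proof (induction Q rule: mpol_induct)
  case zero
  then show ?case by (intro exI[of _ 0] exI[of _ "\<lambda>_ _. 0"]) (simp add: form_fun_zero)
next
  case (add m a p)
  then obtain B g where g: "\<And>n. form_fun n (g n)" "\<And>x. length x = 4 \<Longrightarrow> meval p x = (\<Sum>n\<le>B. g n x)"
    by blast
  define d where "d = (\<Sum>i\<le>3. Poly_Mapping.lookup m i)"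
  show ?case
  proof (cases "Poly_Mapping.keys m \<subseteq> {..3}")
    case True
    then have "is_form 3 d (Poly_Mapping.single m a)" by (auto simp: is_form_def d_def)
    from form_fun_meval[OF this] have fs: "form_fun d (meval (Poly_Mapping.single m a))" .
    define g' where "g' n x = (if n \<le> B then g n x else 0) +
       (if n = d then meval (Poly_Mapping.single m a) x else 0)" for n x
    have "form_fun n (g' n)" for n
    proof -
      have "form_fun n (\<lambda>x. if n \<le> B then g n x else 0)"
        using g(1)[of n] by (cases "n \<le> B") (auto intro: form_fun_zero)
      moreover have "form_fun n (\<lambda>x. if n = d then meval (Poly_Mapping.single m a) x else 0)"
        using fs by (cases "n = d") (auto intro: form_fun_zero simp del: meval_single)
      ultimately show ?thesis unfolding g'_def by (rule form_fun_add)
    qed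
    moreover have "meval (Poly_Mapping.single m a + p) x = (\<Sum>n\<le>max B d. g' n x)" if "length x = 4" for x
    proof -
      have "(\<Sum>n\<le>max B d. if n \<le> B then g n x else 0) = (\<Sum>n\<le>B. g n x)"
        by (intro sum.mono_neutral_cong_right) auto
      then show ?thesis using g(2)[OF that]
        by (simp add: g'_def sum.distrib)
    qed
    ultimately show ?thesis by blast
  next
    case False
    then obtain i where i: "i \<in> Poly_Mapping.keys m" "i > 3" by force
    have "mon_eval m x = 0" if "length x = 4" for x :: "'a list"
      unfolding mon_eval_def using i that
      by (intro prod_zero) (auto intro!: bexI[of _ i] simp: nth_default_def in_keys_iff)
    then show ?thesis using g by (intro exI[of _ B] exI[of _ g]) simp
  qed
qed

section \<open>The affine cone over the curve\<close>

text \<open>In characteristic 2, \<open>xi\<close> and \<open>eta\<close> span the linear forms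
  vanishing at both \<open>ptO\<close> and \<open>ptS\<close>. They are invariant under reversal of
  the coordinates, and \<open>eta\<close> / \<open>xi\<close> is the function u that identifies a
  point with its negative.\<close>

definition xi :: "'a::field list \<Rightarrow> 'a" where "xi x = x!0 + x!3"
definition eta :: "'a::field list \<Rightarrow> 'a" where "eta x = x!1 + x!2"

text \<open>The coordinate vectors of the points of E rather than the points themselves, so that
  forms have values.\<close>

definition z4_cone :: "'a::field \<Rightarrow> 'a list set" where
  "z4_cone c = {x. length x = 4 \<and> (\<exists>a\<in>set x. a \<noteq> 0) \<and>
     (x!0 + x!1 + x!2 + x!3)\<^sup>2 = c * x!0 * x!2 \<and> (x!0 + x!1 + x!2 + x!3)\<^sup>2 = c * x!1 * x!3}"

definition ptO :: "'a::field list" where "ptO = [1, 0, 0, 1]"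
definition ptS :: "'a::field list" where "ptS = [0, 1, 1, 0]"
text \<open>On the curve, normalising \<open>X\<^sub>0 + X\<^sub>3 = 1\<close> and putting \<open>u = X\<^sub>1 + X\<^sub>2\<close>, \<open>y = X\<^sub>3\<close> yields
  the following coordinates; only \<open>ptO\<close> and \<open>ptS\<close> lie on the plane \<open>X\<^sub>0 + X\<^sub>3 = 0\<close>.\<close>

definition pt :: "'a::field \<Rightarrow> 'a \<Rightarrow> 'a list" where "pt u y = [y + 1, u * (y + 1), u * y, y]"

lemma form_fun_xi: "form_fun 1 xi" and form_fun_eta: "form_fun 1 eta"
  unfolding xi_def eta_def by (intro form_fun_add form_fun_nth; simp)+

lemma list4_cases:
  assumes "length x = 4"
  obtains a b c d where "x = [a, b, c, d]"
  using assms by (auto simp: numeral_eq_Suc length_Suc_conv)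

lemma z4_cone_scaled:
  assumes "x \<in> z4_cone c" "t \<noteq> 0"
  shows "map ((*) t) x \<in> z4_cone c"
proof -
  from assms obtain x0 x1 x2 x3 where x: "x = [x0, x1, x2, x3]"
    by (metis (mono_tags, lifting) list4_cases mem_Collect_eq z4_cone_def)
  have "t * x0 + t * x1 + t * x2 + t * x3 = t * (x0 + x1 + x2 + x3)" by (simp add: ring_distribs)
  then show ?thesis using assms unfolding z4_cone_def x
    by (auto simp: power_mult_distrib) (simp_all add: power2_eq_square)
qed

lemma alg_closed_infinite: "infinite (UNIV :: 'a::alg_closed_field set)"
proof
  assume fin: "finite (UNIV :: 'a set)"
  \<comment> \<open>Euclid's argument: a polynomial of positive degree that takes the value 1
    everywhere.\<close>
  define p where "p = (\<Prod>a\<in>(UNIV::'a set). [:-a, 1:]) + 1"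
  have "degree (\<Prod>a\<in>(UNIV::'a set). [:-a, 1:]) = card (UNIV :: 'a set)"
    by (subst degree_prod_sum_eq) auto
  moreover have "card (UNIV :: 'a set) > 0" using fin by (simp add: card_gt_0_iff)
  ultimately have "degree p > 0" unfolding p_def by (subst degree_add_eq_left) auto
  then obtain x where "poly p x = 0" using alg_closed_imp_poly_has_root by blast
  moreover have "poly (\<Prod>a\<in>(UNIV::'a set). [:-a, 1:]) x = 0"
    using fin by (auto simp: poly_prod intro!: prod_zero bexI[of _ x])
  ultimately show False by (simp add: p_def)
qed

lemma poly_zero_if_cofinite_roots:
  fixes p :: "'a::alg_closed_field poly"
  assumes "finite A" "\<And>x. x \<notin> A \<Longrightarrow> poly p x = 0"
  shows "p = 0"
proof (rule ccontr)
  assume "p \<noteq> 0"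
  then have "finite {x. poly p x = 0}" by (rule poly_roots_finite)
  moreover have "UNIV \<subseteq> A \<union> {x. poly p x = 0}" using assms(2) by auto
  ultimately have "finite (UNIV :: 'a set)" using assms(1) by (meson finite_UnI finite_subset)
  then show False using alg_closed_infinite by blast
qed

text \<open>The setting extracted from the hypothesis that E is an elliptic curve. Irreducibility
  enters as the assumption \<open>prime\<close>, the primality of the homogeneous ideal of E, stated
  on the cone.\<close>

locale z4_model =
  fixes c :: "'a::alg_closed_field"
  assumes char2: "(2::'a) = 0" and c_nz: "c \<noteq> 0"
    and prime: "\<lbrakk>is_form 3 d F; is_form 3 e G; \<forall>x\<in>z4_cone c. meval F x * meval G x = 0\<rbrakk>
      \<Longrightarrow> (\<forall>x\<in>z4_cone c. meval F x = 0) \<or> (\<forall>x\<in>z4_cone c. meval G x = 0)"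
begin

declare char2 [simp]

abbreviation "C \<equiv> z4_cone c"

definition on_curve :: "'a \<Rightarrow> 'a \<Rightarrow> bool" where
  "on_curve u y \<longleftrightarrow> c * u * (y\<^sup>2 + y) = (1 + u)\<^sup>2"

text \<open>\<open>N\<close> contains exactly one coordinate vector of each point.\<close>

definition N :: "'a list set" where
  "N = {ptO, ptS} \<union> {pt u y | u y. on_curve u y}"

lemma add_self [simp]: "(x::'a) + x = 0"
  using char2 by (metis mult_2 mult_zero_left)

lemma add_self2 [simp]: "(x::'a) + (x + y) = y"
  by (simp flip: add.assoc)

lemma minus_is_plus: "(x::'a) - y = x + y"
  by (simp add: diff_eq_eq add.assoc)

lemma add_eq_0_char2: "(x::'a) + y = 0 \<longleftrightarrow> x = y"
  by (metis add_self add_right_cancel)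

lemma square_add: "((x::'a) + y)\<^sup>2 = x\<^sup>2 + y\<^sup>2"
  by (simp add: power2_sum char2)

lemma C_length: "x \<in> C \<Longrightarrow> length x = 4"
  by (simp add: z4_cone_def)

text \<open>Comparing the two equations and dividing by c gives the quadric x0 x2 = x1 x3, on which
  the ratios x1 : x0 and x2 : x3 both agree with \<open>eta\<close> : \<open>xi\<close>. The last
  relation, x0 times the second equation plus x3 times the first, is the homogeneous version of the
  affine equation.\<close>

lemma C_rel:
  assumes "x \<in> C"
  shows "x!0 * x!2 = x!1 * x!3" "(xi x + eta x)\<^sup>2 = c * x!0 * x!2"
    "x!2 * xi x = eta x * x!3" "x!1 * xi x = eta x * x!0"
    "c * eta x * x!0 * x!3 = xi x * (xi x + eta x)\<^sup>2"
proof -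
  let ?s = "(x!0 + x!1 + x!2 + x!3)\<^sup>2"
  have s: "?s = c * x!0 * x!2" "?s = c * x!1 * x!3" using assms by (auto simp: z4_cone_def)
  have s': "(xi x + eta x)\<^sup>2 = ?s" by (simp add: xi_def eta_def add_ac)
  show 0: "x!0 * x!2 = x!1 * x!3" using s c_nz by (simp add: mult.assoc)
  show "(xi x + eta x)\<^sup>2 = c * x!0 * x!2" using s s' by simp
  show "x!2 * xi x = eta x * x!3" "x!1 * xi x = eta x * x!0" using 0
    by (simp_all add: xi_def eta_def algebra_simps)
  have "c * eta x * x!0 * x!3 = x!0 * (c * x!1 * x!3) + x!3 * (c * x!0 * x!2)"
    by (simp add: eta_def algebra_simps)
  also have "\<dots> = xi x * (xi x + eta x)\<^sup>2"
    unfolding s(1)[symmetric] s(2)[symmetric] s' by (simp add: xi_def algebra_simps)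
  finally show "c * eta x * x!0 * x!3 = xi x * (xi x + eta x)\<^sup>2" .
qed

lemma on_curve_nz: "on_curve u y \<Longrightarrow> u \<noteq> 0"
  by (auto simp: on_curve_def)

lemma xi_simps [simp]: "xi (ptO :: 'a list) = 0" "xi (ptS :: 'a list) = 0" "xi (pt u y) = (1::'a)"
  "eta (ptO :: 'a list) = 0" "eta (ptS :: 'a list) = 0" "eta (pt u y) = (u::'a)"
  by (simp_all add: xi_def eta_def ptO_def ptS_def pt_def ring_distribs add.assoc add.commute[of y])

lemma N_subset_C: "p \<in> N \<Longrightarrow> p \<in> C"
proof -
  have "pt u y \<in> C" if "on_curve u y" for u y
  proof -
    have s: "y + 1 + u * (y + 1) + u * y + y = 1 + u"
      by (simp add: ring_distribs add_ac)
    have "(1 + u)\<^sup>2 = c * u * (y\<^sup>2 + y)" using that by (simp add: on_curve_def)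
    then have "(1 + u)\<^sup>2 = c * (y + 1) * (u * y)" "(1 + u)\<^sup>2 = c * (u * (y + 1)) * y"
      by (simp_all add: power2_eq_square algebra_simps)
    moreover have "y + 1 \<noteq> 0 \<or> y \<noteq> 0" by auto
    ultimately show ?thesis unfolding z4_cone_def pt_def by (auto simp: s)
  qed
  moreover have "ptO \<in> C" "ptS \<in> C"
    by (auto simp: z4_cone_def ptO_def ptS_def)
  ultimately show "p \<in> N \<Longrightarrow> p \<in> C" by (auto simp: N_def)
qed

lemma C_affine:
  assumes "x \<in> C" "xi x = 1"
  shows "x = pt (eta x) (x!3)" "on_curve (eta x) (x!3)"
proof -
  from assms C_length obtain x0 x1 x2 x3 where x: "x = [x0, x1, x2, x3]" by (metis list4_cases)
  have x0: "x0 = x3 + 1" using assms(2) x by (simp add: xi_def) (metis add_self2 add.commute)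
  show "x = pt (eta x) (x!3)" using C_rel(3,4)[OF assms(1)] assms(2) x x0 by (simp add: pt_def)
  have "c * eta x * x!0 * x!3 = (1 + eta x)\<^sup>2" using C_rel(5)[OF assms(1)] assms(2) by simp
  then show "on_curve (eta x) (x!3)" by (simp add: on_curve_def x x0 power2_eq_square algebra_simps)
qed

lemma C_cases:
  assumes "x \<in> C"
  obtains t p where "t \<noteq> 0" "p \<in> N" "x = map ((*) t) p"
proof (cases "xi x = 0")
  case False
  let ?y = "map ((*) (inverse (xi x))) x"
  have "?y \<in> C" using z4_cone_scaled[OF assms, of "inverse (xi x)"] False by simp
  moreover have "xi ?y = inverse (xi x) * xi x"
    using C_length[OF assms] by (simp add: xi_def ring_distribs)
  then have "xi ?y = 1" using False by simp
  ultimately have "?y \<in> N" using C_affine[of ?y] by (auto simp: N_def)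
  moreover have "x = map ((*) (xi x)) ?y" using False by (auto simp: o_def intro!: map_idI[symmetric])
  ultimately show ?thesis using False that by blast
next
  case True
  from assms C_length obtain x0 x1 x2 x3 where x: "x = [x0, x1, x2, x3]" by (metis list4_cases)
  from True have x3: "x3 = x0" by (simp add: x xi_def add_eq_0_char2)
  have "x2 * xi x = eta x * x3" "x1 * xi x = eta x * x0"
    using C_rel(3,4)[OF assms] by (simp_all add: x)
  with True x3 have *: "eta x = 0 \<or> x0 = 0" by simp
  have e: "(eta x)\<^sup>2 = c * x0 * x2" using C_rel(2)[OF assms] True by (simp add: x)
  have e': "x0 * x2 = x1 * x0" using C_rel(1)[OF assms] x3 by (simp add: x)
  have nonvanishing: "x0 \<noteq> 0 \<or> x1 \<noteq> 0 \<or> x2 \<noteq> 0" using assms x3 by (auto simp: z4_cone_def x)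
  show ?thesis
  proof (cases "x0 = 0")
    case True
    with e have "x1 = x2" by (simp add: eta_def x add_eq_0_char2)
    with True x3 nonvanishing show ?thesis by (intro that[of x1 ptS]) (auto simp: x ptS_def N_def)
  next
    case False
    with * e c_nz e' have "x2 = 0" "x1 = 0" by auto
    with False x3 show ?thesis by (intro that[of x0 ptO]) (auto simp: x ptO_def N_def)
  qed
qed

lemma on_curve_exists:
  assumes "u \<noteq> 0"
  obtains y where "on_curve u y"
proof -
  let ?p = "[:(1 + u)\<^sup>2 / (c * u), 1, 1:]"
  have "degree ?p > 0" by simp
  then obtain y where "poly ?p y = 0" using alg_closed_imp_poly_has_root by blast
  then have "(1 + u)\<^sup>2 / (c * u) + (y\<^sup>2 + y) = 0"
    by (simp add: power2_eq_square ring_distribs add_ac)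
  then have "(1 + u)\<^sup>2 / (c * u) = y\<^sup>2 + y" by (simp only: add_eq_0_char2)
  then have "on_curve u y" using assms c_nz by (simp add: on_curve_def field_simps)
  then show ?thesis by (rule that)
qed

subsection \<open>Forms on the cone\<close>

definition nonvanishing :: "('a list \<Rightarrow> 'a) \<Rightarrow> bool" where "nonvanishing f \<longleftrightarrow> (\<exists>x\<in>C. f x \<noteq> 0)"

lemma nonvanishingI: "x \<in> C \<Longrightarrow> f x \<noteq> 0 \<Longrightarrow> nonvanishing f"
  by (auto simp: nonvanishing_def)

lemma form_fun_prime:
  assumes "form_fun m f" "form_fun n g" "\<And>x. x \<in> C \<Longrightarrow> f x * g x = 0"
  shows "\<not> nonvanishing f \<or> \<not> nonvanishing g"
proof -
  from assms obtain F G where FG: "is_form 3 m F" "is_form 3 n G"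
    "\<And>x. length x = 4 \<Longrightarrow> f x = meval F x" "\<And>x. length x = 4 \<Longrightarrow> g x = meval G x"
    unfolding form_fun_def by blast
  have "\<forall>x\<in>C. meval F x * meval G x = 0" using assms(3) FG(3,4) C_length by metis
  from prime[OF FG(1,2) this] show ?thesis using FG(3,4) C_length by (metis nonvanishing_def)
qed

lemma nonvanishing_mult: "form_fun m f \<Longrightarrow> form_fun n g \<Longrightarrow> nonvanishing f \<Longrightarrow> nonvanishing g \<Longrightarrow> nonvanishing (\<lambda>x. f x * g x)"
  using form_fun_prime unfolding nonvanishing_def by metis

lemma nonvanishing_const: "a \<noteq> 0 \<Longrightarrow> nonvanishing (\<lambda>_. a)"
  using N_subset_C[of ptO] by (intro nonvanishingI[of ptO]) (auto simp: N_def)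

lemma nonvanishing_power: "nonvanishing f \<Longrightarrow> nonvanishing (\<lambda>x. f x ^ n)"
  unfolding nonvanishing_def by (metis power_not_zero)

text \<open>Scaling a vector by t multiplies the common value by t^m and by t^n. As the field is
  infinite, the exponents agree. This recovers degrees that \<open>has_ord\<close> and
  \<open>ord_at_least\<close> leave unspecified.\<close>

lemma form_fun_degree_unique:
  assumes "form_fun m f" "form_fun n g" "\<And>x. x \<in> C \<Longrightarrow> f x = g x" "nonvanishing f"
  shows "m = n"
proof (rule ccontr)
  assume "m \<noteq> n"
  from assms(4) obtain x where x: "x \<in> C" "f x \<noteq> 0" by (auto simp: nonvanishing_def)
  define p :: "'a poly" where "p = monom 1 m - monom 1 n"
  have "p = 0"
  proof (rule poly_zero_if_cofinite_roots[of "{0}"])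
    fix t :: 'a assume "t \<notin> {0}"
    then have "f (map ((*) t) x) = g (map ((*) t) x)" using assms(3)[OF z4_cone_scaled[OF x(1), of t]] by simp
    then have "t ^ m * f x = t ^ n * f x"
      using form_fun_scaled[OF assms(1) C_length[OF x(1)]] form_fun_scaled[OF assms(2) C_length[OF x(1)]]
        assms(3)[OF x(1)] by simp
    with x(2) show "poly p t = 0" by (simp add: p_def poly_monom)
  qed simp
  then have "coeff p m = 0" by simp
  with \<open>m \<noteq> n\<close> show False by (simp add: p_def)
qed

text \<open>Primality applies to f - g only if this is a form, that is, if m = n. When l * f is not
  identically zero on the cone, uniqueness of the degree supplies this; otherwise primality makes
  both f and g vanish.\<close>

lemma form_fun_cancel:
  assumes "form_fun k l" "form_fun m f" "form_fun n g" "nonvanishing l" "\<And>x. x \<in> C \<Longrightarrow> l x * f x = l x * g x" "x \<in> C"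
  shows "f x = g x"
proof (cases "nonvanishing (\<lambda>x. l x * f x)")
  case True
  from form_fun_degree_unique[OF form_fun_mult[OF assms(1,2)] form_fun_mult[OF assms(1,3)] assms(5) True]
  have "m = n" by simp
  with assms have "form_fun m (\<lambda>x. f x - g x)" by (auto intro: form_fun_diff)
  from form_fun_prime[OF assms(1) this] assms(4,5,6) show ?thesis by (auto simp: nonvanishing_def ring_distribs)
next
  case False
  then have "\<not> nonvanishing (\<lambda>x. l x * g x)" using assms(5) by (auto simp: nonvanishing_def)
  with False nonvanishing_mult assms have "\<not> nonvanishing f" "\<not> nonvanishing g" by blast+
  with assms(6) show ?thesis by (auto simp: nonvanishing_def)
qed

lemma nonvanishing_xi: "nonvanishing xi" and nonvanishing_eta: "nonvanishing eta"
proof -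
  obtain y where "on_curve 1 y" using on_curve_exists[of 1] by auto
  then have "pt 1 y \<in> C" using N_subset_C by (auto simp: N_def)
  then show "nonvanishing xi" "nonvanishing eta" by (auto intro: nonvanishingI[of "pt 1 y"])
qed

text \<open>After multiplication by \<open>xi\<close> the identity is trivial on the plane
  \<open>xi\<close> = 0 and holds elsewhere by scaling; the factor is then cancelled. Identities of
  forms can thus be checked on the affine curve.\<close>

lemma form_fun_eq_if_affine_eq:
  assumes "form_fun m f" "form_fun m g" "\<And>x. x \<in> C \<Longrightarrow> xi x = 1 \<Longrightarrow> f x = g x" "x \<in> C"
  shows "f x = g x"
proof -
  have "xi x * f x = xi x * g x" if x: "x \<in> C" for x
  proof (cases "xi x = 0")
    case False
    from x obtain t p where tp: "t \<noteq> 0" "p \<in> N" "x = map ((*) t) p" by (rule C_cases)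
    then have "xi x = t * xi p" using form_fun_scaled[OF form_fun_xi C_length[OF N_subset_C[OF tp(2)]]] by simp
    with False tp(2) have "xi p = 1" by (auto simp: N_def)
    with assms(3) N_subset_C tp(2) have "f p = g p" by blast
    then show ?thesis
      using form_fun_scaled[OF assms(1) C_length[OF N_subset_C[OF tp(2)]]]
        form_fun_scaled[OF assms(2) C_length[OF N_subset_C[OF tp(2)]]] tp(3) by simp
  qed simp
  from form_fun_cancel[OF form_fun_xi assms(1,2) nonvanishing_xi this assms(4)] show ?thesis .
qed

subsection \<open>Uniformizers\<close>

text \<open>Uniformisers in the form of linear forms. The partial derivative of c u (y^2 + y) + (1 +
  u)^2 with respect to y is c u, which is nonzero on the affine curve, so u minus its value serves
  at every affine point. At \<open>ptO\<close> the form \<open>eta\<close> vanishes to order 3 and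
  \<open>xi\<close> has to be taken; at \<open>ptS\<close> the roles are exchanged.\<close>

definition unif :: "'a list \<Rightarrow> 'a list \<Rightarrow> 'a" where
  "unif p = (if p = ptO then xi else if p = ptS then eta else (\<lambda>x. eta x - eta p * xi x))"

text \<open>A linear form with value 1 at p. Its powers make the constant f(p) homogeneous, so that
  it can be subtracted from a form f.\<close>

definition unit_at :: "'a list \<Rightarrow> 'a list \<Rightarrow> 'a" where
  "unit_at p x = (if p = ptO then x!0 else if p = ptS then x!1 else xi x)"

lemma ptO_ne [simp]: "ptO \<noteq> (ptS :: 'a list)" "ptS \<noteq> (ptO :: 'a list)"
    "pt u y \<noteq> (ptS :: 'a list)" "pt u y \<noteq> (ptO :: 'a list)" "ptS \<noteq> (pt u y :: 'a list)" "ptO \<noteq> (pt u y :: 'a list)"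
proof -
  have "pt u y \<noteq> p" if "xi p = 0" for p
    using that xi_simps(3)[of u y] by force
  from this[of ptS] this[of ptO] show "pt u y \<noteq> (ptS :: 'a list)" "pt u y \<noteq> (ptO :: 'a list)"
    "ptS \<noteq> (pt u y :: 'a list)" "ptO \<noteq> (pt u y :: 'a list)" by force+
qed (simp_all add: ptO_def ptS_def)

lemma pt_inject [simp]: "pt u y = pt u' y' \<longleftrightarrow> u = u' \<and> y = (y' :: 'a)"
proof
  assume *: "pt u y = pt u' y'"
  then have "eta (pt u y) = eta (pt u' y')" by simp
  then have "u = u'" by (simp only: xi_simps)
  with * show "u = u' \<and> y = y'" by (simp add: pt_def)
qed simp

lemma form_fun_unif: "form_fun 1 (unif p)"
proof -
  have "form_fun 1 (\<lambda>x. eta x - eta p * xi x)" by (intro form_fun_diff form_fun_scale form_fun_xi form_fun_eta)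
  then show ?thesis by (simp add: unif_def form_fun_xi form_fun_eta del: One_nat_def)
qed

lemma unif_self: "p \<in> N \<Longrightarrow> unif p p = 0"
  by (auto simp: N_def unif_def)

lemma nonvanishing_unif:
  assumes "p \<in> N"
  shows "nonvanishing (unif p)"
proof -
  consider "p = ptO" | "p = ptS" | u y where "p = pt u y" "on_curve u y" using assms by (auto simp: N_def)
  then show ?thesis
  proof cases
    case 3
    obtain v :: 'a where v: "v \<noteq> 0" "v \<noteq> u"
      using alg_closed_infinite finite_subset[of UNIV "{0, u}"] by auto
    obtain z where "on_curve v z" using on_curve_exists[OF v(1)] .
    then have "pt v z \<in> C" using N_subset_C by (auto simp: N_def)
    then show ?thesis using v 3 by (intro nonvanishingI[of "pt v z"]) (auto simp: unif_def)
  qed (simp_all add: unif_def nonvanishing_xi nonvanishing_eta)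
qed

lemma form_fun_unit_at: "form_fun 1 (unit_at p)"
proof (cases "p = ptO \<or> p = ptS")
  case True
  then show ?thesis using form_fun_nth[of 0] form_fun_nth[of 1] by (auto simp: unit_at_def[abs_def] simp del: One_nat_def)
next
  case False
  then show ?thesis using form_fun_xi by (auto simp: unit_at_def[abs_def] simp del: One_nat_def)
qed

lemma unit_at_self: "p \<in> N \<Longrightarrow> unit_at p p = 1"
  by (auto simp: N_def unit_at_def) (auto simp: ptO_def ptS_def)

text \<open>Multiplying c x1 x3 = xi^2 + x1^2 + x2^2 by x0^2 and replacing x0 x2 by x1 x3 leaves a
  factor x1 in every term other than xi^2 x0^2. The cofactor of x1 takes the value c at
  \<open>ptO\<close>, so x1 vanishes there exactly like the square of \<open>xi\<close>.\<close>

lemma near_O: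
  assumes "x \<in> C"
  shows "(c * (x!3 * (x!0 * x!0)) + (x!1 * (x!0 * x!0) + x!1 * (x!3 * x!3))) * x!1 = xi x * (xi x * (x!0 * x!0))"
proof -
  note r = C_rel[OF assms]
  have "c * x!1 * x!3 = (xi x)\<^sup>2 + (x!1)\<^sup>2 + (x!2)\<^sup>2"
    using r(1,2) by (simp add: square_add eta_def mult.assoc add.assoc)
  then have "c * x!1 * x!3 * (x!0)\<^sup>2 = (xi x)\<^sup>2 * (x!0)\<^sup>2 + (x!1)\<^sup>2 * (x!0)\<^sup>2 + (x!0 * x!2)\<^sup>2"
    by (simp add: ring_distribs power_mult_distrib mult_ac)
  also have "(x!0 * x!2)\<^sup>2 = (x!1)\<^sup>2 * (x!3)\<^sup>2" using r(1) by (simp add: power_mult_distrib)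
  finally show ?thesis
    by (simp add: power2_eq_square ring_distribs mult_ac add_ac)
qed

text \<open>This is \<open>near_O\<close> with all indices shifted by two, a symmetry of the curve
  that exchanges \<open>ptO\<close> with \<open>ptS\<close> and \<open>xi\<close> with
  \<open>eta\<close>.\<close>

lemma near_S:
  assumes "x \<in> C"
  shows "(c * (x!1 * (x!2 * x!2)) + (x!3 * (x!2 * x!2) + x!3 * (x!1 * x!1))) * x!3 = eta x * (eta x * (x!2 * x!2))"
proof -
  note r = C_rel[OF assms]
  have "c * x!1 * x!3 = (eta x)\<^sup>2 + (x!3)\<^sup>2 + (x!0)\<^sup>2"
    using r(1,2) by (simp add: square_add xi_def mult.assoc add_ac)
  then have "c * x!1 * x!3 * (x!2)\<^sup>2 = (eta x)\<^sup>2 * (x!2)\<^sup>2 + (x!3)\<^sup>2 * (x!2)\<^sup>2 + (x!0 * x!2)\<^sup>2"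
    by (simp add: ring_distribs power_mult_distrib mult_ac)
  also have "(x!0 * x!2)\<^sup>2 = (x!1)\<^sup>2 * (x!3)\<^sup>2" using r(1) by (simp add: power_mult_distrib)
  finally show ?thesis
    by (simp add: power2_eq_square ring_distribs mult_ac add_ac)
qed

lemma locally_principalI:
  assumes "form_fun d h" "h p \<noteq> 0" "form_fun d g" "\<And>x. x \<in> C \<Longrightarrow> h x * f x = unif p x * g x"
  shows "\<exists>h d g. form_fun d h \<and> h p \<noteq> 0 \<and> form_fun d g \<and> (\<forall>x\<in>C. h x * f x = unif p x * g x)"
  using assms by blast

lemma locally_principal_linear:
  assumes p: "p \<in> N" and i: "i < 4"
  shows "\<exists>h d g. form_fun d h \<and> h p \<noteq> 0 \<and> form_fun d g \<and> (\<forall>x\<in>C. h x * (x ! i - p ! i * unit_at p x) = unif p x * g x)"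
proof -
  consider "p = ptO" | "p = ptS" | u y where "p = pt u y" "on_curve u y" using p by (auto simp: N_def)
  then show ?thesis
  proof cases
    case 1
    let ?H = "\<lambda>x. c * (x!3 * (x!0 * x!0)) + (x!1 * (x!0 * x!0) + x!1 * (x!3 * x!3))"
    have fH: "form_fun (1 + (1 + 1)) ?H" by (intro form_fun_add form_fun_scale form_fun_mult form_fun_nth) auto
    have fs: "form_fun (1 + (1 + 1)) (\<lambda>x. xi x * (x!0 * x!0))"
      "form_fun (1 + (1 + 1) + 1) (\<lambda>x. xi x * (x!0 * x!0) * x!3)"
      "form_fun (1 + (1 + 1) + 1) (\<lambda>x. ?H x * x!0)"
      using fH by (intro form_fun_mult form_fun_nth form_fun_xi; simp)+
    have H1: "?H x * x!1 = xi x * (xi x * (x!0 * x!0))" if "x \<in> C" for x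
      by (rule near_O[OF that])
    from i consider "i = 0" | "i = 1" | "i = 2" | "i = 3" by linarith
    then show ?thesis
    proof cases
      case 1
      show ?thesis by (rule locally_principalI[OF form_fun_nth[of 0] _ form_fun_zero[of 1]])
          (use 1 \<open>p = ptO\<close> in \<open>simp_all add: unit_at_def\<close>, simp_all add: ptO_def)
    next
      case 2
      have pi: "p ! 1 = 0" "unif p = xi" "?H p \<noteq> 0"
        using 2 \<open>p = ptO\<close> c_nz by (simp_all add: unif_def) (simp_all add: ptO_def)
      show ?thesis
        by (rule locally_principalI[OF fH pi(3) fs(1)]) (simp only: 2 pi(1,2) H1 mult_zero_left diff_zero)
    next
      case 3
      \<comment> \<open>There is no direct formula for x2: the unit x0 is multiplied in, and the
        quadric replaces x0 x2 by x1 x3.\<close>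
      have "?H x * x!0 * x!2 = xi x * (xi x * (x!0 * x!0) * x!3)" if "x \<in> C" for x
      proof -
        have "?H x * x!0 * x!2 = ?H x * x!1 * x!3" by (simp only: mult.assoc C_rel(1)[OF that])
        then show ?thesis by (simp only: H1[OF that] mult.assoc)
      qed
      note X2 = this
      have pi: "p ! 2 = 0" "unif p = xi" "?H p * p!0 \<noteq> 0"
        using 3 \<open>p = ptO\<close> c_nz by (simp_all add: unif_def) (simp_all add: ptO_def)
      show ?thesis
        by (rule locally_principalI[OF fs(3) pi(3) fs(2)]) (simp only: 3 pi(1,2) X2 mult_zero_left diff_zero)
    next
      case 4
      have "x!3 - x!0 = xi x" for x :: "'a list" by (simp add: minus_is_plus xi_def add_ac)
      then show ?thesis
        by (intro locally_principalI[OF form_fun_nth[of 0] _ form_fun_nth[of 0]])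
          (use 4 \<open>p = ptO\<close> in \<open>simp_all add: unit_at_def unif_def\<close>, simp_all add: ptO_def)
    qed
  next
    case 2
    let ?H = "\<lambda>x. c * (x!1 * (x!2 * x!2)) + (x!3 * (x!2 * x!2) + x!3 * (x!1 * x!1))"
    have fH: "form_fun (1 + (1 + 1)) ?H" by (intro form_fun_add form_fun_scale form_fun_mult form_fun_nth) auto
    have fs: "form_fun (1 + (1 + 1)) (\<lambda>x. eta x * (x!2 * x!2))"
      "form_fun (1 + (1 + 1) + 1) (\<lambda>x. eta x * (x!2 * x!2) * x!1)"
      "form_fun (1 + (1 + 1) + 1) (\<lambda>x. ?H x * x!2)"
      using fH by (intro form_fun_mult form_fun_nth form_fun_eta; simp)+
    have H3: "?H x * x!3 = eta x * (eta x * (x!2 * x!2))" if "x \<in> C" for x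
      by (rule near_S[OF that])
    from i consider "i = 0" | "i = 1" | "i = 2" | "i = 3" by linarith
    then show ?thesis
    proof cases
      case 2
      show ?thesis by (rule locally_principalI[OF form_fun_nth[of 1] _ form_fun_zero[of 1]])
          (use 2 \<open>p = ptS\<close> in \<open>simp_all add: unit_at_def\<close>, simp_all add: ptS_def)
    next
      case 4
      have pi: "p ! 3 = 0" "unif p = eta" "?H p \<noteq> 0"
        using 4 \<open>p = ptS\<close> c_nz by (simp_all add: unif_def) (simp_all add: ptS_def)
      show ?thesis
        by (rule locally_principalI[OF fH pi(3) fs(1)]) (simp only: 4 pi(1,2) H3 mult_zero_left diff_zero)
    next
      case 1
      have "?H x * x!2 * x!0 = eta x * (eta x * (x!2 * x!2) * x!1)" if "x \<in> C" for x
      proof -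
        have "?H x * x!2 * x!0 = ?H x * x!3 * x!1"
          by (simp only: mult.assoc mult.commute[of "x!2" "x!0"] mult.commute[of "x!3" "x!1"] C_rel(1)[OF that])
        then show ?thesis by (simp only: H3[OF that] mult.assoc)
      qed
      note X0 = this
      have pi: "p ! 0 = 0" "unif p = eta" "?H p * p!2 \<noteq> 0"
        using 1 \<open>p = ptS\<close> c_nz by (simp_all add: unif_def) (simp_all add: ptS_def)
      show ?thesis
        by (rule locally_principalI[OF fs(3) pi(3) fs(2)]) (simp only: 1 pi(1,2) X0 mult_zero_left diff_zero)
    next
      case 3
      have "x!2 - x!1 = eta x" for x :: "'a list" by (simp add: minus_is_plus eta_def add_ac)
      then show ?thesis
        by (intro locally_principalI[OF form_fun_nth[of 1] _ form_fun_nth[of 1]])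
          (use 3 \<open>p = ptS\<close> in \<open>simp_all add: unit_at_def unif_def\<close>, simp_all add: ptS_def)
    qed
  next
    case 3
    have u0: "u \<noteq> 0" using 3 on_curve_nz by blast
    have cvu: "c * u * (y\<^sup>2 + y) = 1 + u\<^sup>2" using 3 by (simp add: on_curve_def square_add)
    \<comment> \<open>The product of x3 + y xi with its conjugate x3 + (y + 1) xi is x0 x3 + (y^2 +
      y) xi^2. The factor c u eta makes the curve equation applicable to both summands, and eta + u
      xi then splits off. The conjugate factor is 1 at p, so \<open>?h\<close> is a unit
      there.\<close>
    let ?h = "\<lambda>x. c * u * (eta x * (x!3 + (y + 1) * xi x))"
    let ?g = "\<lambda>x. xi x * (xi x + u * eta x)"
    have unif: "unif p x = eta x + u * xi x" for x using 3 by (simp add: unif_def minus_is_plus)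
    have fs: "form_fun (1 + 1) ?h" "form_fun (1 + 1) ?g"
      by (intro form_fun_add form_fun_scale form_fun_mult form_fun_nth form_fun_xi form_fun_eta; simp)+
    have hp: "?h p \<noteq> 0" using 3 u0 c_nz by (simp) (simp add: pt_def)
    have X3: "?h x * (x!3 + y * xi x) = unif p x * ?g x" if "x \<in> C" for x
    proof -
      have K: "(x!3 + (y + 1) * xi x) * (x!3 + y * xi x) = x!0 * x!3 + (y\<^sup>2 + y) * (xi x)\<^sup>2"
        by (simp add: xi_def power2_eq_square algebra_simps)
      have "?h x * (x!3 + y * xi x) = c * u * eta x * ((x!3 + (y + 1) * xi x) * (x!3 + y * xi x))"
        by (simp only: mult_ac)
      also have "\<dots> = u * (c * eta x * x!0 * x!3) + (c * u * (y\<^sup>2 + y)) * eta x * (xi x)\<^sup>2"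
        unfolding K by (simp only: distrib_left mult_ac)
      also have "\<dots> = u * (xi x * (xi x + eta x)\<^sup>2) + (1 + u\<^sup>2) * eta x * (xi x)\<^sup>2"
        by (simp only: cvu C_rel(5)[OF that])
      also have "\<dots> = unif p x * ?g x"
        by (simp add: unif square_add) (simp add: power2_eq_square algebra_simps)
      finally show ?thesis .
    qed
    have X0: "?h x * (x!0 + (y + 1) * xi x) = unif p x * ?g x" if "x \<in> C" for x
    proof -
      have "x!0 + (y + 1) * xi x = x!3 + y * xi x" by (simp add: xi_def algebra_simps)
      with X3[OF that] show ?thesis by simp
    qed
    \<comment> \<open>The additional factor \<open>xi\<close> allows x2 xi to be replaced by eta x3,
      which reduces x2 to the case of x3; x1 = x2 + eta then follows.\<close>
    let ?h2 = "\<lambda>x. xi x * ?h x"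
    let ?g2 = "\<lambda>x. eta x * ?g x + y * xi x * ?h x"
    have fs2: "form_fun (1 + (1 + 1)) ?h2" "form_fun (1 + (1 + 1)) ?g2"
      by (intro form_fun_add form_fun_mult[of 1 _ "1+1"] form_fun_scale fs form_fun_xi form_fun_eta; simp)+
    have X2: "?h2 x * (x!2 + u * y * xi x) = unif p x * ?g2 x" if "x \<in> C" for x
    proof -
      have K: "xi x * (x!2 + u * y * xi x) = eta x * (x!3 + y * xi x) + y * xi x * unif p x"
        using C_rel(3)[OF that] by (simp add: unif algebra_simps)
      have "?h2 x * (x!2 + u * y * xi x) = ?h x * (xi x * (x!2 + u * y * xi x))" by (simp only: mult_ac)
      also have "\<dots> = eta x * (?h x * (x!3 + y * xi x)) + y * xi x * ?h x * unif p x"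
        unfolding K by (simp add: algebra_simps)
      finally have "?h2 x * (x!2 + u * y * xi x) = eta x * (?h x * (x!3 + y * xi x)) + y * xi x * ?h x * unif p x" .
      then show ?thesis unfolding X3[OF that] by (simp add: algebra_simps)
    qed
    let ?g1 = "\<lambda>x. ?h2 x + ?g2 x"
    have X1: "?h2 x * (x!1 + u * (y + 1) * xi x) = unif p x * ?g1 x" if "x \<in> C" for x
    proof -
      have "x!1 + u * (y + 1) * xi x = unif p x + (x!2 + u * y * xi x)"
        by (simp add: unif eta_def algebra_simps)
      then have "?h2 x * (x!1 + u * (y + 1) * xi x) = ?h2 x * unif p x + ?h2 x * (x!2 + u * y * xi x)"
        by (simp only: distrib_left)
      also have "\<dots> = unif p x * ?g1 x" unfolding X2[OF that] by (simp only: distrib_left mult_ac)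
      finally show ?thesis .
    qed
    have fs1: "form_fun (1 + (1 + 1)) ?g1" by (intro form_fun_add fs2)
    have hp2: "?h2 p \<noteq> 0" using hp 3 by simp
    have unit_at: "unit_at p x = xi x" for x using 3 by (simp add: unit_at_def)
    have pi: "p!0 = y + 1" "p!1 = u * (y + 1)" "p!2 = u * y" "p!3 = y"
      using 3 by (simp_all add: pt_def)
    from i consider "i = 0" | "i = 1" | "i = 2" | "i = 3" by linarith
    then show ?thesis
    proof cases
      case 1
      show ?thesis unfolding unit_at minus_is_plus
        by (rule locally_principalI[OF fs(1) hp fs(2)]) (simp only: 1 pi X0)
    next
      case 2
      show ?thesis unfolding unit_at minus_is_plus
        by (rule locally_principalI[OF fs2(1) hp2 fs1]) (simp only: 2 pi X1)
    next
      case 3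
      show ?thesis unfolding unit_at minus_is_plus
        by (rule locally_principalI[OF fs2(1) hp2 fs2(2)]) (simp only: 3 pi X2)
    next
      case 4
      show ?thesis unfolding unit_at minus_is_plus
        by (rule locally_principalI[OF fs(1) hp fs(2)]) (simp only: 4 pi X3)
    qed
  qed
qed

text \<open>The expansion of f at p to first order: up to a local unit, f minus its value is a
  multiple of the uniformiser. Products follow the Leibniz rule. The degree of g is recorded because
  the cofactors of two expansions can be added only if their degrees match.\<close>

lemma locally_principal:
  assumes "form_fun m f" and p: "p \<in> N"
  shows "\<exists>h k g d. form_fun k h \<and> h p \<noteq> 0 \<and> form_fun d g \<and> d + 1 = k + m \<and>
     (\<forall>x\<in>C. h x * (f x - f p * unit_at p x ^ m) = unif p x * g x)"
  using assms(1)
proof (induction rule: form_fun_induct)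
  case (zero m)
  show ?case
    by (intro exI[of _ "unit_at p"] exI[of _ "1::nat"] exI[of _ "\<lambda>_. 0"] exI[of _ m] conjI form_fun_unit_at form_fun_zero)
      (simp_all add: unit_at_self p)
next
  case (const a)
  show ?case
    by (intro exI[of _ "unit_at p"] exI[of _ "1::nat"] exI[of _ "\<lambda>_. 0"] exI[of _ "0::nat"] conjI form_fun_unit_at form_fun_zero)
      (simp_all add: unit_at_self p)
next
  case (var m f i)
  from var(3) obtain h k g d where 1: "form_fun k h" "h p \<noteq> 0" "form_fun d g" "d + 1 = k + m"
     "\<And>x. x \<in> C \<Longrightarrow> h x * (f x - f p * unit_at p x ^ m) = unif p x * g x" by blast
  from locally_principal_linear[OF p var(1)] obtain h' d' g' where 2: "form_fun d' h'" "h' p \<noteq> 0" "form_fun d' g'"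
     "\<And>x. x \<in> C \<Longrightarrow> h' x * (x ! i - p ! i * unit_at p x) = unif p x * g' x" by blast
  let ?g = "\<lambda>x. h' x * x ! i * g x + f p * unit_at p x ^ m * h x * g' x"
  have *: "h x * h' x * (x ! i * f x - p ! i * f p * unit_at p x ^ Suc m) = unif p x * ?g x" if "x \<in> C" for x
  proof -
    have "h x * h' x * (x ! i * f x - p ! i * f p * unit_at p x ^ Suc m) =
      h' x * x ! i * (h x * (f x - f p * unit_at p x ^ m)) + f p * unit_at p x ^ m * h x * (h' x * (x ! i - p ! i * unit_at p x))"
      by (simp add: algebra_simps)
    also have "\<dots> = unif p x * ?g x" by (simp only: 1(5)[OF that] 2(4)[OF that]) (simp add: algebra_simps)
    finally show ?thesis .
  qed
  have A: "form_fun (d' + 1 + d) (\<lambda>x. h' x * x ! i * g x)" by (intro form_fun_mult form_fun_nth 1 2 var)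
  have B: "form_fun (0 + m + k + d') (\<lambda>x. f p * unit_at p x ^ m * h x * g' x)"
    by (intro form_fun_mult form_fun_const form_fun_power1 form_fun_unit_at 1 2)
  have deg: "0 + m + k + d' = d' + 1 + d" using 1(4) by simp
  have "form_fun (d' + 1 + d) ?g" by (rule form_fun_add[OF A B[unfolded deg]])
  moreover have "d' + 1 + d + 1 = (k + d') + Suc m" using 1(4) by simp
  ultimately show ?case using form_fun_mult[OF 1(1) 2(1)] 1(2) 2(2) *
    by (intro exI[of _ "\<lambda>x. h x * h' x"] exI[of _ "k + d'"] exI[of _ ?g] exI[of _ "d' + 1 + d"]) simp
next
  case (add m f f')
  from add(3) obtain h k g d where 1: "form_fun k h" "h p \<noteq> 0" "form_fun d g" "d + 1 = k + m"
     "\<And>x. x \<in> C \<Longrightarrow> h x * (f x - f p * unit_at p x ^ m) = unif p x * g x" by blast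
  from add(4) obtain h' k' g' d' where 2: "form_fun k' h'" "h' p \<noteq> 0" "form_fun d' g'" "d' + 1 = k' + m"
     "\<And>x. x \<in> C \<Longrightarrow> h' x * (f' x - f' p * unit_at p x ^ m) = unif p x * g' x" by blast
  let ?g = "\<lambda>x. h' x * g x + h x * g' x"
  have *: "h x * h' x * (f x + f' x - (f p + f' p) * unit_at p x ^ m) = unif p x * ?g x" if "x \<in> C" for x
  proof -
    have "h x * h' x * (f x + f' x - (f p + f' p) * unit_at p x ^ m) =
      h' x * (h x * (f x - f p * unit_at p x ^ m)) + h x * (h' x * (f' x - f' p * unit_at p x ^ m))"
      by (simp add: algebra_simps)
    also have "\<dots> = unif p x * ?g x" by (simp only: 1(5)[OF that] 2(5)[OF that]) (simp add: algebra_simps)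
    finally show ?thesis .
  qed
  have deg: "k + d' = k' + d" using 1(4) 2(4) by simp
  have "form_fun (k' + d) ?g" by (rule form_fun_add[OF form_fun_mult[OF 2(1) 1(3)] form_fun_mult[OF 1(1) 2(3), unfolded deg]])
  moreover have "k' + d + 1 = (k + k') + m" using 1(4) by simp
  ultimately show ?case using form_fun_mult[OF 1(1) 2(1)] 1(2) 2(2) *
    by (intro exI[of _ "\<lambda>x. h x * h' x"] exI[of _ "k + k'"] exI[of _ ?g] exI[of _ "k' + d"]) simp
next
  case (cong m f g)
  have "f p = g p" "x \<in> C \<Longrightarrow> f x = g x" for x using cong(1) C_length N_subset_C p by blast+
  with cong(2) show ?case by (metis (mono_tags, lifting))
qed

subsection \<open>Orders of vanishing\<close>

text \<open>Divisibility by the n-th power of the uniformiser in the local ring at p, with the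
  denominator h, a unit at p, cleared.\<close>

definition ord_at_least :: "'a list \<Rightarrow> ('a list \<Rightarrow> 'a) \<Rightarrow> nat \<Rightarrow> bool" where
  "ord_at_least p f n \<longleftrightarrow> (\<exists>h g d e. form_fun d h \<and> form_fun e g \<and> h p \<noteq> 0 \<and> (\<forall>x\<in>C. h x * f x = unif p x ^ n * g x))"

text \<open>The degrees of \<open>h\<close> and \<open>g\<close> are left open: they are forced by that of \<open>f\<close>, since a function
  that is not zero on the cone has at most one degree.\<close>

definition has_ord :: "'a list \<Rightarrow> ('a list \<Rightarrow> 'a) \<Rightarrow> nat \<Rightarrow> bool" where
  "has_ord p f n \<longleftrightarrow> (\<exists>h g d e. form_fun d h \<and> form_fun e g \<and> h p \<noteq> 0 \<and> g p \<noteq> 0 \<and>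
     (\<forall>x\<in>C. h x * f x = unif p x ^ n * g x))"

lemma has_ordI:
  assumes "form_fun d h" "form_fun e g" "h p \<noteq> 0" "g p \<noteq> 0" "\<And>x. x \<in> C \<Longrightarrow> h x * f x = unif p x ^ n * g x"
  shows "has_ord p f n"
  unfolding has_ord_def using assms by blast

lemma ord_at_leastI:
  assumes "form_fun d h" "form_fun e g" "h p \<noteq> 0" "\<And>x. x \<in> C \<Longrightarrow> h x * f x = unif p x ^ n * g x"
  shows "ord_at_least p f n"
  unfolding ord_at_least_def using assms by blast

lemma has_ordE:
  assumes "has_ord p f n"
  obtains h g d e where "form_fun d h" "form_fun e g" "h p \<noteq> 0" "g p \<noteq> 0" "\<And>x. x \<in> C \<Longrightarrow> h x * f x = unif p x ^ n * g x"
  using assms unfolding has_ord_def by blast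

lemma ord_at_leastE:
  assumes "ord_at_least p f n"
  obtains h g d e where "form_fun d h" "form_fun e g" "h p \<noteq> 0" "\<And>x. x \<in> C \<Longrightarrow> h x * f x = unif p x ^ n * g x"
  using assms unfolding ord_at_least_def by blast

lemma has_ord_imp_ord_at_least: "has_ord p f n \<Longrightarrow> ord_at_least p f n"
  unfolding has_ord_def ord_at_least_def by blast

lemma has_ord_cong: "(\<And>x. x \<in> C \<Longrightarrow> f x = g x) \<Longrightarrow> has_ord p f n \<longleftrightarrow> has_ord p g n"
  unfolding has_ord_def by auto

lemma ord_at_least_cong: "(\<And>x. x \<in> C \<Longrightarrow> f x = g x) \<Longrightarrow> ord_at_least p f n \<longleftrightarrow> ord_at_least p g n"
  unfolding ord_at_least_def by auto

lemma has_ord_eq: "has_ord p f n \<Longrightarrow> (\<And>x. x \<in> C \<Longrightarrow> f x = g x) \<Longrightarrow> has_ord p g n"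
  using has_ord_cong by blast

lemma ord_at_least_eq: "ord_at_least p f n \<Longrightarrow> (\<And>x. x \<in> C \<Longrightarrow> f x = g x) \<Longrightarrow> ord_at_least p g n"
  using ord_at_least_cong by blast

lemma ord_at_least_mono:
  assumes "ord_at_least p f n" "m \<le> n"
  shows "ord_at_least p f m"
proof -
  from assms(1) obtain h g d e where *: "form_fun d h" "form_fun e g" "h p \<noteq> 0"
    "\<And>x. x \<in> C \<Longrightarrow> h x * f x = unif p x ^ n * g x" by (rule ord_at_leastE) blast
  have "form_fun (n - m + e) (\<lambda>x. unif p x ^ (n - m) * g x)" by (intro form_fun_mult form_fun_power1 form_fun_unif *)
  from ord_at_leastI[OF *(1) this *(3), of f m] *(4) assms(2) show ?thesis
    by (simp flip: mult.assoc power_add)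
qed

lemma has_ord_nz:
  assumes "has_ord p f n" "p \<in> N"
  shows "nonvanishing f"
proof -
  from assms(1) obtain h g d e where *: "form_fun d h" "form_fun e g" "h p \<noteq> 0" "g p \<noteq> 0"
    "\<And>x. x \<in> C \<Longrightarrow> h x * f x = unif p x ^ n * g x" by (rule has_ordE) blast
  have "nonvanishing (\<lambda>x. unif p x ^ n * g x)"
    using nonvanishing_mult[OF form_fun_power1[OF form_fun_unif] *(2) nonvanishing_power[OF nonvanishing_unif[OF assms(2)]]]
      nonvanishingI[OF N_subset_C[OF assms(2)], of g] *(4) by blast
  then obtain x where x: "x \<in> C" "unif p x ^ n * g x \<noteq> 0" by (auto simp: nonvanishing_def)
  with *(5)[OF x(1)] have "f x \<noteq> 0" by auto
  with x(1) show ?thesis by (rule nonvanishingI)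
qed

text \<open>If k exceeded n, equating the two local expressions and cancelling the n-th power of the
  uniformiser would leave a product of units equal to a multiple of \<open>unif p\<close>, which is
  impossible at p.\<close>

lemma ord_at_least_le_has_ord:
  assumes p: "p \<in> N" and "has_ord p f n" "ord_at_least p f k"
  shows "k \<le> n"
proof (rule ccontr)
  assume "\<not> k \<le> n"
  from assms(2) obtain h g d e where 1: "form_fun d h" "form_fun e g" "h p \<noteq> 0" "g p \<noteq> 0"
    "\<And>x. x \<in> C \<Longrightarrow> h x * f x = unif p x ^ n * g x" by (rule has_ordE) blast
  from assms(3) obtain h' g' d' e' where 2: "form_fun d' h'" "form_fun e' g'" "h' p \<noteq> 0"
    "\<And>x. x \<in> C \<Longrightarrow> h' x * f x = unif p x ^ k * g' x" by (rule ord_at_leastE) blast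
  have eq: "unif p x ^ n * (h' x * g x) = unif p x ^ n * (unif p x ^ (k - n) * (h x * g' x))" if "x \<in> C" for x
  proof -
    have "unif p x ^ n * (h' x * g x) = h x * (h' x * f x)" using 1(5)[OF that] by (simp add: mult_ac)
    also have "\<dots> = unif p x ^ k * (h x * g' x)" using 2(4)[OF that] by (simp add: mult_ac)
    also have "\<dots> = unif p x ^ n * (unif p x ^ (k - n) * (h x * g' x))"
      using \<open>\<not> k \<le> n\<close> by (simp flip: mult.assoc power_add)
    finally show ?thesis .
  qed
  have "h' p * g p = unif p p ^ (k - n) * (h p * g' p)"
    by (rule form_fun_cancel[OF form_fun_power1[OF form_fun_unif] form_fun_mult[OF 2(1) 1(2)]
          form_fun_mult[OF form_fun_power1[OF form_fun_unif] form_fun_mult[OF 1(1) 2(2)]] nonvanishing_power[OF nonvanishing_unif[OF p]] eq N_subset_C[OF p]])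
  moreover have "unif p p ^ (k - n) = 0" using unif_self[OF p] \<open>\<not> k \<le> n\<close> by simp
  ultimately show False using 1(4) 2(3) by simp
qed

lemma has_ord_unique: "p \<in> N \<Longrightarrow> has_ord p f n \<Longrightarrow> has_ord p f k \<Longrightarrow> n = k"
  using ord_at_least_le_has_ord has_ord_imp_ord_at_least le_antisym by metis

lemma has_ord_mult:
  assumes "has_ord p f n" "has_ord p f' n'"
  shows "has_ord p (\<lambda>x. f x * f' x) (n + n')"
proof -
  from assms(1) obtain h g d e where 1: "form_fun d h" "form_fun e g" "h p \<noteq> 0" "g p \<noteq> 0"
    "\<And>x. x \<in> C \<Longrightarrow> h x * f x = unif p x ^ n * g x" by (rule has_ordE) blast
  from assms(2) obtain h' g' d' e' where 2: "form_fun d' h'" "form_fun e' g'" "h' p \<noteq> 0" "g' p \<noteq> 0"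
    "\<And>x. x \<in> C \<Longrightarrow> h' x * f' x = unif p x ^ n' * g' x" by (rule has_ordE) blast
  have "h x * h' x * (f x * f' x) = unif p x ^ (n + n') * (g x * g' x)" (is "_ = ?R x") if "x \<in> C" for x
  proof -
    have "h x * h' x * (f x * f' x) = (h x * f x) * (h' x * f' x)" by (simp only: mult_ac)
    also have "\<dots> = ?R x" unfolding 1(5)[OF that] 2(5)[OF that] by (simp only: power_add mult_ac)
    finally show ?thesis .
  qed
  then show ?thesis using 1 2 by (intro has_ordI[OF form_fun_mult[OF 1(1) 2(1)] form_fun_mult[OF 1(2) 2(2)]]) auto
qed

lemma has_ord_0: "form_fun m f \<Longrightarrow> f p \<noteq> 0 \<Longrightarrow> has_ord p f 0"
  by (rule has_ordI[OF form_fun_const[of 1], of m f]) auto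

lemma ord_at_least_0: "form_fun m f \<Longrightarrow> ord_at_least p f 0"
  by (rule ord_at_leastI[OF form_fun_const[of 1], of m f]) auto

lemma has_ord_unif: "has_ord p (unif p) 1"
  by (rule has_ordI[OF form_fun_const[of 1] form_fun_const[of 1]]) auto

lemma has_ord_power: "has_ord p f n \<Longrightarrow> has_ord p (\<lambda>x. f x ^ k) (k * n)"
proof (induction k)
  case 0
  then show ?case using has_ord_0[OF form_fun_const[of 1]] by simp
next
  case (Suc k)
  then show ?case using has_ord_mult[of p f n "\<lambda>x. f x ^ k"] by simp
qed

lemma has_ord_scale: "a \<noteq> 0 \<Longrightarrow> has_ord p f n \<Longrightarrow> has_ord p (\<lambda>x. a * f x) n"
  using has_ord_mult[OF has_ord_0[OF form_fun_const[of a]], of p f n] by simp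

text \<open>With a common denominator the numerator is h' g + h g', a form only if both products
  have the same degree. The common degree m of the summands forces this, provided that neither
  vanishes identically; that case is split off.\<close>

lemma ord_at_least_add:
  assumes "form_fun m f" "form_fun m f'" "ord_at_least p f n" "ord_at_least p f' n" "p \<in> N"
  shows "ord_at_least p (\<lambda>x. f x + f' x) n"
proof (cases "nonvanishing f \<and> nonvanishing f'")
  case False
  then consider "\<And>x. x \<in> C \<Longrightarrow> f x = 0" | "\<And>x. x \<in> C \<Longrightarrow> f' x = 0" by (auto simp: nonvanishing_def)
  then show ?thesis
  proof cases
    case 1
    then show ?thesis using assms(4) ord_at_least_cong[of "\<lambda>x. f x + f' x" f'] by simp
  next
    case 2
    then show ?thesis using assms(3) ord_at_least_cong[of "\<lambda>x. f x + f' x" f] by simp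
  qed
next
  case True
  from assms(3) obtain h g d e where 1: "form_fun d h" "form_fun e g" "h p \<noteq> 0"
    "\<And>x. x \<in> C \<Longrightarrow> h x * f x = unif p x ^ n * g x" by (rule ord_at_leastE) blast
  from assms(4) obtain h' g' d' e' where 2: "form_fun d' h'" "form_fun e' g'" "h' p \<noteq> 0"
    "\<And>x. x \<in> C \<Longrightarrow> h' x * f' x = unif p x ^ n * g' x" by (rule ord_at_leastE) blast
  note pC = N_subset_C[OF assms(5)]
  have "d + m = n + e"
    by (rule form_fun_degree_unique[OF form_fun_mult[OF 1(1) assms(1)] form_fun_mult[OF form_fun_power1[OF form_fun_unif] 1(2)] 1(4)])
      (use nonvanishing_mult[OF 1(1) assms(1) nonvanishingI[OF pC, of h]] 1(3) True in auto)
  moreover have "d' + m = n + e'"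
    by (rule form_fun_degree_unique[OF form_fun_mult[OF 2(1) assms(2)] form_fun_mult[OF form_fun_power1[OF form_fun_unif] 2(2)] 2(4)])
      (use nonvanishing_mult[OF 2(1) assms(2) nonvanishingI[OF pC, of h']] 2(3) True in auto)
  ultimately have deg: "d' + e = d + e'" by simp
  have "h x * h' x * (f x + f' x) = unif p x ^ n * (h' x * g x + h x * g' x)" (is "_ = ?R x") if "x \<in> C" for x
  proof -
    have "h x * h' x * (f x + f' x) = h' x * (h x * f x) + h x * (h' x * f' x)" by (simp add: algebra_simps)
    also have "\<dots> = ?R x" unfolding 1(4)[OF that] 2(4)[OF that] by (simp only: distrib_left mult_ac)
    finally show ?thesis .
  qed
  moreover have "form_fun (d' + e) (\<lambda>x. h' x * g x + h x * g' x)"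
    by (rule form_fun_add[OF form_fun_mult[OF 2(1) 1(2)] form_fun_mult[OF 1(1) 2(2), folded deg]])
  ultimately show ?thesis using 1 2 by (intro ord_at_leastI[OF form_fun_mult[OF 1(1) 2(1)]]) auto
qed

lemma ord_at_least_sum:
  assumes "\<And>i. i \<in> A \<Longrightarrow> form_fun m (f i)" "\<And>i. i \<in> A \<Longrightarrow> ord_at_least p (f i) n" "p \<in> N"
  shows "ord_at_least p (\<lambda>x. \<Sum>i\<in>A. f i x) n"
  using assms
proof (induction A rule: infinite_finite_induct)
  case (insert i A)
  then show ?case using ord_at_least_add[of m "f i" "\<lambda>x. \<Sum>i\<in>A. f i x"] form_fun_sum[of A m f] by simp
qed (simp_all add: ord_at_leastI[OF form_fun_const[of 1] form_fun_const[of 0]])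

lemma has_ord_add_ord_at_least:
  assumes "form_fun m f" "form_fun m f'" "has_ord p f n" "ord_at_least p f' (Suc n)" "p \<in> N"
  shows "has_ord p (\<lambda>x. f x + f' x) n"
proof (cases "nonvanishing f'")
  case False
  then show ?thesis using assms(3) has_ord_cong[of "\<lambda>x. f x + f' x" f] by (simp add: nonvanishing_def)
next
  case True
  from assms(3) obtain h g d e where 1: "form_fun d h" "form_fun e g" "h p \<noteq> 0" "g p \<noteq> 0"
    "\<And>x. x \<in> C \<Longrightarrow> h x * f x = unif p x ^ n * g x" by (rule has_ordE) blast
  from assms(4) obtain h' g' d' e' where 2: "form_fun d' h'" "form_fun e' g'" "h' p \<noteq> 0"
    "\<And>x. x \<in> C \<Longrightarrow> h' x * f' x = unif p x ^ Suc n * g' x" by (rule ord_at_leastE) blast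
  note pC = N_subset_C[OF assms(5)]
  have "d + m = n + e"
    by (rule form_fun_degree_unique[OF form_fun_mult[OF 1(1) assms(1)] form_fun_mult[OF form_fun_power1[OF form_fun_unif] 1(2)] 1(5)])
      (use nonvanishing_mult[OF 1(1) assms(1) nonvanishingI[OF pC, of h]] 1(3) has_ord_nz[OF assms(3,5)] in auto)
  moreover have "d' + m = Suc n + e'"
    by (rule form_fun_degree_unique[OF form_fun_mult[OF 2(1) assms(2)] form_fun_mult[OF form_fun_power1[OF form_fun_unif] 2(2)] 2(4)])
      (use nonvanishing_mult[OF 2(1) assms(2) nonvanishingI[OF pC, of h']] 2(3) True in auto)
  ultimately have deg: "d' + e = d + (1 + e')" by simp
  have *: "h x * h' x * (f x + f' x) = unif p x ^ n * (h' x * g x + h x * (unif p x * g' x))" (is "_ = ?R x") if "x \<in> C" for x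
  proof -
    have "h x * h' x * (f x + f' x) = h' x * (h x * f x) + h x * (h' x * f' x)" by (simp add: algebra_simps)
    also have "\<dots> = ?R x" unfolding 1(5)[OF that] 2(4)[OF that] by (simp only: distrib_left mult_ac power_Suc)
    finally show ?thesis .
  qed
  have "form_fun (d' + e) (\<lambda>x. h' x * g x + h x * (unif p x * g' x))"
    by (rule form_fun_add[OF form_fun_mult[OF 2(1) 1(2)] form_fun_mult[OF 1(1) form_fun_mult[OF form_fun_unif 2(2)], folded deg]])
  from has_ordI[OF form_fun_mult[OF 1(1) 2(1)] this _ _ *] show ?thesis using 1(3,4) 2(3)
    by (simp add: unif_self assms(5))
qed

text \<open>The ultrametric principle: the term of least order cannot be cancelled by terms of
  strictly larger order.\<close>

lemma has_ord_sum_distinct: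
  assumes "finite I" "I \<noteq> {}" "inj_on n I" "p \<in> N"
    and f: "\<And>i. i \<in> I \<Longrightarrow> form_fun m (f i)" "\<And>i. i \<in> I \<Longrightarrow> has_ord p (f i) (n i)"
  shows "\<exists>j\<in>I. has_ord p (\<lambda>x. \<Sum>i\<in>I. f i x) (n j) \<and> (\<forall>i\<in>I. n j \<le> n i)"
proof -
  obtain j where j: "j \<in> I" "\<And>i. i \<in> I \<Longrightarrow> n j \<le> n i"
    using assms(1,2) by (metis arg_min_if_finite(1) arg_min_least)
  have "ord_at_least p (\<lambda>x. \<Sum>i\<in>I - {j}. f i x) (Suc (n j))"
  proof (rule ord_at_least_sum)
    fix i assume i: "i \<in> I - {j}"
    then have "n i \<noteq> n j" using assms(3) j(1) by (auto simp: inj_on_def)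
    with j(2)[of i] i show "ord_at_least p (f i) (Suc (n j))" using ord_at_least_mono[OF has_ord_imp_ord_at_least[OF f(2)]] by auto
  qed (use f assms in auto)
  moreover have "form_fun m (\<lambda>x. \<Sum>i\<in>I - {j}. f i x)" using f by (intro form_fun_sum) auto
  ultimately have "has_ord p (\<lambda>x. f j x + (\<Sum>i\<in>I - {j}. f i x)) (n j)"
    using has_ord_add_ord_at_least f j(1) assms(4) by blast
  moreover have "(\<Sum>i\<in>I. f i x) = f j x + (\<Sum>i\<in>I - {j}. f i x)" for x
    using sum.remove[OF assms(1) j(1)] .
  ultimately show ?thesis using j by auto
qed

text \<open>That a form has an order at all needs a bound on how often the uniformiser can be split
  off from it. A multiple of the form with a known order n gives one: each splitting lowers
  n.\<close>

lemma has_ord_exists_factor: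
  assumes "form_fun m f" "form_fun k g" "has_ord p (\<lambda>x. f x * g x) n" "p \<in> N"
  shows "\<exists>i\<le>n. has_ord p f i"
  using assms
proof (induction n arbitrary: m f rule: less_induct)
  case (less n)
  show ?case
  proof (cases "f p = 0")
    case False
    then show ?thesis using has_ord_0[OF less.prems(1)] by blast
  next
    case True
    from locally_principal[OF less.prems(1,4)] True obtain h d f' e where h: "form_fun d h" "h p \<noteq> 0" "form_fun e f'"
      "\<And>x. x \<in> C \<Longrightarrow> h x * f x = unif p x * f' x" by auto
    have "has_ord p (\<lambda>x. h x * (f x * g x)) (0 + n)" by (rule has_ord_mult[OF has_ord_0[OF h(1,2)] less.prems(3)])
    moreover have "h x * (f x * g x) = unif p x * (f' x * g x)" if "x \<in> C" for x
      using h(4)[OF that] by (simp flip: mult.assoc)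
    ultimately have "has_ord p (\<lambda>x. unif p x * (f' x * g x)) (0 + n)" by (rule has_ord_eq)
    then have "has_ord p (\<lambda>x. unif p x * (f' x * g x)) n" by simp
    then obtain h2 g2 d2 e2 where 2: "form_fun d2 h2" "form_fun e2 g2" "h2 p \<noteq> 0" "g2 p \<noteq> 0"
      "\<And>x. x \<in> C \<Longrightarrow> h2 x * (unif p x * (f' x * g x)) = unif p x ^ n * g2 x" by (rule has_ordE) blast
    have "n \<noteq> 0"
    proof
      assume "n = 0"
      with 2(5)[OF N_subset_C[OF less.prems(4)]] 2(4) show False by (simp add: unif_self less.prems(4))
    qed
    then obtain n' where n': "n = Suc n'" by (cases n) auto
    have "h2 x * (f' x * g x) = unif p x ^ n' * g2 x" if "x \<in> C" for x
    proof (rule form_fun_cancel[OF form_fun_unif _ _ nonvanishing_unif[OF less.prems(4)] _ that])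
      show "form_fun (d2 + (e + k)) (\<lambda>x. h2 x * (f' x * g x))" by (intro form_fun_mult 2 h less.prems)
      show "form_fun (n' + e2) (\<lambda>x. unif p x ^ n' * g2 x)" by (intro form_fun_mult form_fun_power1 form_fun_unif 2)
    qed (use 2(5) n' in \<open>simp add: mult_ac\<close>)
    then have "has_ord p (\<lambda>x. f' x * g x) n'" by (rule has_ordI[OF 2(1-4)])
    from less.IH[OF _ h(3) less.prems(2) this less.prems(4)] n' obtain i where i: "i \<le> n'" "has_ord p f' i" by auto
    from i(2) obtain h3 g3 d3 e3 where 3: "form_fun d3 h3" "form_fun e3 g3" "h3 p \<noteq> 0" "g3 p \<noteq> 0"
      "\<And>x. x \<in> C \<Longrightarrow> h3 x * f' x = unif p x ^ i * g3 x" by (rule has_ordE) blast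
    have "has_ord p f (Suc i)"
    proof (rule has_ordI[OF form_fun_mult[OF 3(1) h(1)] 3(2)])
      fix x assume x: "x \<in> C"
      have "h3 x * h x * f x = unif p x * (h3 x * f' x)" using h(4)[OF x] by (simp add: mult_ac)
      then show "h3 x * h x * f x = unif p x ^ Suc i * g3 x" by (simp add: 3(5)[OF x])
    qed (use 3 h in auto)
    then show ?thesis using i n' by auto
  qed
qed

section \<open>Explicit orders at \<open>ptO\<close> and \<open>ptS\<close>, and the pencil of
  planes through them\<close>

lemma form_fun_vars [simp]: "form_fun (Suc 0) (\<lambda>x. x!0)" "form_fun (Suc 0) (\<lambda>x. x!1)" "form_fun (Suc 0) (\<lambda>x. x!Suc 0)"
  "form_fun (Suc 0) (\<lambda>x. x!2)" "form_fun (Suc 0) (\<lambda>x. x!3)" "form_fun (Suc 0) xi" "form_fun (Suc 0) eta"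
  using form_fun_nth[of 0] form_fun_nth[of 1] form_fun_nth[of 2] form_fun_nth[of 3] form_fun_xi form_fun_eta by auto

lemma N_ptO [simp]: "ptO \<in> N" and N_ptS [simp]: "ptS \<in> N"
  by (simp_all add: N_def)

lemma N_pt [simp]: "pt u y \<in> N \<longleftrightarrow> on_curve u y"
  by (auto simp: N_def)

lemma pt_nth [simp]: "pt u y ! 0 = y + 1" "pt u y ! 1 = u * (y + 1)" "pt u y ! Suc 0 = u * (y + 1)"
  "pt u y ! 2 = u * y" "pt u y ! 3 = y"
  by (simp_all add: pt_def)

lemma N_cases:
  assumes "p \<in> N"
  obtains "p = ptO" | "p = ptS" | u y where "p = pt u y" "on_curve u y" "u \<noteq> 0"
  using assms on_curve_nz by (auto simp: N_def)

lemma has_ord_O_xi: "has_ord ptO xi 1"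
  using has_ord_unif[of ptO] by (simp add: unif_def)

lemma has_ord_S_eta: "has_ord ptS eta 1"
  using has_ord_unif[of ptS] by (simp add: unif_def)

text \<open>By the quadric, x0 eta = x1 xi. Here x0 is a unit at \<open>ptO\<close>, x1 has order 2
  by \<open>near_O\<close> and \<open>xi\<close> has order 1.\<close>

lemma has_ord_O_eta: "has_ord ptO eta 3"
proof (rule has_ordI)
  let ?H = "\<lambda>x. (c * (x!3 * (x!0 * x!0)) + (x!1 * (x!0 * x!0) + x!1 * (x!3 * x!3))) * x!0"
  show "form_fun (1 + (1 + 1) + 1) ?H" by (intro form_fun_add form_fun_scale form_fun_mult form_fun_nth) auto
  show "form_fun (1 + 1) (\<lambda>x. x!0 * x!0)" by (intro form_fun_mult form_fun_nth) auto
  show "?H ptO \<noteq> 0" "ptO!0 * ptO!0 \<noteq> 0" using c_nz by (simp_all add: ptO_def)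
  fix x assume x: "x \<in> C"
  let ?K = "c * (x!3 * (x!0 * x!0)) + (x!1 * (x!0 * x!0) + x!1 * (x!3 * x!3))"
  have "?H x * eta x = x!0 * (?K * x!1) + ?K * (x!0 * x!2)" by (simp add: eta_def ring_distribs mult_ac)
  also have "\<dots> = (?K * x!1) * xi x" unfolding C_rel(1)[OF x] by (simp add: xi_def ring_distribs mult_ac)
  also have "\<dots> = unif ptO x ^ 3 * (x!0 * x!0)"
    unfolding near_O[OF x] by (simp add: unif_def power3_eq_cube mult_ac)
  finally show "?H x * eta x = unif ptO x ^ 3 * (x!0 * x!0)" .
qed

lemma has_ord_S_x3: "has_ord ptS (\<lambda>x. x!3) 2"
proof (rule has_ordI)
  let ?H = "\<lambda>x. c * (x!1 * (x!2 * x!2)) + (x!3 * (x!2 * x!2) + x!3 * (x!1 * x!1))"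
  show "form_fun (1 + (1 + 1)) ?H" by (intro form_fun_add form_fun_scale form_fun_mult form_fun_nth) auto
  show "form_fun (1 + 1) (\<lambda>x. x!2 * x!2)" by (intro form_fun_mult form_fun_nth) auto
  show "?H ptS \<noteq> 0" "ptS!2 * ptS!2 \<noteq> 0" using c_nz by (simp_all add: ptS_def)
  fix x assume x: "x \<in> C"
  show "?H x * x!3 = unif ptS x ^ 2 * (x!2 * x!2)"
    unfolding near_S[OF x] by (simp add: unif_def power2_eq_square mult_ac)
qed

lemma has_ord_S_xi: "has_ord ptS xi 3"
proof (rule has_ordI)
  let ?H = "\<lambda>x. (c * (x!1 * (x!2 * x!2)) + (x!3 * (x!2 * x!2) + x!3 * (x!1 * x!1))) * x!2"
  show "form_fun (1 + (1 + 1) + 1) ?H" by (intro form_fun_add form_fun_scale form_fun_mult form_fun_nth) auto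
  show "form_fun (1 + 1) (\<lambda>x. x!2 * x!2)" by (intro form_fun_mult form_fun_nth) auto
  show "?H ptS \<noteq> 0" "ptS!2 * ptS!2 \<noteq> 0" using c_nz by (simp_all add: ptS_def)
  fix x assume x: "x \<in> C"
  let ?K = "c * (x!1 * (x!2 * x!2)) + (x!3 * (x!2 * x!2) + x!3 * (x!1 * x!1))"
  have "?H x * xi x = x!2 * (?K * x!3) + ?K * (x!0 * x!2)" by (simp add: xi_def ring_distribs mult_ac)
  also have "\<dots> = (?K * x!3) * eta x" unfolding C_rel(1)[OF x] by (simp add: eta_def ring_distribs mult_ac)
  also have "\<dots> = unif ptS x ^ 3 * (x!2 * x!2)"
    unfolding near_S[OF x] by (simp add: unif_def power3_eq_cube mult_ac)
  finally show "?H x * xi x = unif ptS x ^ 3 * (x!2 * x!2)" .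
qed

text \<open>The plane through \<open>ptO\<close>, \<open>ptS\<close> and q; it also contains the
  conjugate \<open>rev q\<close>. For q = \<open>ptO\<close> it is the plane meeting the curve three
  times at \<open>ptO\<close>, so \<open>xi\<close> and \<open>eta\<close> stand in the opposite
  places to those in \<open>unif\<close>.\<close>

definition pencil :: "'a list \<Rightarrow> 'a list \<Rightarrow> 'a" where
  "pencil q = (if q = ptO then eta else if q = ptS then xi else (\<lambda>x. eta x - eta q * xi x))"

lemma form_fun_pencil: "form_fun 1 (pencil q)"
proof -
  have "form_fun 1 (\<lambda>x. eta x - eta q * xi x)" by (intro form_fun_diff form_fun_scale form_fun_xi form_fun_eta)
  then show ?thesis by (simp add: pencil_def)
qed

lemma rev_pts [simp]: "rev ptO = (ptO :: 'a list)" "rev ptS = (ptS :: 'a list)" "rev (pt u y) = (pt u (y + 1) :: 'a list)"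
  by (simp_all add: ptO_def ptS_def pt_def add.assoc)

lemma on_curve_add_1 [simp]: "on_curve u (y + 1) \<longleftrightarrow> on_curve u y"
proof -
  have "(y + 1)\<^sup>2 + (y + 1) = y\<^sup>2 + y" by (simp add: square_add algebra_simps)
  then show ?thesis unfolding on_curve_def by (simp only:)
qed

lemma rev_N: "p \<in> N \<Longrightarrow> rev p \<in> N"
  by (erule N_cases) simp_all

lemma on_curve_same_u:
  assumes "on_curve u y" "on_curve u z"
  shows "z = y \<or> z = y + 1"
proof -
  have "c * u * (y\<^sup>2 + y) = c * u * (z\<^sup>2 + z)" using assms by (simp add: on_curve_def)
  then have "y\<^sup>2 + y = z\<^sup>2 + z" using on_curve_nz[OF assms(1)] c_nz by simp
  then have "(y\<^sup>2 + y) + (z\<^sup>2 + z) = 0" by (simp only: add_self)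
  moreover have "(y + z) * (y + z + 1) = (y\<^sup>2 + y) + (z\<^sup>2 + z)" by (simp add: power2_eq_square algebra_simps)
  ultimately have "(y + z) * (y + (z + 1)) = 0" by (simp only: add.assoc)
  then show ?thesis by (auto simp: add_eq_0_char2)
qed

lemma has_ord_pencil:
  assumes "p \<in> N" "q \<in> N"
  shows "has_ord p (pencil q) (of_bool (p = ptO) + of_bool (p = ptS) + of_bool (p = q) + of_bool (p = rev q))"
  using assms(1)
proof (cases p rule: N_cases)
  case 1
  show ?thesis using assms(2)
  proof (cases q rule: N_cases)
    case (3 u y)
    have "has_ord ptO (\<lambda>x. u * xi x + eta x) 1"
    proof (rule has_ord_add_ord_at_least[OF form_fun_scale[OF form_fun_xi] form_fun_eta])
      show "ord_at_least ptO eta (Suc 1)" by (rule ord_at_least_mono[OF has_ord_imp_ord_at_least[OF has_ord_O_eta]]) simp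
      show "has_ord ptO (\<lambda>x. u * xi x) 1" by (rule has_ord_scale[OF _ has_ord_O_xi]) fact
    qed simp
    then show ?thesis using 1 3 by (simp add: pencil_def minus_is_plus add.commute)
  qed (use 1 has_ord_O_xi has_ord_O_eta in \<open>simp_all add: pencil_def eval_nat_numeral\<close>)
next
  case 2
  show ?thesis using assms(2)
  proof (cases q rule: N_cases)
    case (3 u y)
    have "has_ord ptS (\<lambda>x. eta x + u * xi x) 1"
    proof (rule has_ord_add_ord_at_least[OF form_fun_eta form_fun_scale[OF form_fun_xi] has_ord_S_eta])
      show "ord_at_least ptS (\<lambda>x. u * xi x) (Suc 1)"
        by (rule ord_at_least_mono[OF has_ord_imp_ord_at_least[OF has_ord_scale[OF _ has_ord_S_xi]]]) (use 3 in auto)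
    qed simp
    then show ?thesis using 2 3 by (simp add: pencil_def minus_is_plus)
  qed (use 2 has_ord_S_xi has_ord_S_eta in \<open>simp_all add: pencil_def eval_nat_numeral\<close>)
next
  case (3 u y)
  show ?thesis using assms(2)
  proof (cases q rule: N_cases)
    case 1
    then show ?thesis using has_ord_0[OF form_fun_eta, of p] 3 by (simp add: pencil_def)
  next
    case 2
    then show ?thesis using has_ord_0[OF form_fun_xi, of p] 3 by (simp add: pencil_def)
  next
    case q: (3 v z)
    show ?thesis
    proof (cases "u = v")
      case True
      with 3 q have "pencil q = unif p" by (simp add: pencil_def unif_def)
      \<comment> \<open>An affine point never equals its conjugate, since y and y + 1 differ. So
        exactly one of the two terms counts.\<close>
      moreover have "of_bool (y = z) + of_bool (y = z + 1) = (1::nat)"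
        using on_curve_same_u[of u z y] 3 q True by auto
      ultimately show ?thesis using 3 q True has_ord_unif[of p] by simp
    next
      case False
      with 3 q have "pencil q p \<noteq> 0" by (simp add: pencil_def minus_is_plus add_eq_0_char2)
      with has_ord_0[OF form_fun_pencil] False 3 q show ?thesis by simp
    qed
  qed
qed

lemma pencil_of_pencil:
  assumes "\<alpha> \<noteq> 0 \<or> \<beta> \<noteq> 0"
  shows "\<exists>q\<in>N. \<exists>\<kappa>. \<kappa> \<noteq> 0 \<and> (\<forall>x. \<alpha> * xi x + \<beta> * eta x = \<kappa> * pencil q x)"
proof (cases "\<beta> = 0")
  case True
  with assms show ?thesis by (intro bexI[of _ ptS] exI[of _ \<alpha>]) (simp_all add: pencil_def)
next
  case \<beta>: False
  show ?thesis
  proof (cases "\<alpha> = 0")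
    case True
    with \<beta> show ?thesis by (intro bexI[of _ ptO] exI[of _ \<beta>]) (simp_all add: pencil_def)
  next
    case False
    define u where "u = \<alpha> / \<beta>"
    have "u \<noteq> 0" using False \<beta> by (simp add: u_def)
    then obtain y where "on_curve u y" using on_curve_exists by blast
    with \<beta> show ?thesis
      by (intro bexI[of _ "pt u y"] exI[of _ \<beta>])
        (simp_all add: pencil_def minus_is_plus u_def field_simps)
  qed
qed

subsection \<open>The involution\<close>

lemma rev_C: "x \<in> C \<Longrightarrow> rev x \<in> C"
proof -
  assume x: "x \<in> C"
  then obtain x0 x1 x2 x3 where [simp]: "x = [x0, x1, x2, x3]" using C_length by (metis list4_cases)
  from x C_rel(1)[OF x] show ?thesis by (simp add: z4_cone_def add_ac mult_ac) auto
qed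

lemma xi_rev: "length x = 4 \<Longrightarrow> xi (rev x) = xi x" and eta_rev: "length x = 4 \<Longrightarrow> eta (rev x) = eta x"
  by (auto elim!: list4_cases simp: xi_def eta_def add_ac)

lemma unif_rev: "p \<in> N \<Longrightarrow> length x = 4 \<Longrightarrow> unif (rev p) (rev x) = unif p x"
  by (erule N_cases) (simp_all add: unif_def xi_rev eta_rev)

lemma has_ord_rev:
  assumes "has_ord p f n" "p \<in> N"
  shows "has_ord (rev p) (\<lambda>x. f (rev x)) n"
proof -
  from assms(1) obtain h g d e where *: "form_fun d h" "form_fun e g" "h p \<noteq> 0" "g p \<noteq> 0"
    "\<And>x. x \<in> C \<Longrightarrow> h x * f x = unif p x ^ n * g x" by (rule has_ordE) blast
  show ?thesis
  proof (rule has_ordI[OF form_fun_rev[OF *(1)] form_fun_rev[OF *(2)]])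
    fix x assume x: "x \<in> C"
    have "unif (rev p) x = unif p (rev x)" using unif_rev[OF assms(2), of "rev x"] C_length[OF x] by simp
    then show "h (rev x) * f (rev x) = unif (rev p) x ^ n * g (rev x)" using *(5)[OF rev_C[OF x]] by simp
  qed (use * in auto)
qed

lemma nonvanishing_rev: "nonvanishing f \<Longrightarrow> nonvanishing (\<lambda>x. f (rev x))"
  unfolding nonvanishing_def by (metis rev_C rev_rev_ident)

subsection \<open>Affine functions\<close>

text \<open>The power of \<open>eta\<close> clears the denominators of the Laurent polynomials. They
  arise from y^2 = y + (1 + u)^2 / (c u), and u has no zeros on the affine curve.\<close>

definition affine_rep :: "('a list \<Rightarrow> 'a) \<Rightarrow> nat \<Rightarrow> 'a poly \<Rightarrow> 'a poly \<Rightarrow> bool" where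
  "affine_rep f k A B \<longleftrightarrow> (\<forall>x\<in>C. xi x = 1 \<longrightarrow> eta x ^ k * f x = poly A (eta x) + poly B (eta x) * x!3)"

definition affine_fun :: "('a list \<Rightarrow> 'a) \<Rightarrow> bool" where
  "affine_fun f \<longleftrightarrow> (\<exists>k A B. affine_rep f k A B)"

lemma affine_funI: "affine_rep f k A B \<Longrightarrow> affine_fun f"
  by (auto simp: affine_fun_def)

lemma affine_coords:
  assumes "x \<in> C" "xi x = 1"
  shows "x!0 = x!3 + 1" "x!1 = eta x * (x!3 + 1)" "x!2 = eta x * x!3" "eta x \<noteq> 0"
    "c * eta x * (x!3)\<^sup>2 = c * eta x * x!3 + (1 + eta x)\<^sup>2"
proof -
  note * = C_affine[OF assms]
  from *(1) show "x!0 = x!3 + 1" "x!1 = eta x * (x!3 + 1)" "x!2 = eta x * x!3"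
    by (auto simp: pt_def dest: arg_cong[where f = "\<lambda>x. x!0"] arg_cong[where f = "\<lambda>x. x!1"] arg_cong[where f = "\<lambda>x. x!2"])
  show "eta x \<noteq> 0" using on_curve_nz *(2) .
  show "c * eta x * (x!3)\<^sup>2 = c * eta x * x!3 + (1 + eta x)\<^sup>2"
    using *(2) by (simp add: on_curve_def distrib_left) (metis add.commute add_self2)
qed

lemma affine_repD: "affine_rep f k A B \<Longrightarrow> x \<in> C \<Longrightarrow> xi x = 1 \<Longrightarrow> eta x ^ k * f x = poly A (eta x) + poly B (eta x) * x!3"
  by (auto simp: affine_rep_def)

lemma affine_fun_add:
  assumes "affine_fun f" "affine_fun g"
  shows "affine_fun (\<lambda>x. f x + g x)"
proof -
  from assms obtain k A B k' A' B' where *: "affine_rep f k A B" "affine_rep g k' A' B'"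
    by (auto simp: affine_fun_def)
  have "affine_rep (\<lambda>x. f x + g x) (k + k') (monom 1 k' * A + monom 1 k * A') (monom 1 k' * B + monom 1 k * B')"
    unfolding affine_rep_def
  proof (intro ballI impI)
    fix x assume x: "x \<in> C" "xi x = 1"
    have "eta x ^ (k + k') * (f x + g x) = eta x ^ k' * (eta x ^ k * f x) + eta x ^ k * (eta x ^ k' * g x)"
      by (simp add: power_add algebra_simps)
    also have "\<dots> = poly (monom 1 k' * A + monom 1 k * A') (eta x) + poly (monom 1 k' * B + monom 1 k * B') (eta x) * x ! 3"
      unfolding affine_repD[OF *(1) x] affine_repD[OF *(2) x] by (simp add: poly_monom algebra_simps)
    finally show "eta x ^ (k + k') * (f x + g x) = poly (monom 1 k' * A + monom 1 k * A') (eta x)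
       + poly (monom 1 k' * B + monom 1 k * B') (eta x) * x ! 3" .
  qed
  then show ?thesis by (rule affine_funI)
qed

lemma affine_fun_mult:
  assumes "affine_fun f" "affine_fun g"
  shows "affine_fun (\<lambda>x. f x * g x)"
proof -
  from assms obtain k A B k' A' B' where *: "affine_rep f k A B" "affine_rep g k' A' B'"
    by (auto simp: affine_fun_def)
  \<comment> \<open>The product of A + B y and A' + B' y contains y^2. Multiplying by c u, here
    \<open>[:0, c:]\<close>, turns it into c u y + (1 + u)^2 without division.\<close>
  let ?A = "[:0, c:] * (A * A') + B * B' * [:1, 1:] ^ 2"
  let ?B = "[:0, c:] * (A * B' + A' * B + B * B')"
  have "affine_rep (\<lambda>x. f x * g x) (Suc (k + k')) (smult (inverse c) ?A) (smult (inverse c) ?B)"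
    unfolding affine_rep_def
  proof (intro ballI impI)
    fix x assume x: "x \<in> C" "xi x = 1"
    note r = affine_coords(5)[OF x]
    have "c * (eta x ^ Suc (k + k') * (f x * g x)) = c * eta x * ((eta x ^ k * f x) * (eta x ^ k' * g x))"
      by (simp add: power_add mult_ac)
    also have "\<dots> = c * eta x * (poly A (eta x) * poly A' (eta x)) +
      c * eta x * (poly A (eta x) * poly B' (eta x) + poly A' (eta x) * poly B (eta x)) * x!3 +
      poly B (eta x) * poly B' (eta x) * (c * eta x * (x!3)\<^sup>2)"
      unfolding affine_repD[OF *(1) x] affine_repD[OF *(2) x] by (simp add: power2_eq_square algebra_simps)
    also have "\<dots> = poly ?A (eta x) + poly ?B (eta x) * x!3"
      unfolding r by (simp add: algebra_simps)
    finally have "inverse c * (c * (eta x ^ Suc (k + k') * (f x * g x))) =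
       inverse c * (poly ?A (eta x) + poly ?B (eta x) * x!3)" by simp
    then show "eta x ^ Suc (k + k') * (f x * g x) = poly (smult (inverse c) ?A) (eta x)
       + poly (smult (inverse c) ?B) (eta x) * x ! 3"
      using c_nz by (simp only: mult.assoc[symmetric] left_inverse[OF c_nz] mult_1_left poly_smult distrib_left)
  qed
  then show ?thesis by (rule affine_funI)
qed

lemma affine_fun_poly: "affine_fun (\<lambda>x. poly A (eta x))"
  by (rule affine_funI[of _ 0 A 0]) (simp add: affine_rep_def)

lemma affine_fun_x3: "affine_fun (\<lambda>x. x!3)"
  by (rule affine_funI[of _ 0 0 1]) (simp add: affine_rep_def)

lemma affine_fun_cong: "(\<And>x. x \<in> C \<Longrightarrow> xi x = 1 \<Longrightarrow> f x = g x) \<Longrightarrow> affine_fun f \<Longrightarrow> affine_fun g"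
  unfolding affine_fun_def affine_rep_def by auto

lemma affine_fun_const: "affine_fun (\<lambda>_. a)"
  using affine_fun_poly[of "[:a:]"] by simp

lemma affine_fun_nth: 
  assumes "i < 4" shows "affine_fun (\<lambda>x. x ! i)"
proof -
  have 0: "affine_fun (\<lambda>x. x!3 + 1)" by (intro affine_fun_add affine_fun_x3 affine_fun_const)
  have e: "affine_fun eta" using affine_fun_poly[of "[:0,1:]"] by simp
  from assms consider "i = 0" | "i = 1" | "i = 2" | "i = 3" by linarith
  then show ?thesis
  proof cases
    case 1 then show ?thesis using affine_fun_cong[OF _ 0, of "\<lambda>x. x!0"] affine_coords(1) by simp
  next
    case 2 then show ?thesis using affine_fun_cong[OF _ affine_fun_mult[OF e 0], of "\<lambda>x. x!1"] affine_coords(2) by simp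
  next
    case 3 then show ?thesis using affine_fun_cong[OF _ affine_fun_mult[OF e affine_fun_x3], of "\<lambda>x. x!2"] affine_coords(3) by simp
  qed (simp add: affine_fun_x3)
qed

lemma form_fun_imp_affine_fun: "form_fun m f \<Longrightarrow> affine_fun f"
proof (induction rule: form_fun_induct)
  case (zero m)
  show ?case by (rule affine_fun_const)
next
  case (const a)
  show ?case by (rule affine_fun_const)
next
  case (var m f i)
  then show ?case by (intro affine_fun_mult affine_fun_nth)
next
  case (add m f g)
  then show ?case by (intro affine_fun_add)
next
  case (cong m f g)
  then show ?case using affine_fun_cong[of f g] C_length by blast
qed

text \<open>The two points above u have second coordinates y and y + 1, and the values of A + B y
  there add up to B(u). If both vanish for all but finitely many u, then so do B and A, hence they
  are zero polynomials. This removes finitely many exceptional fibres from an identity.\<close>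

lemma affine_fun_zero_if:
  assumes "affine_fun f" "finite U" "\<And>x. x \<in> C \<Longrightarrow> xi x = 1 \<Longrightarrow> eta x \<notin> U \<Longrightarrow> f x = 0"
    and x: "x \<in> C" "xi x = 1"
  shows "f x = 0"
proof -
  from assms(1) obtain k A B where *: "affine_rep f k A B" by (auto simp: affine_fun_def)
  have AB: "poly A u = 0 \<and> poly B u = 0" if u: "u \<notin> insert 0 U" for u
  proof -
    from u obtain y where y: "on_curve u y" using on_curve_exists by auto
    have "f (pt u y) = 0" "f (pt u (y + 1)) = 0"
      using u y N_subset_C by (auto intro!: assms(3))
    then have "poly A u + poly B u * y = 0" "poly A u + poly B u * (y + 1) = 0"
      using affine_repD[OF *, of "pt u y"] affine_repD[OF *, of "pt u (y + 1)"] y N_subset_C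
      by auto
    moreover have "(poly A u + poly B u * y) + (poly A u + poly B u * (y + 1)) = poly B u"
      by (simp add: algebra_simps)
    ultimately show ?thesis by auto
  qed
  have "A = 0" by (rule poly_zero_if_cofinite_roots[of "insert 0 U"]) (use AB assms(2) in auto)
  moreover have "B = 0" by (rule poly_zero_if_cofinite_roots[of "insert 0 U"]) (use AB assms(2) in auto)
  ultimately have "eta x ^ k * f x = 0" using affine_repD[OF * x] by simp
  then show ?thesis using affine_coords(4)[OF x] by simp
qed

subsection \<open>The norm to the projective line\<close>

lemma norm_exists:
  assumes "form_fun m f" "nonvanishing f"
  shows "\<exists>k n. n \<noteq> 0 \<and> (\<forall>x\<in>C. xi x = 1 \<longrightarrow> eta x ^ k * (f x * f (rev x)) = poly n (eta x))"
proof -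
  from form_fun_imp_affine_fun[OF assms(1)] obtain k A B where *: "affine_rep f k A B" by (auto simp: affine_fun_def)
  \<comment> \<open>The norm of A + B y is A (A + B) + B^2 (y^2 + y), as the conjugate is A + B (y +
    1). Multiplication by c u replaces y^2 + y by (1 + u)^2.\<close>
  define n' where "n' = [:0, c:] * (A * (A + B)) + B ^ 2 * [:1, 1:] ^ 2"
  define n where "n = smult (inverse c) n'"
  have n': "c * poly n t = poly n' t" for t using c_nz by (simp add: n_def)
  have n: "eta x ^ (Suc (k + k)) * (f x * f (rev x)) = poly n (eta x)" if x: "x \<in> C" "xi x = 1" for x
  proof -
    note r = affine_coords[OF x]
    have rx: "rev x \<in> C" "xi (rev x) = 1" "eta (rev x) = eta x" "rev x ! 3 = x!0"
      using x(2) C_length[OF x(1)] rev_C[OF x(1)] xi_rev[OF C_length[OF x(1)]] eta_rev[OF C_length[OF x(1)]]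
      by (simp_all add: rev_nth)
    have "c * (eta x ^ (Suc (k + k)) * (f x * f (rev x))) = c * eta x * ((eta x ^ k * f x) * (eta (rev x) ^ k * f (rev x)))"
      unfolding rx(3) by (simp add: power_add mult_ac)
    also have "\<dots> = c * eta x * (poly A (eta x) * (poly A (eta x) + poly B (eta x)))
       + (poly B (eta x))\<^sup>2 * (c * eta x * (x!3)\<^sup>2 + c * eta x * x!3)"
      unfolding affine_repD[OF * x] affine_repD[OF * rx(1,2)] unfolding rx(3,4) r(1)
      by (simp add: power2_eq_square algebra_simps)
    also have "\<dots> = c * poly n (eta x)"
      unfolding r(5) n' by (simp add: n'_def algebra_simps)
    finally show ?thesis using c_nz by simp
  qed
  moreover have "n \<noteq> 0"
  proof
    assume "n = 0"
    have F: "form_fun (Suc (k + k) + (m + m)) (\<lambda>x. eta x ^ (Suc (k + k)) * (f x * f (rev x)))"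
      by (intro form_fun_mult form_fun_power1 form_fun_eta form_fun_rev assms)
    have "eta x ^ (Suc (k + k)) * (f x * f (rev x)) = 0" if "x \<in> C" for x
      by (rule form_fun_eq_if_affine_eq[OF F form_fun_zero _ that]) (use n \<open>n = 0\<close> in simp)
    moreover have "nonvanishing (\<lambda>x. eta x ^ (Suc (k + k)) * (f x * f (rev x)))"
      by (intro nonvanishing_mult[OF form_fun_power1[OF form_fun_eta] form_fun_mult[OF assms(1) form_fun_rev[OF assms(1)]]] nonvanishing_power nonvanishing_eta
          nonvanishing_mult[OF assms(1) form_fun_rev[OF assms(1)]] assms(2) nonvanishing_rev)
    ultimately show False by (auto simp: nonvanishing_def)
  qed
  ultimately show ?thesis by blast
qed

lemma form_fun_pencil_prod: "form_fun (length qs) (\<lambda>x. \<Prod>q\<leftarrow>qs. pencil q x)"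
  by (induction qs) (use form_fun_const[of 1] form_fun_mult[OF form_fun_pencil] in auto)

lemma has_ord_pencil_prod:
  assumes "p \<in> N" "set qs \<subseteq> N"
  shows "has_ord p (\<lambda>x. \<Prod>q\<leftarrow>qs. pencil q x)
    (\<Sum>q\<leftarrow>qs. of_bool (p = ptO) + of_bool (p = ptS) + of_bool (p = q) + of_bool (p = rev q))"
  using assms(2)
proof (induction qs)
  case Nil
  then show ?case using has_ord_0[OF form_fun_const[of 1]] by simp
next
  case (Cons q qs)
  then show ?case using has_ord_mult[OF has_ord_pencil[OF assms(1), of q] Cons.IH] by simp
qed

text \<open>The polynomial splits into linear factors, and u - a is the value of the plane eta - a
  xi when \<open>xi\<close> is 1. For a nonzero this plane belongs to a point above a; the root 0
  gives the pencil member of \<open>ptO\<close>.\<close>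

lemma poly_as_pencil_prod:
  assumes "n \<noteq> 0"
  obtains qs \<kappa> where "length qs = degree n" "set qs \<subseteq> N" "\<kappa> \<noteq> 0"
    "\<And>x. xi x = 1 \<Longrightarrow> poly n (eta x) = \<kappa> * (\<Prod>q\<leftarrow>qs. pencil q x)"
proof -
  from alg_closed_imp_factorization[OF assms] obtain M
    where M: "size M = degree n" "n = smult (lead_coeff n) (\<Prod>a\<in>#M. [:-a, 1:])" by blast
  have "\<exists>qs \<kappa>. length qs = size M \<and> set qs \<subseteq> N \<and> \<kappa> \<noteq> 0 \<and>
     (\<forall>x. xi x = 1 \<longrightarrow> poly (\<Prod>a\<in>#M. [:-a, 1:]) (eta x) = \<kappa> * (\<Prod>q\<leftarrow>qs. pencil q x))"
  proof (induction M)
    case empty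
    show ?case by (intro exI[of _ "[]"] exI[of _ 1]) simp
  next
    case (add a M)
    then obtain qs \<kappa> where 1: "length qs = size M" "set qs \<subseteq> N" "\<kappa> \<noteq> 0"
      "\<And>x. xi x = 1 \<Longrightarrow> poly (\<Prod>a\<in>#M. [:-a, 1:]) (eta x) = \<kappa> * (\<Prod>q\<leftarrow>qs. pencil q x)" by blast
    from pencil_of_pencil[of "-a" 1] obtain q \<kappa>' where 2: "q \<in> N" "\<kappa>' \<noteq> 0"
      "\<And>x. -a * xi x + eta x = \<kappa>' * pencil q x" by auto
    have "poly (\<Prod>a\<in>#add_mset a M. [:-a, 1:]) (eta x) = \<kappa>' * \<kappa> * (\<Prod>q\<leftarrow>q # qs. pencil q x)" if x: "xi x = 1" for x
    proof -
      have "poly [:-a, 1:] (eta x) = \<kappa>' * pencil q x" using 2(3)[of x] x by simp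
      then show ?thesis using 1(4)[OF x] by (simp only: image_mset_add_mset prod_mset.add_mset poly_mult) simp
    qed
    with 1 2 show ?case by (intro exI[of _ "q # qs"] exI[of _ "\<kappa>' * \<kappa>"]) auto
  qed
  then obtain qs \<kappa> where 1: "length qs = size M" "set qs \<subseteq> N" "\<kappa> \<noteq> 0"
      "\<And>x. xi x = 1 \<Longrightarrow> poly (\<Prod>a\<in>#M. [:-a, 1:]) (eta x) = \<kappa> * (\<Prod>q\<leftarrow>qs. pencil q x)" by blast
  show ?thesis
  proof (rule that[of qs "lead_coeff n * \<kappa>"])
    fix x :: "'a list" assume x: "xi x = 1"
    have "poly n (eta x) = lead_coeff n * poly (\<Prod>a\<in>#M. [:-a, 1:]) (eta x)"
      by (subst M(2)) (simp only: poly_smult)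
    then show "poly n (eta x) = lead_coeff n * \<kappa> * (\<Prod>q\<leftarrow>qs. pencil q x)" by (simp only: 1(4)[OF x] mult.assoc)
  qed (use 1 M assms in auto)
qed

text \<open>A form divides its norm, which is a product of pencil planes up to powers of
  \<open>xi\<close> and \<open>eta\<close> and hence has known orders. The finite list of points
  bounds the support of the divisor.\<close>

lemma has_ord_exists:
  assumes "form_fun m f" "nonvanishing f"
  shows "\<exists>qs. set qs \<subseteq> N \<and> (\<forall>p\<in>N. \<exists>n. has_ord p f n \<and> (n = 0 \<or> p \<in> {ptO, ptS} \<union> set qs \<union> rev ` set qs))"
proof -
  from norm_exists[OF assms] obtain k n where n: "n \<noteq> 0"
    "\<And>x. x \<in> C \<Longrightarrow> xi x = 1 \<Longrightarrow> eta x ^ k * (f x * f (rev x)) = poly n (eta x)" by blast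
  from poly_as_pencil_prod[OF n(1)] obtain qs \<kappa> where qs: "set qs \<subseteq> N" "\<kappa> \<noteq> 0"
    "\<And>x. xi x = 1 \<Longrightarrow> poly n (eta x) = \<kappa> * (\<Prod>q\<leftarrow>qs. pencil q x)" by metis
  let ?g = "\<lambda>x. f (rev x) * (eta x ^ k * xi x ^ length qs)"
  have fg: "form_fun (m + (k + length qs)) ?g"
    by (intro form_fun_mult form_fun_rev form_fun_power1 form_fun_eta form_fun_xi assms)
  have F2: "form_fun (length qs + (m + m + k)) (\<lambda>x. \<kappa> * (\<Prod>q\<leftarrow>qs. pencil q x) * xi x ^ (m + m + k))"
    by (intro form_fun_mult form_fun_power1 form_fun_xi form_fun_scale form_fun_pencil_prod)
  have deg: "m + (m + (k + length qs)) = length qs + (m + m + k)" by simp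
  have eq: "f x * ?g x = \<kappa> * (\<Prod>q\<leftarrow>qs. pencil q x) * xi x ^ (m + m + k)" if "x \<in> C" for x
    by (rule form_fun_eq_if_affine_eq[OF form_fun_mult[OF assms(1) fg, unfolded deg] F2 _ that])
      (use n(2) qs(3) in \<open>simp add: mult_ac\<close>)
  have "\<exists>i. has_ord p f i \<and> (i = 0 \<or> p \<in> {ptO, ptS} \<union> set qs \<union> rev ` set qs)" if p: "p \<in> N" for p
  proof -
    let ?n = "(\<Sum>q\<leftarrow>qs. of_bool (p = ptO) + of_bool (p = ptS) + of_bool (p = q) + of_bool (p = rev q)) +
       (m + m + k) * (of_bool (p = ptO) + of_bool (p = ptS) + of_bool (p = ptS) + of_bool (p = rev ptS))"
    have "has_ord p (\<lambda>x. \<kappa> * (\<Prod>q\<leftarrow>qs. pencil q x) * xi x ^ (m + m + k)) ?n"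
      using has_ord_pencil[OF p, of ptS]
      by (intro has_ord_mult has_ord_power has_ord_scale has_ord_pencil_prod qs p) (simp add: pencil_def)
    then have "has_ord p (\<lambda>x. f x * ?g x) ?n" by (rule has_ord_eq) (simp add: eq)
    from has_ord_exists_factor[OF assms(1) fg this p] obtain i where i: "i \<le> ?n" "has_ord p f i" by blast
    show ?thesis
    proof (cases "p \<in> {ptO, ptS} \<union> set qs \<union> rev ` set qs")
      case False
      then have "(\<Sum>q\<leftarrow>qs. of_bool (p = ptO) + of_bool (p = ptS) + of_bool (p = q) + of_bool (p = rev q)) = (0::nat)"
      proof -
        have "map (\<lambda>q. of_bool (p = ptO) + of_bool (p = ptS) + of_bool (p = q) + of_bool (p = rev q)) qs = map (\<lambda>_. 0::nat) qs"
          using False by (intro map_cong) auto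
        then show ?thesis by (simp add: sum_list_triv)
      qed
      note z = this
      have "i = 0" using False i(1) unfolding z by auto
      with i show ?thesis by blast
    qed (use i in blast)
  qed
  with qs(1) show ?thesis by blast
qed

lemma linear_norm:
  assumes "form_fun 1 f" "nonvanishing f"
  obtains qs \<kappa> where "length qs = 4" "set qs \<subseteq> N" "\<kappa> \<noteq> 0"
    "\<And>x. x \<in> C \<Longrightarrow> xi x * eta x * (f x * f (rev x)) = \<kappa> * (\<Prod>q\<leftarrow>qs. pencil q x)"
proof -
  from assms(1) obtain a0 a1 a2 a3 where f: "\<And>x. length x = 4 \<Longrightarrow> f x = a0 * x!0 + a1 * x!1 + a2 * x!2 + a3 * x!3"
    unfolding form_fun_1_iff by blast
  \<comment> \<open>Substituting the affine coordinates (y + 1, u (y + 1), u y, y) turns the linear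
    form into A + B y with these coefficients.\<close>
  let ?A = "[:a0, a1:]" and ?B = "[:a0 + a3, a1 + a2:]"
  define n' where "n' = [:0, c:] * (?A * (?A + ?B)) + ?B ^ 2 * [:1, 1:] ^ 2"
  define n where "n = smult (inverse c) n'"
  have n': "c * poly n t = poly n' t" for t using c_nz by (simp add: n_def)
  have n: "eta x * (f x * f (rev x)) = poly n (eta x)" if x: "x \<in> C" "xi x = 1" for x
  proof -
    note r = affine_coords[OF x]
    have rx: "rev x ! 3 = x!0" "rev x ! 0 = x!3" "rev x ! 1 = x!2" "rev x ! 2 = x!1"
      using C_length[OF x(1)] by (simp_all add: rev_nth numeral_eq_Suc)
    have 1: "f x = poly ?A (eta x) + poly ?B (eta x) * x!3"
      using f[of x] r C_length[OF x(1)] by (simp add: algebra_simps)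
    have 2: "f (rev x) = poly ?A (eta x) + poly ?B (eta x) * (x!3 + 1)"
      using f[of "rev x"] r rx C_length[OF x(1)] by (simp add: algebra_simps)
    have "c * (eta x * (f x * f (rev x))) = c * eta x * (poly ?A (eta x) * (poly ?A (eta x) + poly ?B (eta x)))
       + (poly ?B (eta x))\<^sup>2 * (c * eta x * (x!3)\<^sup>2 + c * eta x * x!3)"
      unfolding 1 2 by (simp only: power2_eq_square) (simp add: algebra_simps del: poly_pCons)
    also have "\<dots> = c * poly n (eta x)"
      unfolding r(5) n' by (simp add: n'_def algebra_simps)
    finally show ?thesis using c_nz by simp
  qed
  have fF: "form_fun (1 + 1 + (1 + 1)) (\<lambda>x. xi x * eta x * (f x * f (rev x)))"
    by (intro form_fun_mult form_fun_rev form_fun_xi form_fun_eta assms)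
  have nzF: "nonvanishing (\<lambda>x. xi x * eta x * (f x * f (rev x)))"
    by (rule nonvanishing_mult[OF form_fun_mult[OF form_fun_xi form_fun_eta] form_fun_mult[OF assms(1) form_fun_rev[OF assms(1)]]])
      (intro nonvanishing_mult[OF form_fun_xi form_fun_eta] nonvanishing_mult[OF assms(1) form_fun_rev[OF assms(1)]] nonvanishing_xi nonvanishing_eta nonvanishing_rev assms)+
  have "n \<noteq> 0"
  proof
    assume "n = 0"
    have "xi x * eta x * (f x * f (rev x)) = 0" if "x \<in> C" for x
      by (rule form_fun_eq_if_affine_eq[OF fF form_fun_zero _ that]) (use n \<open>n = 0\<close> in simp)
    with nzF show False by (simp add: nonvanishing_def)
  qed
  from poly_as_pencil_prod[OF this] obtain qs \<kappa> where qs: "length qs = degree n" "set qs \<subseteq> N" "\<kappa> \<noteq> 0"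
    "\<And>x. xi x = 1 \<Longrightarrow> poly n (eta x) = \<kappa> * (\<Prod>q\<leftarrow>qs. pencil q x)" by metis
  have deg: "degree n \<le> 4"
  proof -
    have "degree ([:0, c:] * (?A * (?A + ?B))) \<le> 1 + (1 + 1)"
      by (intro order.trans[OF degree_mult_le] add_mono degree_add_le) auto
    moreover have "degree (?B ^ 2 * [:1, 1:] ^ 2) \<le> 2 + 2"
      by (intro order.trans[OF degree_mult_le] add_mono order.trans[OF degree_power_le]) auto
    ultimately have "degree ([:0, c:] * (?A * (?A + ?B)) + ?B ^ 2 * [:1, 1:] ^ 2) \<le> 4"
      by (intro degree_add_le) auto
    then show ?thesis unfolding n_def n'_def using order.trans[OF degree_smult_le] by blast
  qed
  \<comment> \<open>Homogenising to degree 4 may require powers of \<open>xi\<close>. The pencil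
    member of \<open>ptS\<close> is \<open>xi\<close>, so padding with \<open>ptS\<close> supplies
    them without changing the affine values.\<close>
  let ?qs = "qs @ replicate (4 - length qs) ptS"
  have l: "length ?qs = 4" using qs(1) deg by simp
  have "xi x * eta x * (f x * f (rev x)) = \<kappa> * (\<Prod>q\<leftarrow>?qs. pencil q x)" if "x \<in> C" for x
  proof (rule form_fun_eq_if_affine_eq[OF _ _ _ that])
    show "form_fun 4 (\<lambda>x. xi x * eta x * (f x * f (rev x)))" using fF by (simp add: numeral_eq_Suc)
    show "form_fun 4 (\<lambda>x. \<kappa> * (\<Prod>q\<leftarrow>?qs. pencil q x))" using form_fun_scale[OF form_fun_pencil_prod[of ?qs]] l by metis
    show "xi x * eta x * (f x * f (rev x)) = \<kappa> * (\<Prod>q\<leftarrow>?qs. pencil q x)" if "x \<in> C" "xi x = 1" for x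
    proof -
      have "pencil ptS x = 1" using that by (simp add: pencil_def)
      then show ?thesis using n[OF that] qs(4)[OF that(2)] that(2) by simp
    qed
  qed
  then show ?thesis using l qs by (intro that[of ?qs \<kappa>]) auto
qed

text \<open>The product of \<open>xi\<close> and \<open>eta\<close> has divisor 4 (O) + 4 (S),
  exactly what the base points of four pencil planes contribute. Cancelling it leaves the divisor of
  f plus its conjugate.\<close>

lemma linear_orders:
  assumes "form_fun 1 f" "nonvanishing f"
  obtains qs where "length qs = 4" "set qs \<subseteq> N"
    "\<And>p i j. p \<in> N \<Longrightarrow> has_ord p f i \<Longrightarrow> has_ord (rev p) f j \<Longrightarrow> i + j = (\<Sum>q\<leftarrow>qs. of_bool (p = q) + of_bool (p = rev q))"
proof -
  from linear_norm[OF assms] obtain qs \<kappa> where qs: "length qs = 4" "set qs \<subseteq> N" "\<kappa> \<noteq> 0"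
    "\<And>x. x \<in> C \<Longrightarrow> xi x * eta x * (f x * f (rev x)) = \<kappa> * (\<Prod>q\<leftarrow>qs. pencil q x)" by metis
  have "i + j = (\<Sum>q\<leftarrow>qs. of_bool (p = q) + of_bool (p = rev q))" if p: "p \<in> N" "has_ord p f i" "has_ord (rev p) f j" for p i j
  proof -
    have "has_ord p (\<lambda>x. f (rev x)) j" using has_ord_rev[OF p(3) rev_N[OF p(1)]] by simp
    then have "has_ord p (\<lambda>x. pencil ptS x * pencil ptO x * (f x * f (rev x)))
       ((of_bool (p = ptO) + of_bool (p = ptS) + of_bool (p = ptS) + of_bool (p = rev ptS))
       + (of_bool (p = ptO) + of_bool (p = ptS) + of_bool (p = ptO) + of_bool (p = rev ptO)) + (i + j))"
      by (intro has_ord_mult has_ord_pencil p N_ptO N_ptS)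
    also have "(of_bool (p = ptO) + of_bool (p = ptS) + of_bool (p = ptS) + of_bool (p = rev ptS))
       + (of_bool (p = ptO) + of_bool (p = ptS) + of_bool (p = ptO) + of_bool (p = rev ptO)) + (i + j)
       = 4 * of_bool (p = ptO) + 4 * of_bool (p = ptS) + (i + j)" by simp
    finally have 1: "has_ord p (\<lambda>x. xi x * eta x * (f x * f (rev x))) (4 * of_bool (p = ptO) + 4 * of_bool (p = ptS) + (i + j))"
      by (simp only: pencil_def refl if_True if_False ptO_ne)
    have "has_ord p (\<lambda>x. \<kappa> * (\<Prod>q\<leftarrow>qs. pencil q x))
       (\<Sum>q\<leftarrow>qs. of_bool (p = ptO) + of_bool (p = ptS) + of_bool (p = q) + of_bool (p = rev q))"
      by (intro has_ord_scale has_ord_pencil_prod p qs)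
    then have "has_ord p (\<lambda>x. xi x * eta x * (f x * f (rev x)))
       (\<Sum>q\<leftarrow>qs. of_bool (p = ptO) + of_bool (p = ptS) + of_bool (p = q) + of_bool (p = rev q))"
      by (rule has_ord_eq) (simp add: qs(4))
    from has_ord_unique[OF p(1) 1 this] have "4 * of_bool (p = ptO) + 4 * of_bool (p = ptS) + (i + j) =
       (\<Sum>q\<leftarrow>qs. (of_bool (p = ptO) + of_bool (p = ptS)) + (of_bool (p = q) + of_bool (p = rev q)))"
      by (simp add: add.assoc)
    also have "\<dots> = 4 * of_bool (p = ptO) + 4 * of_bool (p = ptS) + (\<Sum>q\<leftarrow>qs. of_bool (p = q) + of_bool (p = rev q))"
      unfolding sum_list_addf using qs(1) by (simp add: sum_list_triv)
    finally show ?thesis by simp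
  qed
  with qs show ?thesis using that by blast
qed

end

section \<open>Homogeneous linear systems and roots of polynomials\<close>

lemma common_zero_of_functionals:
  fixes ws :: "('b \<Rightarrow> 'a::field) list"
  assumes "finite I" "card I > length ws"
  shows "\<exists>a. (\<exists>i\<in>I. a i \<noteq> 0) \<and> (\<forall>w\<in>set ws. (\<Sum>i\<in>I. a i * w i) = 0)"
  using assms
proof (induction "length ws" arbitrary: ws I)
  case 0
  then obtain i where "i \<in> I" by fastforce
  with 0 show ?case by (intro exI[of _ "\<lambda>_. 1"]) auto
next
  case (Suc n)
  then obtain w vs where ws: "ws = w # vs" by (metis length_Suc_conv)
  show ?case
  proof (cases "\<forall>i\<in>I. w i = 0")
    case True
    from Suc.hyps(1)[of vs I] Suc.hyps(2) Suc.prems ws obtain a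
      where "\<exists>i\<in>I. a i \<noteq> 0" "\<forall>w\<in>set vs. (\<Sum>i\<in>I. a i * w i) = 0" by auto
    with True ws show ?thesis by (intro exI[of _ a]) auto
  next
    case False
    then obtain j where j: "j \<in> I" "w j \<noteq> 0" by blast
    let ?J = "I - {j}"
    \<comment> \<open>Elimination of the unknown with index j by means of the equation w, in which
      its coefficient is nonzero.\<close>
    let ?us = "map (\<lambda>v i. v i - w i / w j * v j) vs"
    have "card ?J > length ?us" using Suc.hyps(2) Suc.prems ws j by (simp add: card_Diff_singleton)
    from Suc.hyps(1)[of ?us ?J] this Suc.hyps(2) Suc.prems ws obtain a
      where a: "\<exists>i\<in>?J. a i \<noteq> 0" "\<forall>u\<in>set ?us. (\<Sum>i\<in>?J. a i * u i) = 0" by auto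
    define t where "t = - (\<Sum>i\<in>?J. a i * w i) / w j"
    let ?a = "a(j := t)"
    have sum: "(\<Sum>i\<in>I. ?a i * v i) = t * v j + (\<Sum>i\<in>?J. a i * v i)" for v
      using sum.remove[OF Suc.prems(1) j(1), of "\<lambda>i. ?a i * v i"] by simp
    have "(\<Sum>i\<in>I. ?a i * v i) = 0" if "v \<in> set ws" for v
    proof (cases "v = w")
      case True
      then show ?thesis using j unfolding sum by (simp add: t_def)
    next
      case False
      with that ws have "v \<in> set vs" by simp
      with a(2) have "(\<Sum>i\<in>?J. a i * (v i - w i / w j * v j)) = 0" by simp
      moreover have "(\<Sum>i\<in>?J. a i * (v i - w i / w j * v j)) = (\<Sum>i\<in>?J. a i * v i) + t * v j"
        by (simp add: t_def sum_subtractf right_diff_distrib sum_divide_distrib sum_distrib_right mult.assoc)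
      ultimately show ?thesis unfolding sum by (simp add: add.commute)
    qed
    moreover from a(1) have "\<exists>i\<in>I. ?a i \<noteq> 0" by auto
    ultimately show ?thesis by blast
  qed
qed

lemma form_fun_prod:
  assumes "finite A" "\<And>i. i \<in> A \<Longrightarrow> form_fun (k i) (h i)"
  shows "form_fun (\<Sum>i\<in>A. k i) (\<lambda>x. \<Prod>i\<in>A. h i x)"
  using assms
proof (induction A rule: finite_induct)
  case empty
  then show ?case using form_fun_const[of 1] by simp
next
  case (insert i A)
  then show ?case using form_fun_mult[of "k i" "h i" "\<Sum>i\<in>A. k i" "\<lambda>x. \<Prod>i\<in>A. h i x"] by simp
qed

text \<open>No affine point lies above u = 0, so this root imposes no condition there: its power is
  a unit on the affine curve and is kept apart from the other factors.\<close>

lemma split_off_zero_roots: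
  fixes n :: "'a::alg_closed_field poly"
  assumes "n \<noteq> 0"
  obtains l e as where "l \<noteq> 0" "0 \<notin> set as"
    "\<And>t. poly n t = l * t ^ e * (\<Prod>a\<leftarrow>as. t - a)"
proof -
  from alg_closed_imp_factorization[OF assms] obtain M
    where M: "n = smult (lead_coeff n) (\<Prod>a\<in>#M. [:-a, 1:])" by blast
  have "\<exists>e as. 0 \<notin> set as \<and> (\<forall>t. poly (\<Prod>a\<in>#M. [:-a, 1:]) t = t ^ e * (\<Prod>a\<leftarrow>as. t - a))"
  proof (induction M)
    case empty
    show ?case by (intro exI[of _ 0] exI[of _ "[]"]) simp
  next
    case (add a M)
    then obtain e as where *: "0 \<notin> set as" "\<And>t. poly (\<Prod>a\<in>#M. [:-a, 1:]) t = t ^ e * (\<Prod>a\<leftarrow>as. t - a)"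
      by blast
    show ?case
    proof (cases "a = 0")
      case True
      with * show ?thesis by (intro exI[of _ "Suc e"] exI[of _ as]) simp
    next
      case False
      have "poly (\<Prod>b\<in>#add_mset a M. [:-b, 1:]) t = t ^ e * (\<Prod>b\<leftarrow>a # as. t - b)" for t
        by (simp add: *(2) algebra_simps)
      with * False show ?thesis by (intro exI[of _ e] exI[of _ "a # as"]) simp
    qed
  qed
  then obtain e as where *: "0 \<notin> set as" "\<And>t. poly (\<Prod>a\<in>#M. [:-a, 1:]) t = t ^ e * (\<Prod>a\<leftarrow>as. t - a)"
    by blast
  have "poly n t = lead_coeff n * t ^ e * (\<Prod>a\<leftarrow>as. t - a)" for t
    by (subst M) (simp only: poly_smult *(2) mult.assoc)
  with * assms show ?thesis by (intro that[of "lead_coeff n" as e]) auto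
qed

context z4_model
begin

subsection \<open>Planes through given points\<close>

text \<open>Order at least d at p amounts to d linear conditions on the coefficients: the value at p
  vanishes, and after division by the uniformiser the quotient satisfies d - 1 further
  conditions.\<close>

lemma vanishing_conditions:
  assumes "\<And>i. i < 4 \<Longrightarrow> form_fun m (g i)" "p \<in> N"
  shows "\<exists>ws. length ws = d \<and> (\<forall>a::nat \<Rightarrow> 'a. (\<forall>w\<in>set ws. (\<Sum>i<4. a i * w i) = 0) \<longrightarrow>
     ord_at_least p (\<lambda>x. \<Sum>i<4. a i * g i x) d)"
  using assms(1)
proof (induction d arbitrary: m g)
  case 0
  have "ord_at_least p (\<lambda>x. \<Sum>i<4. a i * g i x) 0" for a :: "nat \<Rightarrow> 'a"
    by (rule ord_at_least_0[of m]) (intro form_fun_sum form_fun_scale 0, simp)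
  then show ?case by simp
next
  case (Suc d)
  have "\<exists>h k g' e. form_fun k h \<and> h p \<noteq> 0 \<and> form_fun e g' \<and> e + 1 = k + m \<and>
     (\<forall>x\<in>C. h x * (g i x - g i p * unit_at p x ^ m) = unif p x * g' x)" if "i < 4" for i
    by (rule locally_principal[OF Suc.prems[OF that] assms(2)])
  then obtain h k g' e where *: "\<And>i. i < 4 \<Longrightarrow> form_fun (k i) (h i)" "\<And>i. i < 4 \<Longrightarrow> h i p \<noteq> 0"
    "\<And>i. i < 4 \<Longrightarrow> form_fun (e i) (g' i)" "\<And>i. i < 4 \<Longrightarrow> e i + 1 = k i + m"
    "\<And>i x. i < 4 \<Longrightarrow> x \<in> C \<Longrightarrow> h i x * (g i x - g i p * unit_at p x ^ m) = unif p x * g' i x" by metis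
  \<comment> \<open>A common denominator for the four expansions, so that the quotient by the
    uniformiser is again a linear combination with the same coefficients a.\<close>
  define H where "H x = (\<Prod>i<4. h i x)" for x
  define g2 where "g2 i x = (\<Prod>j\<in>{..<4} - {i}. h j x) * g' i x" for i x
  have H: "form_fun (\<Sum>i<4. k i) H" "H p \<noteq> 0"
    using form_fun_prod[of "{..<4}" k h] * by (auto simp: H_def[abs_def])
  have Hi: "H x = (\<Prod>j\<in>{..<4} - {i}. h j x) * h i x" if "i < 4" for i x
    unfolding H_def using prod.remove[of "{..<4}" i "\<lambda>i. h i x"] that by (simp add: mult.commute)
  have ki: "(\<Sum>i<4. k i) = (\<Sum>j\<in>{..<4} - {i}. k j) + k i" if "i < 4" for i
    using sum.remove[of "{..<4}" i k] that by simp
  have g2: "form_fun ((\<Sum>i<4. k i) + m - 1) (g2 i)" if i: "i < 4" for i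
  proof -
    have "form_fun ((\<Sum>j\<in>{..<4} - {i}. k j) + e i) (g2 i)"
      unfolding g2_def by (intro form_fun_mult form_fun_prod) (use * i in auto)
    moreover have "(\<Sum>j\<in>{..<4} - {i}. k j) + e i = (\<Sum>i<4. k i) + m - 1"
      using ki[OF i] *(4)[OF i] by simp
    ultimately show ?thesis by simp
  qed
  have "\<exists>ws. length ws = d \<and> (\<forall>a::nat \<Rightarrow> 'a. (\<forall>w\<in>set ws. (\<Sum>i<4. a i * w i) = 0) \<longrightarrow>
     ord_at_least p (\<lambda>x. \<Sum>i<4. a i * g2 i x) d)"
    by (rule Suc.IH[OF g2])
  then obtain ws where ws: "length ws = d"
    "\<And>a::nat \<Rightarrow> 'a. \<forall>w\<in>set ws. (\<Sum>i<4. a i * w i) = 0 \<Longrightarrow> ord_at_least p (\<lambda>x. \<Sum>i<4. a i * g2 i x) d" by blast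
  have "ord_at_least p (\<lambda>x. \<Sum>i<4. a i * g i x) (Suc d)"
    if a: "\<forall>w\<in>set ((\<lambda>i. g i p) # ws). (\<Sum>i<4. a i * w i) = 0" for a
  proof -
    from ws(2) a have "ord_at_least p (\<lambda>x. \<Sum>i<4. a i * g2 i x) d" by auto
    then obtain h' q d1 d2 where 1: "form_fun d1 h'" "form_fun d2 q" "h' p \<noteq> 0"
      "\<And>x. x \<in> C \<Longrightarrow> h' x * (\<Sum>i<4. a i * g2 i x) = unif p x ^ d * q x" by (rule ord_at_leastE) blast
    have "h' x * H x * (\<Sum>i<4. a i * g i x) = unif p x ^ Suc d * q x" if x: "x \<in> C" for x
    proof -
      have "(\<Sum>i<4. a i * g i p) * unit_at p x ^ m = 0" using a by simp
      then have "H x * (\<Sum>i<4. a i * g i x) = H x * ((\<Sum>i<4. a i * g i x) - (\<Sum>i<4. a i * g i p) * unit_at p x ^ m)" by simp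
      also have "\<dots> = (\<Sum>i<4. a i * (H x * (g i x - g i p * unit_at p x ^ m)))"
        by (simp add: sum_distrib_right sum_distrib_left sum_subtractf algebra_simps)
      also have "\<dots> = (\<Sum>i<4. unif p x * (a i * g2 i x))"
      proof (rule sum.cong[OF refl])
        fix i :: nat assume "i \<in> {..<4}"
        then have i: "i < 4" by simp
        have "H x * (g i x - g i p * unit_at p x ^ m) = (\<Prod>j\<in>{..<4} - {i}. h j x) * (h i x * (g i x - g i p * unit_at p x ^ m))"
          by (simp only: Hi[OF i] mult.assoc)
        also have "\<dots> = unif p x * g2 i x" unfolding *(5)[OF i x] by (simp add: g2_def mult_ac)
        finally show "a i * (H x * (g i x - g i p * unit_at p x ^ m)) = unif p x * (a i * g2 i x)" by (simp add: mult_ac)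
      qed
      also have "\<dots> = unif p x * (\<Sum>i<4. a i * g2 i x)" by (simp only: sum_distrib_left)
      finally have "h' x * H x * (\<Sum>i<4. a i * g i x) = unif p x * (h' x * (\<Sum>i<4. a i * g2 i x))"
        by (simp add: mult_ac)
      then show ?thesis by (simp add: 1(4)[OF x])
    qed
    then show ?thesis using 1 H by (intro ord_at_leastI[OF form_fun_mult[OF 1(1) H(1)] 1(2)]) auto
  qed
  then show ?case using ws(1) by (intro exI[of _ "(\<lambda>i. g i p) # ws"]) auto
qed

lemma on_curve_1_0: "on_curve 1 0" and on_curve_1_1: "on_curve 1 1"
  by (simp_all add: on_curve_def)

lemma generic_point:
  obtains u y where "on_curve u y" "u \<noteq> 1"
proof -
  obtain u :: 'a where u: "u \<noteq> 0" "u \<noteq> 1"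
    using alg_closed_infinite finite_subset[of UNIV "{0, 1}"] by auto
  then show ?thesis using on_curve_exists[OF u(1)] that by metis
qed

text \<open>The curve lies in no plane. Vanishing at \<open>ptO\<close>, \<open>ptS\<close> and
  \<open>pt 1 0\<close> makes all four coefficients equal, and the sum of the coordinates is 1 + u
  at an affine point, nonzero if u differs from 1.\<close>

lemma linear_form_nz:
  assumes "\<not> (a = 0 \<and> b = 0 \<and> c' = 0 \<and> d = 0)"
  shows "nonvanishing (\<lambda>x. a * x!0 + b * x!1 + c' * x!2 + d * x!3)"
proof (rule ccontr)
  assume "\<not> nonvanishing (\<lambda>x. a * x!0 + b * x!1 + c' * x!2 + d * x!3)"
  then have *: "a * p!0 + b * p!1 + c' * p!2 + d * p!3 = 0" if "p \<in> N" for p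
    using N_subset_C[OF that] by (auto simp: nonvanishing_def)
  from generic_point obtain u y where uy: "on_curve u y" "u \<noteq> 1" .
  from *[OF N_ptO] have 1: "d = a" by (simp add: ptO_def add_eq_0_char2)
  from *[OF N_ptS] have 2: "c' = b" by (simp add: ptS_def add_eq_0_char2)
  from *[of "pt 1 0"] have 3: "b = a" by (simp add: on_curve_1_0 add_eq_0_char2)
  have "a * (1 + u) = a * pt u y ! 0 + a * pt u y ! 1 + a * pt u y ! 2 + a * pt u y ! 3"
    by (simp add: algebra_simps)
  also have "\<dots> = 0" using *[of "pt u y"] 1 2 3 uy by simp
  finally have "a = 0" using uy(2) by (simp add: add_eq_0_char2)
  with 1 2 3 assms show False by simp
qed

text \<open>Three linear conditions on four coefficients have a nontrivial solution. Coinciding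
  points are collected first, so that a repeated point imposes a condition of higher order instead
  of the same one twice.\<close>

lemma plane_through_three_points:
  assumes "p1 \<in> N" "p2 \<in> N" "p3 \<in> N"
  obtains L where "form_fun 1 L" "nonvanishing L"
    "\<And>p. p \<in> N \<Longrightarrow> ord_at_least p L (of_bool (p = p1) + of_bool (p = p2) + of_bool (p = p3))"
proof -
  define ps where "ps = remdups [p1, p2, p3]"
  have set_ps: "set ps = {p1, p2, p3}" by (simp only: ps_def set_remdups list.set)
  define mu :: "'a list \<Rightarrow> nat" where "mu p = of_bool (p = p1) + of_bool (p = p2) + of_bool (p = p3)" for p
  have "\<exists>ws. length ws = mu p \<and> (\<forall>a::nat \<Rightarrow> 'a. (\<forall>w\<in>set ws. (\<Sum>i<4. a i * w i) = 0) \<longrightarrow>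
     ord_at_least p (\<lambda>x. \<Sum>i<4. a i * x ! i) (mu p))" if "p \<in> set ps" for p
    by (rule vanishing_conditions[of 1]) (use that assms in \<open>auto simp: set_ps simp del: One_nat_def intro: form_fun_nth\<close>)
  then obtain W where W: "\<And>p. p \<in> set ps \<Longrightarrow> length (W p) = mu p"
    "\<And>p (a::nat \<Rightarrow> 'a). p \<in> set ps \<Longrightarrow> \<forall>w\<in>set (W p). (\<Sum>i<4. a i * w i) = 0 \<Longrightarrow>
     ord_at_least p (\<lambda>x. \<Sum>i<4. a i * x ! i) (mu p)" by metis
  have "length (concat (map W ps)) = (\<Sum>p\<leftarrow>ps. mu p)"
    by (simp add: length_concat o_def) (intro arg_cong[where f = sum_list] map_cong, simp_all add: W)
  also have "\<dots> = 3" by (auto simp: ps_def mu_def)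
  finally have "card {..<4::nat} > length (concat (map W ps))" by simp
  from common_zero_of_functionals[OF _ this] obtain a
    where a: "\<exists>i<4. a i \<noteq> 0" "\<forall>w\<in>set (concat (map W ps)). (\<Sum>i<4. a i * w i) = 0" by auto
  let ?L = "\<lambda>x::'a list. \<Sum>i<4. a i * x ! i"
  have L: "?L x = a 0 * x!0 + a 1 * x!1 + a 2 * x!2 + a 3 * x!3" for x
    by (simp add: numeral_eq_Suc)
  have "\<not> (a 0 = 0 \<and> a 1 = 0 \<and> a 2 = 0 \<and> a 3 = 0)"
  proof
    assume z: "a 0 = 0 \<and> a 1 = 0 \<and> a 2 = 0 \<and> a 3 = 0"
    from a(1) obtain i where "i < 4" "a i \<noteq> 0" by blast
    moreover from \<open>i < 4\<close> have "i = 0 \<or> i = 1 \<or> i = 2 \<or> i = 3" by linarith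
    ultimately show False using z by auto
  qed
  from linear_form_nz[OF this] have nonvanishing: "nonvanishing ?L" by (simp only: L)
  have fL: "form_fun 1 ?L" by (intro form_fun_sum form_fun_scale form_fun_nth) simp
  have "ord_at_least p ?L (mu p)" if "p \<in> N" for p
  proof (cases "p \<in> set ps")
    case True
    then show ?thesis using a(2) by (intro W(2)) auto
  next
    case False
    then have "mu p = 0" by (auto simp: set_ps mu_def)
    then show ?thesis using ord_at_least_0[OF fL] by simp
  qed
  with fL nonvanishing show ?thesis unfolding mu_def by (rule that)
qed

subsection \<open>Completeness of the linear system of planes\<close>

text \<open>A variant of \<open>ord_at_least\<close> in which g need only be an affine function:
  quotients by polynomials in u occur before they are known to come from forms.\<close>

definition ord_at_least_affine :: "'a list \<Rightarrow> ('a list \<Rightarrow> 'a) \<Rightarrow> nat \<Rightarrow> bool" where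
  "ord_at_least_affine p f n \<longleftrightarrow> (\<exists>h g d. form_fun d h \<and> affine_fun g \<and> h p \<noteq> 0 \<and>
     (\<forall>x\<in>C. xi x = 1 \<longrightarrow> h x * f x = (eta x - eta p) ^ n * g x))"

lemma affine_fun_linear: "affine_fun (\<lambda>x. eta x - a)"
  using affine_fun_poly[of "[:-a, 1:]"] by simp

lemma affine_fun_power: "affine_fun f \<Longrightarrow> affine_fun (\<lambda>x. f x ^ n)"
  by (induction n) (auto intro: affine_fun_mult affine_fun_const)

lemma affine_fun_diff: "affine_fun f \<Longrightarrow> affine_fun g \<Longrightarrow> affine_fun (\<lambda>x. f x - g x)"
  using affine_fun_add[of f g] by (simp add: minus_is_plus)

text \<open>The zeros at (a, y) and (a, y + 1) add up to B(a) = 0, and then A(a) = 0, so both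
  coefficients are divisible by u - a. The remaining work is to show that the quotient still
  satisfies the conditions for the shorter list of roots.\<close>

lemma divide_affine:
  assumes "\<And>u y. on_curve u y \<Longrightarrow> ord_at_least_affine (pt u y) (\<lambda>x. poly A (eta x) + poly B (eta x) * x!3) (count_list as u)"
    and "0 \<notin> set as"
  shows "\<exists>A' B'. A = (\<Prod>a\<leftarrow>as. [:-a, 1:]) * A' \<and> B = (\<Prod>a\<leftarrow>as. [:-a, 1:]) * B'"
  using assms
proof (induction as arbitrary: A B)
  case Nil
  then show ?case by simp
next
  case (Cons a as)
  from Cons.prems(2) obtain y where y: "on_curve a y" using on_curve_exists by auto
  have root: "poly A a + poly B a * z = 0" if z: "on_curve a z" for z
  proof -
    from Cons.prems(1)[OF z] obtain h g d where *: "h (pt a z) \<noteq> 0"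
      "\<And>x. x \<in> C \<Longrightarrow> xi x = 1 \<Longrightarrow> h x * (poly A (eta x) + poly B (eta x) * x!3) = (eta x - a) ^ count_list (a # as) a * g x"
      unfolding ord_at_least_affine_def xi_simps by metis
    from *(2)[of "pt a z"] *(1) z N_subset_C show ?thesis by auto
  qed
  have "poly B a = (poly A a + poly B a * y) + (poly A a + poly B a * (y + 1))"
    by (simp add: algebra_simps)
  then have B0: "poly B a = 0" using root[OF y] root[of "y + 1"] y by simp
  with root[OF y] have "poly A a = 0" by simp
  with B0 obtain A1 B1 where AB: "A = [:-a, 1:] * A1" "B = [:-a, 1:] * B1"
    unfolding poly_eq_0_iff_dvd by (auto elim!: dvdE)
  have pAB: "poly A t = (t - a) * poly A1 t" "poly B t = (t - a) * poly B1 t" for t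
    unfolding AB by (simp_all add: algebra_simps)
  let ?f1 = "\<lambda>x. poly A1 (eta x) + poly B1 (eta x) * x!3"
  have f1: "poly A (eta x) + poly B (eta x) * x!3 = (eta x - a) * ?f1 x" for x
    unfolding pAB by (simp add: algebra_simps)
  have "ord_at_least_affine (pt u z) ?f1 (count_list as u)" if uz: "on_curve u z" for u z
  proof -
    from Cons.prems(1)[OF uz] obtain h g d where *: "form_fun d h" "affine_fun g" "h (pt u z) \<noteq> 0"
      "\<And>x. x \<in> C \<Longrightarrow> xi x = 1 \<Longrightarrow> h x * ((eta x - a) * ?f1 x) = (eta x - u) ^ count_list (a # as) u * g x"
      unfolding ord_at_least_affine_def xi_simps f1 by metis
    show ?thesis
    proof (cases "u = a")
      case False
      \<comment> \<open>Away from the fibre of a, the homogenised factor eta - a xi is a unit and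
        can be absorbed into h.\<close>
      have "form_fun (d + 1) (\<lambda>x. h x * (eta x - a * xi x))" by (intro form_fun_mult form_fun_diff form_fun_scale form_fun_xi form_fun_eta *)
      moreover have "h (pt u z) * (eta (pt u z) - a * xi (pt u z)) \<noteq> 0" using *(3) False by simp
      moreover have "h x * (eta x - a * xi x) * ?f1 x = (eta x - eta (pt u z)) ^ count_list as u * g x"
        if "x \<in> C" "xi x = 1" for x
        using *(4)[OF that] that(2) False by (simp add: mult.assoc)
      ultimately show ?thesis unfolding ord_at_least_affine_def using *(2)
        by (intro exI[of _ "\<lambda>x. h x * (eta x - a * xi x)"] exI[of _ g] exI[of _ "d + 1"]) blast
    next
      case True
      \<comment> \<open>On the fibre itself one factor eta - a is cancelled from both sides. This is
        legitimate for all other values of \<open>eta\<close>, and \<open>affine_fun_zero_if\<close>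
        extends it to the value a.\<close>
      let ?F = "\<lambda>x. h x * ?f1 x - (eta x - a) ^ count_list as a * g x"
      have "affine_fun ?F"
        by (intro affine_fun_diff affine_fun_mult affine_fun_add affine_fun_poly affine_fun_x3 affine_fun_power affine_fun_linear * form_fun_imp_affine_fun[OF *(1)])
      then have "?F x = 0" if "x \<in> C" "xi x = 1" for x
      proof (rule affine_fun_zero_if[of _ "{a}"])
        fix x assume x: "x \<in> C" "xi x = 1" "eta x \<notin> {a}"
        have "(eta x - a) * (h x * ?f1 x) = (eta x - a) * ((eta x - a) ^ count_list as a * g x)"
          using *(4)[OF x(1,2)] True by (simp add: mult_ac)
        with x(3) show "?F x = 0" by simp
      qed (use that in auto)
      then show ?thesis unfolding ord_at_least_affine_def xi_simps using *(1-3) True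
        by (intro exI[of _ h] exI[of _ g] exI[of _ d]) simp
    qed
  qed
  with Cons.IH[of A1 B1] Cons.prems(2) obtain A' B' where
    "A1 = (\<Prod>a\<leftarrow>as. [:-a, 1:]) * A'" "B1 = (\<Prod>a\<leftarrow>as. [:-a, 1:]) * B'" by auto
  then show ?case unfolding AB
    by (intro exI[of _ A'] exI[of _ B']) (simp only: list.map prod_list.Cons mult.assoc)
qed

lemma form_fun_linear_prod: "form_fun (length as) (\<lambda>x. \<Prod>a\<leftarrow>as. eta x - a * xi x)"
proof (induction as)
  case Nil
  then show ?case using form_fun_const[of 1] by simp
next
  case (Cons a as)
  have "form_fun 1 (\<lambda>x. eta x - a * xi x)" by (intro form_fun_diff form_fun_scale form_fun_xi form_fun_eta)
  from form_fun_mult[OF this Cons] show ?case by simp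
qed

lemma has_ord_linear_prod:
  assumes "on_curve u y"
  shows "has_ord (pt u y) (\<lambda>x. \<Prod>a\<leftarrow>as. eta x - a * xi x) (count_list as u)"
proof (induction as)
  case Nil
  then show ?case using has_ord_0[OF form_fun_const[of 1]] by simp
next
  case (Cons a as)
  have "has_ord (pt u y) (\<lambda>x. eta x - a * xi x) (if a = u then 1 else 0)"
  proof (cases "a = u")
    case True
    then show ?thesis using has_ord_unif[of "pt u y"] by (simp add: unif_def)
  next
    case False
    have "form_fun 1 (\<lambda>x. eta x - a * xi x)" by (intro form_fun_diff form_fun_scale form_fun_xi form_fun_eta)
    then show ?thesis using False has_ord_0[of 1 "\<lambda>x. eta x - a * xi x"] by simp
  qed
  from has_ord_mult[OF this Cons] show ?case by (simp split: if_splits)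
qed

text \<open>For fixed M, the orders of the terms without x3 have the parity of M at both points, and
  those of the terms with x3 the opposite parity. Within each family the order is strictly monotone
  in k, so no two terms have the same order.\<close>

lemma orders_of_affine_terms:
  shows "k \<le> M \<Longrightarrow> has_ord ptO (\<lambda>x. eta x ^ k * xi x ^ (M - k)) (M + 2 * k)"
    and "k \<le> M \<Longrightarrow> has_ord ptS (\<lambda>x. eta x ^ k * xi x ^ (M - k)) (3 * M - 2 * k)"
    and "k < M \<Longrightarrow> has_ord ptO (\<lambda>x. eta x ^ k * xi x ^ (M - 1 - k) * x!3) (M - 1 + 2 * k)"
    and "k < M \<Longrightarrow> has_ord ptS (\<lambda>x. eta x ^ k * xi x ^ (M - 1 - k) * x!3) (3 * M - 1 - 2 * k)"
proof -
  have O: "has_ord ptO (\<lambda>x. eta x ^ k * xi x ^ j) (k * 3 + j * 1)" for k j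
    by (intro has_ord_mult has_ord_power has_ord_O_eta has_ord_O_xi)
  have S: "has_ord ptS (\<lambda>x. eta x ^ k * xi x ^ j) (k * 1 + j * 3)" for k j
    by (intro has_ord_mult has_ord_power has_ord_S_eta has_ord_S_xi)
  have x3: "has_ord ptO (\<lambda>x. x!3) 0" using has_ord_0[OF form_fun_nth[of 3], of ptO] by (simp add: ptO_def)
  {
    assume k: "k \<le> M"
    have "k * 3 + (M - k) * 1 = M + 2 * k" "k * 1 + (M - k) * 3 = 3 * M - 2 * k" using k by auto
    then show "has_ord ptO (\<lambda>x. eta x ^ k * xi x ^ (M - k)) (M + 2 * k)"
      "has_ord ptS (\<lambda>x. eta x ^ k * xi x ^ (M - k)) (3 * M - 2 * k)"
      using O[of k "M - k"] S[of k "M - k"] by metis+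
  }
  {
    assume k: "k < M"
    have "k * 3 + (M - 1 - k) * 1 + 0 = M - 1 + 2 * k" "k * 1 + (M - 1 - k) * 3 + 2 = 3 * M - 1 - 2 * k" using k by auto
    then show "has_ord ptO (\<lambda>x. eta x ^ k * xi x ^ (M - 1 - k) * x!3) (M - 1 + 2 * k)"
      "has_ord ptS (\<lambda>x. eta x ^ k * xi x ^ (M - 1 - k) * x!3) (3 * M - 1 - 2 * k)"
      using has_ord_mult[OF O[of k "M - 1 - k"] x3] has_ord_mult[OF S[of k "M - 1 - k"] has_ord_S_x3] by metis+
  }
qed

text \<open>Write f / g as f times the conjugate of g, divided by the norm of g. The orders force
  the nonzero roots of the norm to divide the numerator. The factor g * conjugate(g) stays on both
  sides because the quotient is only an affine function here; cancellation requires forms.\<close>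

lemma order_quotient_affine:
  assumes f: "form_fun m' f" "nonvanishing f" and g: "form_fun m g" "nonvanishing g"
    and le: "\<And>p i j. p \<in> N \<Longrightarrow> has_ord p f i \<Longrightarrow> has_ord p g j \<Longrightarrow> j \<le> i"
  obtains a A B where "\<And>x. x \<in> C \<Longrightarrow> xi x = 1 \<Longrightarrow>
    g x * g (rev x) * (eta x ^ a * f x) = g x * g (rev x) * ((poly A (eta x) + poly B (eta x) * x!3) * g x)"
proof -
  from norm_exists[OF g] obtain k n where n: "n \<noteq> 0"
    "\<And>x. x \<in> C \<Longrightarrow> xi x = 1 \<Longrightarrow> eta x ^ k * (g x * g (rev x)) = poly n (eta x)" by blast
  from split_off_zero_roots[OF n(1)] obtain l e as where as: "l \<noteq> 0" "0 \<notin> set as"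
    "\<And>t. poly n t = l * t ^ e * (\<Prod>a\<leftarrow>as. t - a)" by metis
  have fg: "form_fun (m' + m) (\<lambda>x. f x * g (rev x))" by (intro form_fun_mult form_fun_rev f g)
  from form_fun_imp_affine_fun[OF fg] obtain k0 A B where AB: "affine_rep (\<lambda>x. f x * g (rev x)) k0 A B" by (auto simp: affine_fun_def)
  have F1: "form_fun (k + (m + m) + (e + length as)) (\<lambda>x. eta x ^ k * (g x * g (rev x)) * xi x ^ (e + length as))"
    by (intro form_fun_mult form_fun_power1 form_fun_eta form_fun_xi form_fun_rev g)
  have F2: "form_fun (e + length as + (k + (m + m))) (\<lambda>x. l * (eta x ^ e * (\<Prod>a\<leftarrow>as. eta x - a * xi x)) * xi x ^ (k + (m + m)))"
    by (intro form_fun_mult form_fun_scale form_fun_power1 form_fun_eta form_fun_xi form_fun_linear_prod)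
  have deg: "e + length as + (k + (m + m)) = k + (m + m) + (e + length as)" by simp
  have eq: "eta x ^ k * (g x * g (rev x)) * xi x ^ (e + length as) =
      l * (eta x ^ e * (\<Prod>a\<leftarrow>as. eta x - a * xi x)) * xi x ^ (k + (m + m))" if "x \<in> C" for x
    by (rule form_fun_eq_if_affine_eq[OF F1 F2[unfolded deg] _ that]) (simp add: n(2) as(3) mult.assoc)
  have ords: "ord_at_least_affine (pt u y) (\<lambda>x. poly A (eta x) + poly B (eta x) * x!3) (count_list as u)" if uy: "on_curve u y" for u y
  proof -
    let ?p = "pt u y"
    have p: "?p \<in> N" using uy by simp
    have u0: "u \<noteq> 0" using uy on_curve_nz by blast
    from has_ord_exists[OF f] p obtain i where i: "has_ord ?p f i" by blast
    from has_ord_exists[OF g] p obtain j where j: "has_ord ?p g j" by blast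
    from has_ord_exists[OF form_fun_rev[OF g(1)] nonvanishing_rev[OF g(2)]] p obtain j' where j': "has_ord ?p (\<lambda>x. g (rev x)) j'" by blast
    have e0: "has_ord ?p (\<lambda>x. eta x ^ r) 0" "has_ord ?p (\<lambda>x. xi x ^ r) 0" for r
      using has_ord_0[OF form_fun_power1[OF form_fun_eta], of ?p] has_ord_0[OF form_fun_power1[OF form_fun_xi], of ?p] u0 by simp_all
    have "has_ord ?p (\<lambda>x. eta x ^ k * (g x * g (rev x)) * xi x ^ (e + length as)) (0 + (j + j') + 0)"
      by (intro has_ord_mult e0 j j')
    moreover have "has_ord ?p (\<lambda>x. l * (eta x ^ e * (\<Prod>a\<leftarrow>as. eta x - a * xi x)) * xi x ^ (k + (m + m))) (0 + count_list as u + 0)"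
      by (intro has_ord_mult has_ord_scale e0 has_ord_linear_prod uy as)
    then have "has_ord ?p (\<lambda>x. eta x ^ k * (g x * g (rev x)) * xi x ^ (e + length as)) (0 + count_list as u + 0)"
      by (rule has_ord_eq) (simp add: eq)
    \<comment> \<open>The multiplicity of u as a root of the norm is the order of g at p plus that
      of the conjugate of g, hence at most the order of the numerator.\<close>
    ultimately have "0 + (j + j') + 0 = 0 + count_list as u + 0" by (rule has_ord_unique[OF p])
    then have "count_list as u \<le> i + j'" using le[OF p i j] by simp
    from ord_at_least_mono[OF has_ord_imp_ord_at_least[OF has_ord_mult[OF i j']] this]
    obtain h q d1 d2 where 1: "form_fun d1 h" "form_fun d2 q" "h ?p \<noteq> 0"
      "\<And>x. x \<in> C \<Longrightarrow> h x * (f x * g (rev x)) = unif ?p x ^ count_list as u * q x" by (rule ord_at_leastE) blast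
    have "h x * (poly A (eta x) + poly B (eta x) * x!3) = (eta x - u) ^ count_list as u * (eta x ^ k0 * q x)"
      if x: "x \<in> C" "xi x = 1" for x
    proof -
      have "h x * (poly A (eta x) + poly B (eta x) * x!3) = eta x ^ k0 * (h x * (f x * g (rev x)))"
        unfolding affine_repD[OF AB x, symmetric] by (simp add: mult_ac)
      also have "\<dots> = (eta x - u) ^ count_list as u * (eta x ^ k0 * q x)"
        unfolding 1(4)[OF x(1)] using x by (simp add: unif_def mult_ac)
      finally show ?thesis .
    qed
    moreover have "affine_fun (\<lambda>x. eta x ^ k0 * q x)"
      by (intro affine_fun_mult form_fun_imp_affine_fun[OF 1(2)] form_fun_imp_affine_fun[OF form_fun_power1[OF form_fun_eta]])
    ultimately show ?thesis unfolding ord_at_least_affine_def xi_simps using 1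
      by (intro exI[of _ h] exI[of _ "\<lambda>x. eta x ^ k0 * q x"] exI[of _ d1]) blast
  qed
  from divide_affine[OF ords as(2)] obtain A1 B1 where
    A1: "A = (\<Prod>a\<leftarrow>as. [:-a, 1:]) * A1" "B = (\<Prod>a\<leftarrow>as. [:-a, 1:]) * B1" by blast
  have pp: "poly (\<Prod>a\<leftarrow>as. [:-a, 1:]) t = (\<Prod>a\<leftarrow>as. t - a)" for t
    by (induction as) (auto simp: algebra_simps)
  let ?A = "smult (inverse l) (monom 1 k * A1)" and ?B = "smult (inverse l) (monom 1 k * B1)"
  show ?thesis
  proof (rule that[of "e + k0" ?A ?B])
    fix x assume x: "x \<in> C" "xi x = 1"
    let ?P = "(\<Prod>a\<leftarrow>as. eta x - a)"
    let ?Q = "poly A1 (eta x) + poly B1 (eta x) * x!3"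
    have 1: "eta x ^ k0 * (f x * g (rev x)) = ?P * ?Q"
      unfolding affine_repD[OF AB x] A1 by (simp add: pp algebra_simps)
    have 2: "eta x ^ k * (g x * g (rev x)) = l * eta x ^ e * ?P" using n(2)[OF x] as(3) by simp
    have "l * (g x * g (rev x) * (eta x ^ (e + k0) * f x)) = g x * (l * eta x ^ e) * (eta x ^ k0 * (f x * g (rev x)))"
      by (simp add: power_add mult_ac)
    also have "\<dots> = g x * (l * eta x ^ e * ?P) * ?Q" unfolding 1 by (simp add: mult_ac)
    also have "\<dots> = g x * g (rev x) * ((eta x ^ k * ?Q) * g x)" unfolding 2[symmetric] by (simp add: mult_ac)
    finally have "g x * g (rev x) * (eta x ^ (e + k0) * f x) = inverse l * (g x * g (rev x) * ((eta x ^ k * ?Q) * g x))"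
      using as(1) by (simp add: field_simps)
    also have "\<dots> = g x * g (rev x) * ((poly ?A (eta x) + poly ?B (eta x) * x!3) * g x)"
      by (simp add: poly_monom algebra_simps)
    finally show "g x * g (rev x) * (eta x ^ (e + k0) * f x) =
       g x * g (rev x) * ((poly ?A (eta x) + poly ?B (eta x) * x!3) * g x)" .
  qed
qed

lemma poly_sum_support:
  fixes A :: "'a poly"
  shows "poly A t = (\<Sum>i | coeff A i \<noteq> 0. coeff A i * t ^ i)"
proof -
  have "{i. coeff A i \<noteq> 0} \<subseteq> {..degree A}" using le_degree by blast
  then show ?thesis unfolding poly_altdef by (intro sum.mono_neutral_right) auto
qed

text \<open>By the affine lemma, f / g is a sum of terms u^i and u^i y with integral exponents.
  Bounds at \<open>ptO\<close> and \<open>ptS\<close> hold for each term separately and leave only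
  four exponents, which correspond to the four linear forms \<open>xi\<close>, \<open>eta\<close>,
  x3 and x2.\<close>

lemma planes_complete:
  assumes f: "form_fun (Suc m) f" "nonvanishing f" and g: "form_fun m g" "nonvanishing g"
    and le: "\<And>p i j. p \<in> N \<Longrightarrow> has_ord p f i \<Longrightarrow> has_ord p g j \<Longrightarrow> j \<le> i"
  obtains L where "form_fun 1 L" "\<And>x. x \<in> C \<Longrightarrow> f x = L x * g x"
proof -
  obtain a A B where AB: "\<And>x. x \<in> C \<Longrightarrow> xi x = 1 \<Longrightarrow>
    g x * g (rev x) * (eta x ^ a * f x) = g x * g (rev x) * ((poly A (eta x) + poly B (eta x) * x!3) * g x)"
    by (rule order_quotient_affine[OF f g]) (use le in blast)+
  \<comment> \<open>The exponent b is large enough that no subtraction of exponents is truncated,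
    and it is at least 1, so that a factor \<open>xi\<close> remains to turn eta x3 into x2 xi. With
    M = a + b + 1 the homogenised quotient has the degree of eta^a xi^b f / g.\<close>
  define b where "b = degree A + degree B + 1"
  define M where "M = a + b + 1"
  let ?IA = "{i. coeff A i \<noteq> 0}" and ?IB = "{i. coeff B i \<noteq> 0}"
  have finI: "finite ?IA" "finite ?IB"
    using finite_subset[of ?IA "{..degree A}"] finite_subset[of ?IB "{..degree B}"] le_degree by blast+
  have bnd: "i \<le> M" if "i \<in> ?IA" for i using that le_degree[of A i] by (simp add: M_def b_def)
  have bndB: "i < M" if "i \<in> ?IB" for i using that le_degree[of B i] by (simp add: M_def b_def)
  define t where "t j x = (case j of Inl i \<Rightarrow> coeff A i * (eta x ^ i * xi x ^ (M - i))
     | Inr i \<Rightarrow> coeff B i * (eta x ^ i * xi x ^ (M - 1 - i) * x!3))" for j and x :: "'a list"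
  let ?I = "?IA <+> ?IB"
  define q where "q x = (\<Sum>j\<in>?I. t j x)" for x
  have q: "q x = (\<Sum>i\<in>?IA. coeff A i * (eta x ^ i * xi x ^ (M - i))) +
      (\<Sum>i\<in>?IB. coeff B i * (eta x ^ i * xi x ^ (M - 1 - i) * x!3))" for x
    unfolding q_def t_def using finI by (simp add: sum.Plus)
  have ft: "form_fun M (t j)" if j: "j \<in> ?I" for j
  proof (cases j)
    case (Inl i)
    with j bnd have i: "i + (M - i) = M" by auto
    have "form_fun (i + (M - i)) (\<lambda>x. coeff A i * (eta x ^ i * xi x ^ (M - i)))"
      by (intro form_fun_scale form_fun_mult form_fun_power1 form_fun_eta form_fun_xi)
    with Inl i show ?thesis by (simp add: t_def[abs_def])
  next
    case (Inr i)
    with j bndB[of i] have i: "i + (M - 1 - i) + 1 = M" by auto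
    have "form_fun (i + (M - 1 - i) + 1) (\<lambda>x. coeff B i * (eta x ^ i * xi x ^ (M - 1 - i) * x!3))"
      by (intro form_fun_scale form_fun_mult form_fun_power1 form_fun_eta form_fun_xi form_fun_nth) simp
    with Inr i show ?thesis by (simp add: t_def[abs_def])
  qed
  have fq: "form_fun M q" unfolding q_def by (rule form_fun_sum[OF ft])
  have qaff: "q x = poly A (eta x) + poly B (eta x) * x!3" if "xi x = 1" for x
    unfolding q poly_sum_support using that by (simp add: sum_distrib_right mult.assoc)
  have nn: "form_fun (m + m) (\<lambda>x. g x * g (rev x))" "nonvanishing (\<lambda>x. g x * g (rev x))"
    by (intro form_fun_mult form_fun_rev g nonvanishing_mult[OF g(1) form_fun_rev[OF g(1)]] nonvanishing_rev)+
  have fl: "form_fun (a + b + Suc m) (\<lambda>x. eta x ^ a * xi x ^ b * f x)"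
    by (intro form_fun_mult form_fun_power1 form_fun_eta form_fun_xi f)
  have deg: "a + b + Suc m = M + m" by (simp add: M_def)
  have gg: "g x * g (rev x) * (eta x ^ a * xi x ^ b * f x) = g x * g (rev x) * (q x * g x)" if "x \<in> C" for x
    by (rule form_fun_eq_if_affine_eq[OF form_fun_mult[OF nn(1) fl[unfolded deg]] form_fun_mult[OF nn(1) form_fun_mult[OF fq g(1)]] _ that])
      (simp add: AB qaff)
  have eq: "eta x ^ a * xi x ^ b * f x = q x * g x" if "x \<in> C" for x
    by (rule form_fun_cancel[OF nn(1) fl form_fun_mult[OF fq g(1)] nn(2) gg that])
  have nzq: "?I \<noteq> {}"
  proof
    assume "?I = {}"
    then have "q x = 0" for x unfolding q_def by (metis sum.empty)
    then have "eta x ^ a * xi x ^ b * f x = 0" if "x \<in> C" for x using eq[OF that] by simp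
    moreover have "nonvanishing (\<lambda>x. eta x ^ a * xi x ^ b * f x)"
      by (intro nonvanishing_mult[OF form_fun_mult[OF form_fun_power1[OF form_fun_eta] form_fun_power1[OF form_fun_xi]] f(1)]
          nonvanishing_mult[OF form_fun_power1[OF form_fun_eta] form_fun_power1[OF form_fun_xi]] nonvanishing_power nonvanishing_eta nonvanishing_xi f)
    ultimately show False by (simp add: nonvanishing_def)
  qed
  \<comment> \<open>As the orders of the terms at p are distinct, the order of q is their minimum.
    The inequality between f and g bounds this minimum, hence every term, from below.\<close>
  have main: "\<forall>j\<in>?I. r \<le> n j"
    if p: "p \<in> N" and inj: "inj_on n ?I" and odt: "\<And>j. j \<in> ?I \<Longrightarrow> has_ord p (t j) (n j)"
      and r: "has_ord p (\<lambda>x. eta x ^ a * xi x ^ b) r" for p n r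
  proof -
    from has_ord_sum_distinct[OF finite_Plus[OF finI] nzq inj p ft odt] obtain j0
      where j0: "has_ord p q (n j0)" "\<And>j. j \<in> ?I \<Longrightarrow> n j0 \<le> n j" unfolding q_def by blast
    from has_ord_exists[OF f] p obtain i where i: "has_ord p f i" by blast
    from has_ord_exists[OF g] p obtain j where j: "has_ord p g j" by blast
    have "has_ord p (\<lambda>x. eta x ^ a * xi x ^ b * f x) (n j0 + j)"
      by (rule has_ord_eq[OF has_ord_mult[OF j0(1) j]]) (simp add: eq)
    then have "r + i = n j0 + j" using has_ord_unique[OF p has_ord_mult[OF r i]] by blast
    then have "r \<le> n j0" using le[OF p i j] by simp
    then show ?thesis using j0(2) by (meson order.trans)
  qed
  have O: "\<forall>j\<in>?I. a * 3 + b * 1 \<le> (case j of Inl i \<Rightarrow> M + 2 * i | Inr i \<Rightarrow> M - 1 + 2 * i)"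
  proof (rule main[of ptO])
    show "inj_on (case_sum (\<lambda>i. M + 2 * i) (\<lambda>i. M - 1 + 2 * i)) ?I"
      using M_def by (auto simp: inj_on_def) presburger+
    show "has_ord ptO (t j) (case j of Inl i \<Rightarrow> M + 2 * i | Inr i \<Rightarrow> M - 1 + 2 * i)" if "j \<in> ?I" for j
      using that bnd bndB by (auto simp: t_def[abs_def] intro!: has_ord_scale orders_of_affine_terms orders_of_affine_terms[simplified])
    show "has_ord ptO (\<lambda>x. eta x ^ a * xi x ^ b) (a * 3 + b * 1)"
      by (intro has_ord_mult has_ord_power has_ord_O_eta has_ord_O_xi)
  qed simp
  have S: "\<forall>j\<in>?I. a * 1 + b * 3 \<le> (case j of Inl i \<Rightarrow> 3 * M - 2 * i | Inr i \<Rightarrow> 3 * M - 1 - 2 * i)"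
  proof (rule main[of ptS])
    show "inj_on (case_sum (\<lambda>i. 3 * M - 2 * i) (\<lambda>i. 3 * M - 1 - 2 * i)) ?I"
      unfolding inj_on_def
    proof (intro ballI impI)
      fix j j' assume jj: "j \<in> ?I" "j' \<in> ?I"
        "case_sum (\<lambda>i. 3 * M - 2 * i) (\<lambda>i. 3 * M - 1 - 2 * i) j = case_sum (\<lambda>i. 3 * M - 2 * i) (\<lambda>i. 3 * M - 1 - 2 * i) j'"
      show "j = j'"
      proof (cases j)
        case (Inl i)
        with jj have i: "i \<le> M" by (auto intro: bnd)
        show ?thesis
        proof (cases j')
          case (Inl i')
          with jj have "i' \<le> M" by (auto intro: bnd)
          with i jj(3) \<open>j = Inl i\<close> Inl show ?thesis by simp
        next
          case (Inr i')
          with jj have "i' < M" by (auto intro: bndB)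
          with i jj(3) \<open>j = Inl i\<close> Inr show ?thesis by (simp, presburger)
        qed
      next
        case (Inr i)
        with jj have i: "i < M" by (auto intro: bndB)
        show ?thesis
        proof (cases j')
          case (Inl i')
          with jj have "i' \<le> M" by (auto intro: bnd)
          with i jj(3) \<open>j = Inr i\<close> Inl show ?thesis by (simp, presburger)
        next
          case (Inr i')
          with jj have "i' < M" by (auto intro: bndB)
          with i jj(3) \<open>j = Inr i\<close> Inr show ?thesis by simp
        qed
      qed
    qed
    show "has_ord ptS (t j) (case j of Inl i \<Rightarrow> 3 * M - 2 * i | Inr i \<Rightarrow> 3 * M - 1 - 2 * i)" if "j \<in> ?I" for j
      using that bnd bndB by (auto simp: t_def[abs_def] intro!: has_ord_scale orders_of_affine_terms orders_of_affine_terms[simplified])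
    show "has_ord ptS (\<lambda>x. eta x ^ a * xi x ^ b) (a * 1 + b * 3)"
      by (intro has_ord_mult has_ord_power has_ord_S_eta has_ord_S_xi)
  qed simp
  \<comment> \<open>The order at \<open>ptO\<close> gives i \<ge> a and the order at
    \<open>ptS\<close> gives i \<le> a + 1; the same holds for B below.\<close>
  have IA: "?IA \<subseteq> {a, a + 1}"
  proof
    fix i assume i: "i \<in> ?IA"
    then have "Inl i \<in> ?I" by (rule InlI)
    from bspec[OF O this] bspec[OF S this]
    have "a * 3 + b * 1 \<le> M + 2 * i" "a * 1 + b * 3 \<le> 3 * M - 2 * i" by simp_all
    then show "i \<in> {a, a + 1}" using bnd[OF i] by (auto simp: M_def)
  qed
  have IB: "?IB \<subseteq> {a, a + 1}"
  proof
    fix i assume i: "i \<in> ?IB"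
    then have "Inr i \<in> ?I" by (rule InrI)
    from bspec[OF O this] bspec[OF S this]
    have "a * 3 + b * 1 \<le> M - 1 + 2 * i" "a * 1 + b * 3 \<le> 3 * M - 1 - 2 * i" by simp_all
    then show "i \<in> {a, a + 1}" using bndB[OF i] by (auto simp: M_def)
  qed
  \<comment> \<open>After removal of the common factor eta^a xi^b, the surviving terms of A are
    multiples of \<open>xi\<close> and \<open>eta\<close>, those of B multiples of x3 and of eta x3
    / xi = x2.\<close>
  let ?L = "\<lambda>x. coeff A a * xi x + coeff A (a + 1) * eta x + coeff B a * x!3 + coeff B (a + 1) * x!2"
  have fL: "form_fun 1 ?L" by (intro form_fun_add form_fun_scale form_fun_xi form_fun_eta form_fun_nth) auto
  have qL: "q x = eta x ^ a * xi x ^ b * ?L x" if "x \<in> C" for x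
  proof -
    have "(\<Sum>i\<in>?IA. coeff A i * (eta x ^ i * xi x ^ (M - i))) = (\<Sum>i\<in>{a, a + 1}. coeff A i * (eta x ^ i * xi x ^ (M - i)))"
      by (rule sum.mono_neutral_left) (use IA in auto)
    moreover have "(\<Sum>i\<in>?IB. coeff B i * (eta x ^ i * xi x ^ (M - 1 - i) * x!3)) =
        (\<Sum>i\<in>{a, a + 1}. coeff B i * (eta x ^ i * xi x ^ (M - 1 - i) * x!3))"
      by (rule sum.mono_neutral_left) (use IB in auto)
    moreover have "M - a = Suc b" "M - (a + 1) = b" "M - 1 - a = b" "M - 1 - (a + 1) = degree A + degree B"
      "b = Suc (degree A + degree B)" by (simp_all add: M_def b_def)
    ultimately have "q x = coeff A a * (eta x ^ a * xi x ^ Suc b) + coeff A (a + 1) * (eta x ^ Suc a * xi x ^ b) +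
       (coeff B a * (eta x ^ a * xi x ^ b * x!3) + coeff B (a + 1) * (eta x ^ a * xi x ^ (degree A + degree B) * (eta x * x!3)))"
      unfolding q by (simp add: mult_ac)
    also have "eta x * x!3 = x!2 * xi x" using C_rel(3)[OF that] by simp
    finally show ?thesis unfolding \<open>b = Suc _\<close> by (simp add: algebra_simps)
  qed
  show ?thesis
  proof (rule that[OF fL])
    fix x assume "x \<in> C"
    then show "f x = ?L x * g x"
    proof (rule form_fun_cancel[OF form_fun_mult[OF form_fun_power1[OF form_fun_eta] form_fun_power1[OF form_fun_xi]] f(1) form_fun_mult[OF fL g(1)], of a b, rotated 2])
      show "nonvanishing (\<lambda>x. eta x ^ a * xi x ^ b)"
        by (intro nonvanishing_mult[OF form_fun_power1[OF form_fun_eta] form_fun_power1[OF form_fun_xi]] nonvanishing_power nonvanishing_eta nonvanishing_xi)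
    qed (use eq qL in \<open>simp add: mult.assoc\<close>)
  qed
qed

end

section \<open>Points as classes of coordinate vectors, and ideals generated by forms\<close>

lemma proj_refl: "x \<in> proj x"
  unfolding proj_def by (rule CollectI, rule exI[of _ 1]) (simp add: map_idI)

lemma proj_scaled:
  assumes "t \<noteq> 0"
  shows "proj (map ((*) t) x) = proj x"
proof
  show "proj (map ((*) t) x) \<subseteq> proj x"
    unfolding proj_def by (auto simp: o_def mult.assoc[symmetric] assms)
  show "proj x \<subseteq> proj (map ((*) t) x)"
  proof
    fix y assume "y \<in> proj x"
    then obtain s where "s \<noteq> 0" "y = map ((*) s) x" by (auto simp: proj_def)
    with assms show "y \<in> proj (map ((*) t) x)"
      unfolding proj_def by (intro CollectI exI[of _ "s / t"]) (simp add: o_def)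
  qed
qed

lemma proj_eqD:
  assumes "y \<in> proj x"
  shows "proj y = proj x"
proof -
  from assms obtain t where "t \<noteq> 0" "y = map ((*) t) x" by (auto simp: proj_def)
  then show ?thesis by (simp add: proj_scaled)
qed

lemma vanishes_on_proj_image:
  assumes "\<And>x t. x \<in> A \<Longrightarrow> t \<noteq> 0 \<Longrightarrow> map ((*) t) x \<in> A"
  shows "vanishes_on F (proj ` A) \<longleftrightarrow> (\<forall>x\<in>A. meval F x = 0)"
proof
  assume *: "vanishes_on F (proj ` A)"
  show "\<forall>x\<in>A. meval F x = 0"
  proof
    fix x assume "x \<in> A"
    with * have "vanishes_at F (proj x)" by (simp add: vanishes_on_def)
    then show "meval F x = 0" using proj_refl[of x] by (simp add: vanishes_at_def)
  qed
next
  assume *: "\<forall>x\<in>A. meval F x = 0"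
  have "meval F y = 0" if "x \<in> A" "y \<in> proj x" for x y
  proof -
    from that(2) obtain t where "t \<noteq> 0" "y = map ((*) t) x" by (auto simp: proj_def)
    with that(1) assms * show ?thesis by blast
  qed
  then show "vanishes_on F (proj ` A)" by (auto simp: vanishes_on_def vanishes_at_def)
qed

lemma ideal_span_induct [consumes 1, case_names zero add]:
  assumes "A \<in> ideal_span S" "P 0" "\<And>r s t. s \<in> S \<Longrightarrow> P t \<Longrightarrow> P (r * s + t)"
  shows "P A"
  using assms unfolding ideal_span_def
  by (rule Modules.module.span_induct_alt[OF module_times])

lemma ideal_span_base: "s \<in> S \<Longrightarrow> s \<in> ideal_span S"
  unfolding ideal_span_def by (rule Modules.module.span_base[OF module_times])

lemma ideal_span_scale: "s \<in> ideal_span S \<Longrightarrow> r * s \<in> ideal_span S"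
  unfolding ideal_span_def by (rule Modules.module.span_scale[OF module_times])

context z4_model
begin

definition E :: "'a ppoint set" where "E = proj ` C"

lemma C_iff_E: "x \<in> C \<longleftrightarrow> proj x \<in> E"
proof
  assume "proj x \<in> E"
  then obtain y where y: "y \<in> C" "proj x = proj y" by (auto simp: E_def)
  then have "x \<in> proj y" using proj_refl by metis
  then show "x \<in> C" using z4_cone_scaled y(1) by (auto simp: proj_def)
qed (simp add: E_def)

lemma E_N: "E = proj ` N"
proof
  show "E \<subseteq> proj ` N" unfolding E_def
  proof
    fix P assume "P \<in> proj ` C"
    then obtain x where "x \<in> C" "P = proj x" by blast
    from \<open>x \<in> C\<close> obtain t p where "t \<noteq> 0" "p \<in> N" "x = map ((*) t) p" by (rule C_cases)
    with \<open>P = proj x\<close> show "P \<in> proj ` N" using proj_scaled by blast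
  qed
  show "proj ` N \<subseteq> E" using N_subset_C by (auto simp: E_def)
qed

lemma proj_inj_N: "p \<in> N \<Longrightarrow> q \<in> N \<Longrightarrow> proj p = proj q \<longleftrightarrow> p = q"
proof
  assume pq: "p \<in> N" "q \<in> N" "proj p = proj q"
  then have "p \<in> proj q" using proj_refl by metis
  then obtain t where t: "t \<noteq> 0" "p = map ((*) t) q" by (auto simp: proj_def)
  have l: "length q = 4" using pq N_subset_C C_length by blast
  have nth: "p ! i = t * q ! i" if "i < 4" for i using t(2) l that by simp
  have xi: "xi p = t * xi q" using nth[of 0] nth[of 3] by (simp add: xi_def algebra_simps)
  from pq(1) show "p = q"
  proof (cases p rule: N_cases)
    case 1
    with xi t(1) have "xi q = 0" by simp
    with pq(2) have "q = ptO \<or> q = ptS" by (auto elim!: N_cases)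
    moreover have "q ! 0 \<noteq> 0" using 1 nth[of 0] by (auto simp: ptO_def)
    ultimately have "q = ptO" by (auto simp: ptS_def)
    with 1 show ?thesis by simp
  next
    case 2
    with xi t(1) have "xi q = 0" by simp
    with pq(2) have "q = ptO \<or> q = ptS" by (auto elim!: N_cases)
    moreover have "q ! 1 \<noteq> 0" using 2 nth[of 1] by (auto simp: ptS_def)
    ultimately have "q = ptS" by (auto simp: ptO_def)
    with 2 show ?thesis by simp
  next
    case (3 u y)
    with pq(2) xi have "t = 1" by (auto elim!: N_cases)
    with t show ?thesis by (simp add: map_idI)
  qed
qed simp

lemma E_cases:
  assumes "P \<in> E"
  obtains p where "p \<in> N" "P = proj p"
  using assms by (auto simp: E_N)

lemma proj_in_E [simp]: "p \<in> N \<Longrightarrow> proj p \<in> E"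
  by (simp add: E_N)

lemma vanishes_on_E: "vanishes_on F E \<longleftrightarrow> \<not> nonvanishing (meval F)"
  unfolding E_def nonvanishing_def using vanishes_on_proj_image[of C F] z4_cone_scaled by blast

lemma vanishes_at_proj:
  assumes "is_form 3 m F" "length p = 4"
  shows "vanishes_at F (proj p) \<longleftrightarrow> meval F p = 0"
proof
  assume "vanishes_at F (proj p)"
  then show "meval F p = 0" using proj_refl by (auto simp: vanishes_at_def)
next
  assume "meval F p = 0"
  then show "vanishes_at F (proj p)"
    using form_fun_scaled[OF form_fun_meval[OF assms(1)] assms(2)] by (auto simp: vanishes_at_def proj_def)
qed

lemma N_length: "p \<in> N \<Longrightarrow> length p = 4"
  using N_subset_C C_length by blast

subsection \<open>Orders of forms\<close>

lemma ideal_of_E_vanishes: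
  assumes "B \<in> ideal_of 3 E" "x \<in> C"
  shows "meval B x = 0"
  using assms(1) unfolding ideal_of_def
proof (induction rule: ideal_span_induct)
  case (add r s t)
  then have "vanishes_on s E" by (simp add: forms_vanishing_on_def)
  with add assms(2) show ?case by (auto simp: vanishes_on_E nonvanishing_def)
qed simp

text \<open>Each factor vanishes at p and so contributes one uniformiser by
  \<open>locally_principal\<close>. The cofactor is kept as a polynomial because it is later
  multiplied by elements of the polynomial ring.\<close>

lemma point_ideal_prod:
  assumes "set Fs \<subseteq> forms_vanishing_on 3 {proj p}" "p \<in> N"
  shows "\<exists>h k g d. form_fun k h \<and> h p \<noteq> 0 \<and> form_fun d (meval g) \<and> (\<forall>x\<in>C. h x * meval (prod_list Fs) x = unif p x ^ length Fs * meval g x)"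
  using assms(1)
proof (induction Fs)
  case Nil
  show ?case
    by (intro exI[of _ "\<lambda>_. 1"] exI[of _ 0] exI[of _ 1] exI[of _ 0] conjI form_fun_const form_fun_meval is_form_1) auto
next
  case (Cons F Fs)
  then obtain h k g d where 1: "form_fun k h" "h p \<noteq> 0" "form_fun d (meval g)"
    "\<And>x. x \<in> C \<Longrightarrow> h x * meval (prod_list Fs) x = unif p x ^ length Fs * meval g x" by auto
  from Cons.prems obtain m where m: "is_form 3 m F" "vanishes_at F (proj p)"
    by (auto simp: forms_vanishing_on_def vanishes_on_def)
  then have "meval F p = 0" using vanishes_at_proj N_length assms(2) by blast
  with locally_principal[OF form_fun_meval[OF m(1)] assms(2)] obtain h' k' g' d' where
    2: "form_fun k' h'" "h' p \<noteq> 0" "form_fun d' g'" "\<And>x. x \<in> C \<Longrightarrow> h' x * meval F x = unif p x * g' x" by auto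
  from 2(3) obtain G where G: "is_form 3 d' G" "\<And>x. length x = 4 \<Longrightarrow> g' x = meval G x" by (auto simp: form_fun_def)
  have fG: "form_fun (d' + d) (meval (G * g))" by (rule form_fun_cong[OF _ form_fun_mult[OF form_fun_meval[OF G(1)] 1(3)]]) simp
  have *: "h' x * h x * meval (prod_list (F # Fs)) x = unif p x ^ length (F # Fs) * meval (G * g) x" if x: "x \<in> C" for x
  proof -
    have "h' x * h x * meval (prod_list (F # Fs)) x = (h' x * meval F x) * (h x * meval (prod_list Fs) x)"
      by (simp add: mult_ac)
    also have "\<dots> = unif p x ^ length (F # Fs) * (g' x * meval g x)"
      unfolding 1(4)[OF x] 2(4)[OF x] by (simp add: mult_ac)
    finally show ?thesis using G(2)[OF C_length[OF x]] by simp
  qed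
  show ?case
    by (rule exI[of _ "\<lambda>x. h' x * h x"], rule exI[of _ "k' + k"], rule exI[of _ "G * g"], rule exI[of _ "d' + d"])
      (intro conjI ballI form_fun_mult[OF 2(1) 1(1)] fG *; simp add: 1(2) 2(2))
qed

text \<open>The ideal is closed under multiplication by arbitrary polynomials, so homogeneity of the
  cofactor q is lost.\<close>

lemma point_ideal_power_locally:
  assumes "A \<in> point_ideal_power 3 (proj p) n" "p \<in> N"
  shows "\<exists>h k q. form_fun k h \<and> h p \<noteq> 0 \<and> (\<forall>x\<in>C. h x * meval A x = unif p x ^ n * meval q x)"
  using assms(1) unfolding point_ideal_power_def
proof (induction rule: ideal_span_induct)
  case zero
  show ?case by (intro exI[of _ "\<lambda>_. 1"] exI[of _ 0] exI[of _ 0] conjI form_fun_const) auto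
next
  case (add r s t)
  then obtain Fs where Fs: "s = prod_list Fs" "length Fs = n" "set Fs \<subseteq> forms_vanishing_on 3 {proj p}" by auto
  from point_ideal_prod[OF Fs(3) assms(2)] obtain h k g where 1: "form_fun k h" "h p \<noteq> 0"
    "\<And>x. x \<in> C \<Longrightarrow> h x * meval s x = unif p x ^ n * meval g x" unfolding Fs by metis
  from add obtain h' k' q where 2: "form_fun k' h'" "h' p \<noteq> 0"
    "\<And>x. x \<in> C \<Longrightarrow> h' x * meval t x = unif p x ^ n * meval q x" by blast
  from 1(1) 2(1) obtain H H' where H: "\<And>x. length x = 4 \<Longrightarrow> h x = meval H x" "\<And>x. length x = 4 \<Longrightarrow> h' x = meval H' x"
    by (auto simp: form_fun_def)
  have "h x * h' x * meval (r * s + t) x = unif p x ^ n * meval (r * H' * g + H * q) x" if x: "x \<in> C" for x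
  proof -
    have "h x * h' x * meval (r * s + t) x = meval r x * h' x * (h x * meval s x) + h x * (h' x * meval t x)"
      by (simp add: algebra_simps)
    also have "\<dots> = unif p x ^ n * meval (r * H' * g + H * q) x"
      unfolding 1(3)[OF x] 2(3)[OF x] by (simp add: H C_length[OF x] algebra_simps)
    finally show ?thesis .
  qed
  then show ?case using form_fun_mult[OF 1(1) 2(1)] 1(2) 2(2)
    by (intro exI[of _ "\<lambda>x. h x * h' x"] exI[of _ "k + k'"] exI[of _ "r * H' * g + H * q"]) simp
qed

text \<open>The factor \<open>q\<close> need not be homogeneous; comparing the coefficients of
  \<open>t\<close> after scaling the argument by \<open>t\<close> reduces to the homogeneous case.\<close>

lemma local_division_bound:
  assumes p: "p \<in> N" and f: "form_fun N1 f" "f p \<noteq> 0" and g: "form_fun d g" and k: "k > 0"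
    and eq: "\<And>x. x \<in> C \<Longrightarrow> unif p x \<noteq> 0 \<Longrightarrow> f x = unif p x ^ k * (g x * meval q x)"
  shows False
proof -
  from meval_form_fun_decomposition[of q] obtain B r where r: "\<And>n. form_fun n (r n)"
    "\<And>x. length x = 4 \<Longrightarrow> meval q x = (\<Sum>n\<le>B. r n x)" by blast
  let ?b = "\<lambda>n x. unif p x ^ k * (g x * r n x)"
  have fb: "form_fun (k + (d + n)) (?b n)" for n by (intro form_fun_mult form_fun_power1 form_fun_unif g r)
  \<comment> \<open>The component of the right-hand side whose degree is that of f.\<close>
  define b where "b x = (\<Sum>n\<le>B. if k + (d + n) = N1 then ?b n x else 0)" for x
  have "form_fun N1 b" unfolding b_def
  proof (rule form_fun_sum)
    fix n show "form_fun N1 (\<lambda>x. if k + (d + n) = N1 then ?b n x else 0)"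
      using fb[of n] by (cases "k + (d + n) = N1") (auto intro: form_fun_zero)
  qed
  \<comment> \<open>The hypothesis is available only where \<open>unif p\<close> is nonzero, which
    excludes p. The extra factor makes the identity valid on the whole cone; cancelling it then
    allows evaluation at p.\<close>
  have "unif p x * f x = unif p x * b x" if x: "x \<in> C" for x
  proof (cases "unif p x = 0")
    case False
    define P where "P = monom (f x) N1 - (\<Sum>n\<le>B. monom (?b n x) (k + (d + n)))"
    have "P = 0"
    proof (rule poly_zero_if_cofinite_roots[of "{0}"])
      fix t :: 'a assume t: "t \<notin> {0}"
      let ?tx = "map ((*) t) x"
      have "unif p ?tx \<noteq> 0" using form_fun_scaled[OF form_fun_unif C_length[OF x]] t False by simp
      with eq z4_cone_scaled[OF x] t have "f ?tx = unif p ?tx ^ k * (g ?tx * meval q ?tx)" by blast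
      also have "\<dots> = (\<Sum>n\<le>B. ?b n ?tx)"
        using r(2)[of ?tx] C_length[OF x] by (simp add: sum_distrib_left)
      finally have "t ^ N1 * f x = (\<Sum>n\<le>B. t ^ (k + (d + n)) * ?b n x)"
        by (simp only: form_fun_scaled[OF f(1) C_length[OF x]] form_fun_scaled[OF fb C_length[OF x]])
      then show "poly P t = 0" by (simp add: P_def poly_monom poly_sum mult_ac)
    qed simp
    then have "coeff P N1 = 0" by simp
    then have "f x = b x" by (simp add: P_def b_def coeff_sum)
    then show ?thesis by simp
  qed simp
  from form_fun_cancel[OF form_fun_unif f(1) \<open>form_fun N1 b\<close> nonvanishing_unif[OF p] this N_subset_C[OF p]] have "f p = b p" .
  moreover have "b p = 0" using k by (auto simp: b_def unif_self[OF p] intro!: sum.neutral)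
  ultimately show False using f(2) by simp
qed

text \<open>The local order agrees with the order defined by ideals. For the lower bound the witness
  is G * U^n with U representing the uniformiser; for the upper bound a larger exponent would make a
  unit at p divisible by the uniformiser, contrary to \<open>local_division_bound\<close>.\<close>

lemma ord_form_eq:
  assumes F: "is_form 3 m F" and p: "p \<in> N" and n: "has_ord p (meval F) n"
  shows "ord_form 3 E (proj p) F = n"
  unfolding ord_form_def
proof (rule Greatest_equality)
  from n obtain h g d e where 1: "form_fun d h" "form_fun e g" "h p \<noteq> 0" "g p \<noteq> 0"
    "\<And>x. x \<in> C \<Longrightarrow> h x * meval F x = unif p x ^ n * g x" by (rule has_ordE) blast
  from 1(1) obtain H where H: "is_form 3 d H" "\<And>x. length x = 4 \<Longrightarrow> h x = meval H x" by (auto simp: form_fun_def)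
  show "ord_ge 3 E (proj p) F n"
  proof -
    from 1(2) obtain G where G: "is_form 3 e G" "\<And>x. length x = 4 \<Longrightarrow> g x = meval G x" by (auto simp: form_fun_def)
    from form_fun_unif[of p] obtain U where U: "is_form 3 1 U" "\<And>x. length x = 4 \<Longrightarrow> unif p x = meval U x" by (auto simp: form_fun_def)
    \<comment> \<open>The ideal of E is generated by forms, so H * F - G * U^n is recognised as a
      generator only if both terms have the same degree.\<close>
    have deg: "d + m = n + e"
      by (rule form_fun_degree_unique[OF form_fun_mult[OF 1(1) form_fun_meval[OF F]] form_fun_mult[OF form_fun_power1[OF form_fun_unif] 1(2)] 1(5)])
        (use nonvanishing_mult[OF 1(1) form_fun_meval[OF F] nonvanishingI[OF N_subset_C[OF p], of h] has_ord_nz[OF n p]] 1(3) in auto)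
    have "vanishes_on U {proj p}"
      using U unif_self[OF p] N_length[OF p] by (auto simp: vanishes_on_def vanishes_at_proj)
    then have "prod_list (replicate n U) \<in> {prod_list Fs | Fs. length Fs = n \<and> set Fs \<subseteq> forms_vanishing_on 3 {proj p}}"
      using U(1) by (intro CollectI exI[of _ "replicate n U"]) (auto simp: forms_vanishing_on_def)
    then have A: "G * U ^ n \<in> point_ideal_power 3 (proj p) n"
      unfolding point_ideal_power_def by (intro ideal_span_scale ideal_span_base) (simp add: prod_list_replicate)
    have "is_form 3 (d + m) (H * F)" "is_form 3 (d + m) (G * U ^ n)"
      using is_form_mult[OF H(1) F] is_form_mult[OF G(1) is_form_power[OF U(1)], of n] deg by (simp_all add: add.commute)
    then have "is_form 3 (d + m) (H * F - G * U ^ n)" by (rule is_form_diff)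
    moreover have "vanishes_on (H * F - G * U ^ n) E"
      using 1(5) H(2) G(2) U(2) C_length by (auto simp: vanishes_on_E nonvanishing_def mult.commute)
    ultimately have "H * F - G * U ^ n \<in> ideal_of 3 E"
      unfolding ideal_of_def by (intro ideal_span_base) (auto simp: forms_vanishing_on_def)
    moreover have "\<not> vanishes_at H (proj p)"
      using vanishes_at_proj[OF H(1) N_length[OF p]] 1(3) H(2)[OF N_length[OF p]] by simp
    ultimately show ?thesis unfolding ord_ge_def using H(1) A by blast
  qed
  show "k \<le> n" if "ord_ge 3 E (proj p) F k" for k
  proof (rule ccontr)
    assume k: "\<not> k \<le> n"
    from that obtain H' e' A where A: "is_form 3 e' H'" "\<not> vanishes_at H' (proj p)"
      "A \<in> point_ideal_power 3 (proj p) k" "H' * F - A \<in> ideal_of 3 E" unfolding ord_ge_def by blast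
    from point_ideal_power_locally[OF A(3) p] obtain h' d' q where 2: "form_fun d' h'" "h' p \<noteq> 0"
      "\<And>x. x \<in> C \<Longrightarrow> h' x * meval A x = unif p x ^ k * meval q x" by blast
    have H'p: "meval H' p \<noteq> 0" using vanishes_at_proj[OF A(1) N_length[OF p]] A(2) by simp
    show False
    proof (rule local_division_bound[OF p, of "d' + (e' + e)" "\<lambda>x. h' x * (meval H' x * g x)" d h "k - n" q])
      fix x assume x: "x \<in> C" "unif p x \<noteq> 0"
      have "meval A x = meval H' x * meval F x"
        using ideal_of_E_vanishes[OF A(4) x(1)] by simp
      then have "h x * (unif p x ^ k * meval q x) = h' x * (meval H' x * (h x * meval F x))"
        unfolding 2(3)[OF x(1), symmetric] by (simp add: mult_ac)
      also have "\<dots> = unif p x ^ n * (h' x * (meval H' x * g x))"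
        unfolding 1(5)[OF x(1)] by (simp add: mult_ac)
      finally have "unif p x ^ n * (h' x * (meval H' x * g x)) = unif p x ^ n * (unif p x ^ (k - n) * (h x * meval q x))"
        using k by (simp add: mult_ac flip: power_add)
      with x(2) show "h' x * (meval H' x * g x) = unif p x ^ (k - n) * (h x * meval q x)" by simp
    next
      show "form_fun (d' + (e' + e)) (\<lambda>x. h' x * (meval H' x * g x))"
        by (intro form_fun_mult 2 1 form_fun_meval A)
    qed (use 1 2 H'p k in auto)
  qed
qed

end

section \<open>Degrees of divisors and effective divisors of small degree\<close>

lemma div_degree_superset:
  assumes "finite A" "Poly_Mapping.keys D \<subseteq> A"
  shows "div_degree D = (\<Sum>P\<in>A. Poly_Mapping.lookup D P)"
  unfolding div_degree_def using assms
  by (intro sum.mono_neutral_left) (auto simp: in_keys_iff)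

lemma div_degree_add: "div_degree (D + D') = div_degree D + div_degree D'"
proof -
  let ?A = "Poly_Mapping.keys D \<union> Poly_Mapping.keys D'"
  have "Poly_Mapping.keys (D + D') \<subseteq> ?A" by (rule keys_add)
  then show ?thesis by (simp add: div_degree_superset[of ?A] lookup_add sum.distrib)
qed

lemma div_degree_frag_of [simp]: "div_degree (frag_of P) = 1"
  by (simp add: div_degree_def)

lemma div_degree_diff: "div_degree (D - D') = div_degree D - div_degree D'"
  using div_degree_add[of "D - D'" D'] by simp

lemma effective_degree_0:
  assumes "effective D" "div_degree D = 0"
  shows "D = 0"
proof (rule poly_mapping_eqI)
  fix P
  have "\<forall>P\<in>Poly_Mapping.keys D. Poly_Mapping.lookup D P = 0"
    using assms sum_nonneg_eq_0_iff[of "Poly_Mapping.keys D" "Poly_Mapping.lookup D"]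
    by (simp add: effective_def div_degree_def)
  then show "Poly_Mapping.lookup D P = Poly_Mapping.lookup 0 P"
    by (cases "P \<in> Poly_Mapping.keys D") (auto simp: in_keys_iff)
qed

lemma effective_degree_1:
  assumes "effective D" "div_degree D = 1"
  obtains P where "P \<in> Poly_Mapping.keys D" "D = frag_of P"
proof -
  have "Poly_Mapping.keys D \<noteq> {}" using assms(2) by (auto simp: div_degree_def)
  then obtain P where P: "P \<in> Poly_Mapping.keys D" by blast
  have "Poly_Mapping.lookup D P \<noteq> 0" "0 \<le> Poly_Mapping.lookup D P"
    using P assms(1) by (auto simp: in_keys_iff effective_def)
  then have "effective (D - frag_of P)"
    using assms(1) by (auto simp: effective_def lookup_minus lookup_frag_of)
  moreover have "div_degree (D - frag_of P) = 0" using assms(2) by (simp add: div_degree_diff)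
  ultimately have "D - frag_of P = 0" by (rule effective_degree_0)
  with P show ?thesis by (intro that) auto
qed

context z4_model
begin

declare lookup_frag_of [simp del]

definition nv_form :: "nat \<Rightarrow> 'a mpol \<Rightarrow> bool" where
  "nv_form m F \<longleftrightarrow> is_form 3 m F \<and> nonvanishing (meval F)"

abbreviation "dv F \<equiv> form_div 3 E F"

lemma nv_form_iff: "nv_form m F \<longleftrightarrow> is_form 3 m F \<and> \<not> vanishes_on F E"
  by (simp add: nv_form_def vanishes_on_E)

lemma nv_form_has_ord: "nv_form m F \<Longrightarrow> p \<in> N \<Longrightarrow> has_ord p (meval F) (ord_form 3 E (proj p) F)"
  using has_ord_exists[OF form_fun_meval, of m F] ord_form_eq unfolding nv_form_def by metis

text \<open>\<open>form_div\<close> is built with \<open>Abs_poly_mapping\<close>, so its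
  coefficients can be read off only once the support is known to be finite.\<close>

lemma lookup_dv:
  assumes "nv_form m F"
  shows "Poly_Mapping.lookup (dv F) P = (if P \<in> E then int (ord_form 3 E P F) else 0)"
proof -
  let ?f = "\<lambda>P. if P \<in> E then int (ord_form 3 E P F) else 0"
  from has_ord_exists[OF form_fun_meval, of m F] assms obtain qs where qs: "set qs \<subseteq> N"
    "\<And>p. p \<in> N \<Longrightarrow> \<exists>n. has_ord p (meval F) n \<and> (n = 0 \<or> p \<in> {ptO, ptS} \<union> set qs \<union> rev ` set qs)"
    unfolding nv_form_def by metis
  have "{P. ?f P \<noteq> 0} \<subseteq> proj ` ({ptO, ptS} \<union> set qs \<union> rev ` set qs)"
  proof
    fix P assume P: "P \<in> {P. ?f P \<noteq> 0}"
    then obtain p where p: "p \<in> N" "P = proj p" by (auto elim: E_cases split: if_splits)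
    from qs(2)[OF p(1)] obtain n where n: "has_ord p (meval F) n"
      "n = 0 \<or> p \<in> {ptO, ptS} \<union> set qs \<union> rev ` set qs" by blast
    have "ord_form 3 E P F = n" using has_ord_unique[OF p(1) n(1)] nv_form_has_ord[OF assms p(1)] p(2) by simp
    with P n(2) p(2) show "P \<in> proj ` ({ptO, ptS} \<union> set qs \<union> rev ` set qs)" by auto
  qed
  then have "finite {P. ?f P \<noteq> 0}" by (rule finite_subset) simp
  then show ?thesis by (simp add: form_div_def)
qed

lemma lookup_dv_N:
  assumes "nv_form m F" "p \<in> N" "has_ord p (meval F) n"
  shows "Poly_Mapping.lookup (dv F) (proj p) = int n"
  using assms lookup_dv[OF assms(1)] has_ord_unique[OF assms(2,3) nv_form_has_ord[OF assms(1,2)]] by simp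

lemma lookup_dvE:
  assumes "nv_form m F" "p \<in> N"
  obtains n where "has_ord p (meval F) n" "Poly_Mapping.lookup (dv F) (proj p) = int n"
  using nv_form_has_ord[OF assms] lookup_dv_N[OF assms] by blast

lemma divisor_on_dv: "nv_form m F \<Longrightarrow> divisor_on E (dv F)"
  by (auto simp: divisor_on_def in_keys_iff lookup_dv split: if_splits)

lemma divisor_eqI:
  assumes "divisor_on E D" "divisor_on E D'"
    "\<And>p. p \<in> N \<Longrightarrow> Poly_Mapping.lookup D (proj p) = Poly_Mapping.lookup D' (proj p)"
  shows "D = D'"
proof (rule poly_mapping_eqI)
  fix P
  show "Poly_Mapping.lookup D P = Poly_Mapping.lookup D' P"
  proof (cases "P \<in> E")
    case True
    then obtain p where "p \<in> N" "P = proj p" by (rule E_cases)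
    with assms(3) show ?thesis by simp
  next
    case False
    then have "P \<notin> Poly_Mapping.keys D" "P \<notin> Poly_Mapping.keys D'"
      using assms(1,2) by (auto simp: divisor_on_def)
    then show ?thesis by (simp add: in_keys_iff)
  qed
qed

lemma divisor_on_add: "divisor_on E D \<Longrightarrow> divisor_on E D' \<Longrightarrow> divisor_on E (D + D')"
  using keys_add[of D D'] by (auto simp: divisor_on_def)

lemma divisor_on_diff: "divisor_on E D \<Longrightarrow> divisor_on E D' \<Longrightarrow> divisor_on E (D - D')"
  using keys_diff[of D D'] by (auto simp: divisor_on_def)

lemma divisor_on_frag_of: "P \<in> E \<Longrightarrow> divisor_on E (frag_of P)"
  by (simp add: divisor_on_def)

lemma lookup_frag_N: "p \<in> N \<Longrightarrow> q \<in> N \<Longrightarrow> Poly_Mapping.lookup (frag_of (proj q)) (proj p) = of_bool (p = q)"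
  by (simp add: lookup_frag_of proj_inj_N)

lemma nv_form_mult:
  assumes "nv_form m F" "nv_form n G"
  shows "nv_form (m + n) (F * G)"
proof -
  have "nonvanishing (\<lambda>x. meval F x * meval G x)"
    using assms by (intro nonvanishing_mult[OF form_fun_meval form_fun_meval, of m F n G]) (auto simp: nv_form_def)
  then show ?thesis using assms is_form_mult[of 3 m F n G] by (simp add: nv_form_def nonvanishing_def)
qed

lemma dv_mult:
  assumes "nv_form m F" "nv_form n G"
  shows "dv (F * G) = dv F + dv G"
proof (rule divisor_eqI)
  fix p assume p: "p \<in> N"
  from lookup_dvE[OF assms(1) p] obtain i where i: "has_ord p (meval F) i" "Poly_Mapping.lookup (dv F) (proj p) = int i" .
  from lookup_dvE[OF assms(2) p] obtain j where j: "has_ord p (meval G) j" "Poly_Mapping.lookup (dv G) (proj p) = int j" .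
  have "has_ord p (meval (F * G)) (i + j)" by (rule has_ord_eq[OF has_ord_mult[OF i(1) j(1)]]) simp
  with i j show "Poly_Mapping.lookup (dv (F * G)) (proj p) = Poly_Mapping.lookup (dv F + dv G) (proj p)"
    by (simp add: lookup_dv_N[OF nv_form_mult[OF assms] p] lookup_add)
qed (intro divisor_on_add divisor_on_dv[OF nv_form_mult[OF assms]] divisor_on_dv[OF assms(1)] divisor_on_dv[OF assms(2)])+

abbreviation "Pr D \<equiv> principal_divisor 3 E D"

lemma Pr_iff: "Pr D \<longleftrightarrow> (\<exists>m F G. nv_form m F \<and> nv_form m G \<and> D = dv F - dv G)"
  by (auto simp: principal_divisor_def nv_form_iff)

lemma Pr_diff: "nv_form m F \<Longrightarrow> nv_form m G \<Longrightarrow> Pr (dv F - dv G)"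
  by (auto simp: Pr_iff)

lemma Pr_add: "Pr D \<Longrightarrow> Pr D' \<Longrightarrow> Pr (D + D')"
proof -
  assume "Pr D" "Pr D'"
  then obtain m F G m' F' G' where *: "nv_form m F" "nv_form m G" "D = dv F - dv G"
    "nv_form m' F'" "nv_form m' G'" "D' = dv F' - dv G'" by (auto simp: Pr_iff)
  have "D + D' = dv (F * F') - dv (G * G')" using * by (simp add: dv_mult)
  with nv_form_mult * show ?thesis by (metis Pr_diff)
qed

lemma Pr_minus: "Pr D \<Longrightarrow> Pr (- D)"
  by (metis Pr_iff minus_diff_eq)

lemma Pr_sub: "Pr D \<Longrightarrow> Pr D' \<Longrightarrow> Pr (D - D')"
  using Pr_add[OF _ Pr_minus] by fastforce

lemma Pr_0: "Pr 0"
proof -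
  have "nv_form 0 1" using nonvanishing_const[of 1] by (simp add: nv_form_def is_form_1 nonvanishing_def)
  from Pr_diff[OF this this] show ?thesis by simp
qed

subsection \<open>Divisors of linear forms\<close>

lemma form_fun_obtain_nv_form:
  assumes "form_fun m f" "nonvanishing f"
  obtains F where "nv_form m F" "\<And>x. length x = 4 \<Longrightarrow> f x = meval F x"
proof -
  from assms(1) obtain F where F: "is_form 3 m F" "\<And>x. length x = 4 \<Longrightarrow> f x = meval F x" by (auto simp: form_fun_def)
  with assms(2) have "nv_form m F" using C_length by (auto simp: nv_form_def nonvanishing_def)
  with F show ?thesis by (intro that)
qed

lemma has_ord_meval_cong: "(\<And>x. length x = 4 \<Longrightarrow> f x = meval F x) \<Longrightarrow> has_ord p f n \<Longrightarrow> has_ord p (meval F) n"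
  using has_ord_eq[of p f n "meval F"] C_length by blast

lemma pencil_form:
  assumes "q \<in> N"
  obtains L where "nv_form 1 L" "\<And>x. length x = 4 \<Longrightarrow> pencil q x = meval L x"
    "dv L = frag_of (proj ptO) + frag_of (proj ptS) + frag_of (proj q) + frag_of (proj (rev q))"
proof -
  have nonvanishing: "nonvanishing (pencil q)" using has_ord_nz[OF has_ord_pencil[OF N_ptO assms] N_ptO] .
  from form_fun_obtain_nv_form[OF form_fun_pencil nonvanishing] obtain L where L: "nv_form 1 L" "\<And>x. length x = 4 \<Longrightarrow> pencil q x = meval L x" by blast
  have "dv L = frag_of (proj ptO) + frag_of (proj ptS) + frag_of (proj q) + frag_of (proj (rev q))"
  proof (rule divisor_eqI)
    fix p assume p: "p \<in> N"
    show "Poly_Mapping.lookup (dv L) (proj p) =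
       Poly_Mapping.lookup (frag_of (proj ptO) + frag_of (proj ptS) + frag_of (proj q) + frag_of (proj (rev q))) (proj p)"
      using lookup_dv_N[OF L(1) p has_ord_meval_cong[OF L(2) has_ord_pencil[OF p assms]]]
      by (simp add: lookup_add lookup_frag_N p assms rev_N)
  qed (intro divisor_on_add divisor_on_frag_of divisor_on_dv[OF L(1)] proj_in_E N_ptO N_ptS assms rev_N)+
  with L show ?thesis by (rule that)
qed

lemma sum_sum_list: "(\<Sum>p\<in>B. \<Sum>q\<leftarrow>qs. f p q) = (\<Sum>q\<leftarrow>qs. \<Sum>p\<in>B. f p q :: nat)"
  by (induction qs) (auto simp: sum.distrib)

text \<open>Summing the orders of L and of its conjugate over a finite set closed under reversal
  counts the degree twice. Each of the four points q in \<open>linear_orders\<close> contributes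
  itself and its conjugate, so the double degree is 8.\<close>

lemma degree_linear:
  assumes "nv_form 1 L"
  shows "div_degree (dv L) = 4"
proof -
  have "form_fun 1 (meval L)" "nonvanishing (meval L)" using assms by (auto simp: nv_form_def intro: form_fun_meval)
  then obtain qs where qs: "length qs = 4" "set qs \<subseteq> N"
    "\<And>p i j. p \<in> N \<Longrightarrow> has_ord p (meval L) i \<Longrightarrow> has_ord (rev p) (meval L) j \<Longrightarrow>
       i + j = (\<Sum>q\<leftarrow>qs. of_bool (p = q) + of_bool (p = rev q))"
    by (rule linear_orders) blast
  define o' where "o' p = ord_form 3 E (proj p) L" for p
  have sum: "o' p + o' (rev p) = (\<Sum>q\<leftarrow>qs. of_bool (p = q) + of_bool (p = rev q))" if "p \<in> N" for p
    unfolding o'_def by (rule qs(3)[OF that nv_form_has_ord[OF assms that] nv_form_has_ord[OF assms rev_N[OF that]]])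
  \<comment> \<open>Closing the set under reversal lets the sum of the conjugate orders be reindexed
    to the sum of the orders.\<close>
  define B where "B = set qs \<union> rev ` set qs"
  have B: "finite B" "B \<subseteq> N" "rev ` B = B" using qs(2) rev_N by (auto simp: B_def image_Un image_image)
  have supp: "Poly_Mapping.keys (dv L) \<subseteq> proj ` B"
  proof
    fix P assume P: "P \<in> Poly_Mapping.keys (dv L)"
    then have "P \<in> E" using divisor_on_dv[OF assms] by (auto simp: divisor_on_def)
    then obtain p where p: "p \<in> N" "P = proj p" by (rule E_cases)
    have "p \<in> B"
    proof (rule ccontr)
      assume "p \<notin> B"
      then have "map (\<lambda>q. of_bool (p = q) + of_bool (p = rev q)) qs = map (\<lambda>_. 0::nat) qs"
        by (intro map_cong) (auto simp: B_def)
      with sum[OF p(1)] have "o' p = 0" by (simp add: sum_list_triv)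
      with P p lookup_dv[OF assms] show False by (simp add: in_keys_iff o'_def)
    qed
    with p show "P \<in> proj ` B" by blast
  qed
  have inj: "inj_on proj B" using B(2) by (intro inj_onI) (metis proj_inj_N subsetD)
  have "div_degree (dv L) = (\<Sum>P\<in>proj ` B. Poly_Mapping.lookup (dv L) P)"
    by (rule div_degree_superset[OF _ supp]) (simp add: B)
  also have "\<dots> = (\<Sum>p\<in>B. int (o' p))"
    unfolding sum.reindex[OF inj] o_def o'_def using B(2) lookup_dv[OF assms] by (intro sum.cong) auto
  finally have deg: "div_degree (dv L) = int (\<Sum>p\<in>B. o' p)" by simp
  have "(\<Sum>p\<in>B. o' (rev p)) = (\<Sum>p\<in>rev ` B. o' p)"
    by (subst sum.reindex) (auto simp: inj_on_def o_def)
  then have "2 * (\<Sum>p\<in>B. o' p) = (\<Sum>p\<in>B. o' p + o' (rev p))" using B(3) by (simp add: sum.distrib)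
  also have "\<dots> = (\<Sum>p\<in>B. \<Sum>q\<leftarrow>qs. of_bool (p = q) + of_bool (p = rev q))"
    using B(2) sum by (intro sum.cong) auto
  also have "\<dots> = (\<Sum>q\<leftarrow>qs. \<Sum>p\<in>B. of_bool (p = q) + of_bool (p = rev q))" by (rule sum_sum_list)
  also have "map (\<lambda>q. \<Sum>p\<in>B. of_bool (p = q) + of_bool (p = rev q)) qs = map (\<lambda>_. 2::nat) qs"
  proof (rule map_cong[OF refl])
    fix q assume "q \<in> set qs"
    then have "q \<in> B" "rev q \<in> B" by (auto simp: B_def)
    then show "(\<Sum>p\<in>B. of_bool (p = q) + of_bool (p = rev q)) = (2::nat)"
      using B(1) by (simp add: sum.distrib of_bool_def)
  qed
  also have "sum_list (map (\<lambda>_. 2::nat) qs) = 8" using qs(1) by (simp add: sum_list_triv)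
  finally show ?thesis using deg by simp
qed

lemma ord_at_least_lookup:
  assumes "nv_form m F" "p \<in> N" "ord_at_least p (meval F) n"
  shows "int n \<le> Poly_Mapping.lookup (dv F) (proj p)"
  using lookup_dvE[OF assms(1,2)] ord_at_least_le_has_ord[OF assms(2) _ assms(3)] by (metis of_nat_mono)

text \<open>Removing three prescribed points from a plane section of degree 4 leaves an effective
  divisor of degree 1, which is a point.\<close>

lemma plane_through:
  assumes "p1 \<in> N" "p2 \<in> N" "p3 \<in> N"
  obtains L R where "nv_form 1 L" "R \<in> E"
    "dv L = frag_of (proj p1) + frag_of (proj p2) + frag_of (proj p3) + frag_of R"
proof -
  from plane_through_three_points[OF assms] obtain f where f: "form_fun 1 f" "nonvanishing f"
    "\<And>p. p \<in> N \<Longrightarrow> ord_at_least p f (of_bool (p = p1) + of_bool (p = p2) + of_bool (p = p3))" by blast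
  from form_fun_obtain_nv_form[OF f(1,2)] obtain L where L: "nv_form 1 L" "\<And>x. length x = 4 \<Longrightarrow> f x = meval L x" by blast
  let ?D = "dv L - (frag_of (proj p1) + frag_of (proj p2) + frag_of (proj p3))"
  have on: "divisor_on E ?D"
    by (intro divisor_on_diff divisor_on_add divisor_on_frag_of divisor_on_dv[OF L(1)] proj_in_E assms)
  have "effective ?D"
    unfolding effective_def
  proof
    fix P
    show "0 \<le> Poly_Mapping.lookup ?D P"
    proof (cases "P \<in> E")
      case True
      then obtain p where p: "p \<in> N" "P = proj p" by (rule E_cases)
      have "ord_at_least p (meval L) (of_bool (p = p1) + of_bool (p = p2) + of_bool (p = p3))"
        by (rule ord_at_least_eq[OF f(3)[OF p(1)]]) (simp add: L(2) C_length)
      from ord_at_least_lookup[OF L(1) p(1) this] show ?thesis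
        by (simp add: p lookup_minus lookup_add lookup_frag_N assms)
    next
      case False
      then have "P \<notin> Poly_Mapping.keys ?D" using on by (auto simp: divisor_on_def)
      then have "Poly_Mapping.lookup ?D P = 0" by (simp only: in_keys_iff not_not)
      then show ?thesis by simp
    qed
  qed
  moreover have "div_degree ?D = 1"
    by (simp add: div_degree_diff div_degree_add degree_linear[OF L(1)])
  ultimately obtain R where R: "R \<in> Poly_Mapping.keys ?D" "?D = frag_of R" by (rule effective_degree_1)
  show ?thesis
  proof (rule that[OF L(1)])
    show "R \<in> E" using R(1) on by (auto simp: divisor_on_def)
    have "dv L = (frag_of (proj p1) + frag_of (proj p2) + frag_of (proj p3)) + ?D" by simp
    then show "dv L = frag_of (proj p1) + frag_of (proj p2) + frag_of (proj p3) + frag_of R"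
      unfolding R(2) .
  qed
qed

text \<open>Write D - div L as div F - div G. Then D + div G = div (L F), and effectivity of D says
  that L F has at least the zeros of G, so \<open>planes_complete\<close> gives L F = L' G on the
  curve and hence D = div L'.\<close>

lemma linear_system_complete:
  assumes L: "nv_form 1 L" and D: "divisor_on E D" "effective D" "Pr (D - dv L)"
  obtains L' where "nv_form 1 L'" "D = dv L'"
proof -
  from D(3) obtain m F G where FG: "nv_form m F" "nv_form m G" "D - dv L = dv F - dv G" by (auto simp: Pr_iff)
  have D': "D + dv G = dv (L * F)" using FG(3) dv_mult[OF L FG(1)] by (simp add: algebra_simps)
  have LF: "nv_form (Suc m) (L * F)" using nv_form_mult[OF L FG(1)] by simp
  obtain f where f: "form_fun 1 f" "\<And>x. x \<in> C \<Longrightarrow> meval (L * F) x = f x * meval G x"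
  proof (rule planes_complete[of m "meval (L * F)" "meval G"])
    fix p i j assume *: "p \<in> N" "has_ord p (meval (L * F)) i" "has_ord p (meval G) j"
    have "Poly_Mapping.lookup (D + dv G) (proj p) = int i"
      unfolding D' by (rule lookup_dv_N[OF LF *(1,2)])
    moreover have "Poly_Mapping.lookup (dv G) (proj p) = int j" by (rule lookup_dv_N[OF FG(2) *(1,3)])
    moreover have "0 \<le> Poly_Mapping.lookup D (proj p)" using D(2) by (simp add: effective_def)
    ultimately show "j \<le> i" by (simp add: lookup_add)
  qed (use LF FG in \<open>auto simp: nv_form_def intro: form_fun_meval simp del: meval_mult\<close>)
  have "nonvanishing f"
  proof (rule ccontr)
    assume "\<not> nonvanishing f"
    then have "meval (L * F) x = 0" if "x \<in> C" for x using f(2)[OF that] that by (auto simp: nonvanishing_def)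
    with LF show False by (auto simp: nv_form_def nonvanishing_def)
  qed
  from form_fun_obtain_nv_form[OF f(1) this] obtain L' where L': "nv_form 1 L'" "\<And>x. length x = 4 \<Longrightarrow> f x = meval L' x" by blast
  have "D + dv G = dv L' + dv G"
    unfolding D' dv_mult[OF L'(1) FG(2), symmetric]
  proof (rule divisor_eqI[OF divisor_on_dv[OF LF] divisor_on_dv[OF nv_form_mult[OF L'(1) FG(2)]]])
    fix p assume p: "p \<in> N"
    from lookup_dvE[OF LF p] obtain i where i: "has_ord p (meval (L * F)) i"
      "Poly_Mapping.lookup (dv (L * F)) (proj p) = int i" .
    have "has_ord p (meval (L' * G)) i"
      by (rule has_ord_eq[OF i(1)]) (simp add: f(2) L'(2) C_length del: meval_mult, simp add: L'(2) C_length)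
    then show "Poly_Mapping.lookup (dv (L * F)) (proj p) = Poly_Mapping.lookup (dv (L' * G)) (proj p)"
      using i(2) lookup_dv_N[OF nv_form_mult[OF L'(1) FG(2)] p] by simp
  qed
  with L'(1) show ?thesis by (intro that) auto
qed

abbreviation "fr p \<equiv> frag_of (proj p)"

text \<open>A plane through \<open>ptO\<close> and \<open>ptS\<close> cuts out, besides these, a pair of conjugate points.\<close>

lemma point_class_unique:
  assumes "r \<in> N" "r' \<in> N" "Pr (fr r - fr r')"
  shows "r = r'"
proof -
  from pencil_form[OF assms(1)] obtain L where L: "nv_form 1 L" "dv L = fr ptO + fr ptS + fr r + fr (rev r)" by metis
  \<comment> \<open>The section through r and its conjugate with r replaced by r'. It is effective
    and linearly equivalent to a plane section, hence a plane section itself.\<close>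
  let ?D = "fr ptO + fr ptS + fr r' + fr (rev r)"
  have D: "divisor_on E ?D"
    by (intro divisor_on_add divisor_on_frag_of proj_in_E N_ptO N_ptS assms rev_N)
  have eq: "?D - dv L = - (fr r - fr r')" using L(2) by simp
  have "Pr (?D - dv L)" unfolding eq by (rule Pr_minus[OF assms(3)])
  moreover have "effective ?D" by (simp add: effective_def lookup_add lookup_frag_of)
  ultimately obtain L' where L': "nv_form 1 L'" "?D = dv L'" using linear_system_complete[OF L(1) D] by metis
  from L'(1) have "form_fun 1 (meval L')" by (auto simp: nv_form_def intro: form_fun_meval)
  then obtain a0 a1 a2 a3 where a: "\<And>x. length x = 4 \<Longrightarrow> meval L' x = a0 * x!0 + a1 * x!1 + a2 * x!2 + a3 * x!3"
    unfolding form_fun_1_iff by blast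
  have zero: "meval L' p = 0" if "p \<in> {ptO, ptS}" for p
  proof (rule ccontr)
    assume nonvanishing: "meval L' p \<noteq> 0"
    have p: "p \<in> N" using that by auto
    from nonvanishing L'(1) have "has_ord p (meval L') 0" by (intro has_ord_0[OF form_fun_meval[of 1]]) (auto simp: nv_form_def)
    from lookup_dv_N[OF L'(1) p this] have "Poly_Mapping.lookup ?D (proj p) = 0" by (simp add: L'(2))
    with that p show False using assms
      by (auto simp: lookup_add lookup_frag_N rev_N of_bool_def split: if_splits)
  qed
  have "a3 = a0" using zero[of ptO] a[of ptO] by (simp add: ptO_def add_eq_0_char2)
  moreover have "a2 = a1" using zero[of ptS] a[of ptS] by (simp add: ptS_def add_eq_0_char2)
  ultimately have L'x: "meval L' x = a0 * xi x + a1 * eta x" if "length x = 4" for x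
    using a[OF that] by (simp add: xi_def eta_def algebra_simps)
  have "a0 \<noteq> 0 \<or> a1 \<noteq> 0"
    using L'(1) L'x C_length by (auto simp: nv_form_def nonvanishing_def)
  from pencil_of_pencil[OF this] obtain q \<kappa> where q: "q \<in> N" "\<kappa> \<noteq> 0"
    "\<And>x. a0 * xi x + a1 * eta x = \<kappa> * pencil q x" by blast
  \<comment> \<open>As multisets, r' and \<open>rev r\<close> agree with q and \<open>rev q\<close>.
    So they form a conjugate pair, which forces r' = r.\<close>
  have "of_bool (p = r') + of_bool (p = rev r) = of_bool (p = q) + (of_bool (p = rev q) :: int)" if p: "p \<in> N" for p
  proof -
    have "has_ord p (meval L') (of_bool (p = ptO) + of_bool (p = ptS) + of_bool (p = q) + of_bool (p = rev q))"
      by (rule has_ord_meval_cong[OF _ has_ord_scale[OF q(2) has_ord_pencil[OF p q(1)]]]) (simp add: L'x q(3))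
    from lookup_dv_N[OF L'(1) p this] show ?thesis unfolding L'(2)[symmetric]
      by (simp add: lookup_add lookup_frag_N p assms rev_N)
  qed
  from this[of r'] this[of "rev r"] this[of q] assms q(1) rev_N show ?thesis
    by (auto simp: of_bool_def split: if_splits)
qed

end

section \<open>Coefficients of linear forms\<close>

lemma degree_one_monomial:
  fixes m :: "nat \<Rightarrow>\<^sub>0 nat"
  assumes "Poly_Mapping.keys m \<subseteq> {..3}" "(\<Sum>i\<le>3. Poly_Mapping.lookup m i) = (1::nat)"
  shows "\<exists>j<4. m = Poly_Mapping.single j 1"
proof -
  obtain j where j: "j \<le> 3" "Poly_Mapping.lookup m j \<noteq> 0"
    using assms(2) by (metis atMost_iff sum.neutral zero_neq_one)
  have "(\<Sum>i\<le>3. Poly_Mapping.lookup m i) = Poly_Mapping.lookup m j + (\<Sum>i\<in>{..3} - {j}. Poly_Mapping.lookup m i)"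
    using j(1) by (intro sum.remove) auto
  then have 1: "Poly_Mapping.lookup m j = 1" "(\<Sum>i\<in>{..3} - {j}. Poly_Mapping.lookup m i) = 0"
    using assms(2) j(2) by linarith+
  have "Poly_Mapping.lookup m k = (if k = j then 1 else 0)" for k
    using 1 assms(1) by (cases "k \<le> 3") (auto simp: in_keys_iff)
  then have "m = Poly_Mapping.single j 1" by (intro poly_mapping_eqI) (auto simp: lookup_single when_def)
  with j show ?thesis by (intro exI[of _ j]) auto
qed

lemma meval_unit_vector:
  fixes L :: "'a::field mpol"
  assumes "is_form 3 1 L" "i < 4"
  shows "meval L ((replicate 4 0)[i := 1]) = Poly_Mapping.lookup L (Poly_Mapping.single i 1)"
proof -
  let ?e = "(replicate 4 0)[i := 1] :: 'a list"
  have "meval L ?e = (\<Sum>m\<in>Poly_Mapping.keys L. if m = Poly_Mapping.single i 1 then Poly_Mapping.lookup L m else 0)"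
    unfolding meval_superset[OF finite_keys subset_refl, of L]
  proof (rule sum.cong[OF refl])
    fix m assume "m \<in> Poly_Mapping.keys L"
    then obtain j where j: "j < 4" "m = Poly_Mapping.single j 1"
      using assms(1) degree_one_monomial[of m] by (auto simp: is_form_def)
    then have "mon_eval m ?e = of_bool (j = i)" using assms(2)
      by (auto simp: mon_eval_def nth_default_nth nth_list_update)
    moreover have "m = Poly_Mapping.single i 1 \<longleftrightarrow> j = i"
      using j(2) by (auto dest: arg_cong[where f = Poly_Mapping.keys])
    ultimately show "Poly_Mapping.lookup L m * mon_eval m ?e = (if m = Poly_Mapping.single i 1 then Poly_Mapping.lookup L m else 0)"
      by simp
  qed
  then show ?thesis by (simp add: in_keys_iff)
qed

lemma linear_form_nonzero:
  fixes L :: "'a::field mpol"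
  assumes "is_form 3 1 L" "L \<noteq> 0"
  shows "\<exists>x. length x = 4 \<and> meval L x \<noteq> 0"
proof -
  from assms(2) obtain m where m: "m \<in> Poly_Mapping.keys L" by fastforce
  then obtain j where "j < 4" "m = Poly_Mapping.single j 1"
    using assms(1) degree_one_monomial[of m] by (auto simp: is_form_def)
  with m meval_unit_vector[OF assms(1), of j] show ?thesis
    by (intro exI[of _ "(replicate 4 0)[j := 1]"]) (simp add: in_keys_iff)
qed

context z4_model
begin

abbreviation "G \<equiv> ec_group 3 E (proj ptO)"

lemma point_eqI:
  assumes "R \<in> E" "R' \<in> E" "Pr (frag_of R - frag_of R')"
  shows "R = R'"
proof -
  from assms(1) obtain r where r: "r \<in> N" "R = proj r" by (rule E_cases)
  from assms(2) obtain r' where r': "r' \<in> N" "R' = proj r'" by (rule E_cases)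
  from point_class_unique[OF r(1) r'(1)] assms(3) r r' show ?thesis by simp
qed

text \<open>The chord construction: the plane through P, Q and S meets the curve again in W, and the
  plane through W, O and S meets it again in R. Comparing the two sections cancels W and S.\<close>

lemma sum_exists:
  assumes "P \<in> E" "Q \<in> E"
  shows "\<exists>R\<in>E. Pr (frag_of P + frag_of Q - (frag_of R + fr ptO))"
proof -
  from assms(1) obtain p where p: "p \<in> N" "P = proj p" by (rule E_cases)
  from assms(2) obtain q where q: "q \<in> N" "Q = proj q" by (rule E_cases)
  from plane_through[OF p(1) q(1) N_ptS] obtain L W where L: "nv_form 1 L" "W \<in> E"
    "dv L = fr p + fr q + fr ptS + frag_of W" by blast
  from L(2) obtain w where w: "w \<in> N" "W = proj w" by (rule E_cases)
  from plane_through[OF w(1) N_ptO N_ptS] obtain L' R where L': "nv_form 1 L'" "R \<in> E"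
    "dv L' = fr w + fr ptO + fr ptS + frag_of R" by blast
  have "dv L - dv L' = frag_of P + frag_of Q - (frag_of R + fr ptO)"
    using L(3) L'(3) p q w by simp
  with Pr_diff[OF L(1) L'(1)] L'(2) show ?thesis by metis
qed

text \<open>\<open>ec_add\<close> is a definite description. Existence comes from planes, and
  uniqueness from the fact that distinct points are never linearly equivalent.\<close>

lemma ec_add_iff:
  assumes "P \<in> E" "Q \<in> E" "R \<in> E"
  shows "P \<otimes>\<^bsub>G\<^esub> Q = R \<longleftrightarrow> Pr (frag_of P + frag_of Q - (frag_of R + fr ptO))"
proof -
  let ?A = "\<lambda>R. R \<in> E \<and> Pr (frag_of P + frag_of Q - (frag_of R + fr ptO))"
  have ex: "\<exists>R. ?A R" using sum_exists[OF assms(1,2)] by blast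
  have unif: "R = R'" if "?A R" "?A R'" for R R'
  proof -
    have "(frag_of P + frag_of Q - (frag_of R' + fr ptO)) - (frag_of P + frag_of Q - (frag_of R + fr ptO)) = frag_of R - frag_of R'"
      by simp
    with Pr_sub that have "Pr (frag_of R - frag_of R')" by metis
    with that show ?thesis by (intro point_eqI) auto
  qed
  have "P \<otimes>\<^bsub>G\<^esub> Q = (THE R. ?A R)"
    by (simp add: ec_group_def ec_add_def lin_equiv_def)
  moreover have th: "?A (THE R. ?A R)" by (rule theI'[OF ex_ex1I[OF ex]]) (rule unif)
  moreover have "(THE R. ?A R) = R" if "?A R" by (rule unif[OF th that])
  ultimately show ?thesis using assms(3) by auto
qed

lemma carrier_G [simp]: "carrier G = E" and one_G [simp]: "\<one>\<^bsub>G\<^esub> = proj ptO"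
  by (simp_all add: ec_group_def)

lemma ec_add_closed:
  assumes "P \<in> E" "Q \<in> E"
  shows "P \<otimes>\<^bsub>G\<^esub> Q \<in> E" "Pr (frag_of P + frag_of Q - (frag_of (P \<otimes>\<^bsub>G\<^esub> Q) + fr ptO))"
proof -
  from sum_exists[OF assms] obtain R where R: "R \<in> E" "Pr (frag_of P + frag_of Q - (frag_of R + fr ptO))" by blast
  with ec_add_iff[OF assms R(1)] show "P \<otimes>\<^bsub>G\<^esub> Q \<in> E" "Pr (frag_of P + frag_of Q - (frag_of (P \<otimes>\<^bsub>G\<^esub> Q) + fr ptO))"
    by auto
qed

text \<open>The pencil planes of p and of \<open>ptO\<close> have the divisors O + S + p + rev p and
  O + S + 2 O, which are linearly equivalent.\<close>

lemma conj_class: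
  assumes "p \<in> N"
  shows "Pr (fr p + fr (rev p) - (fr ptO + fr ptO))"
proof -
  from pencil_form[OF assms] obtain L where L: "nv_form 1 L" "dv L = fr ptO + fr ptS + fr p + fr (rev p)" by blast
  from pencil_form[OF N_ptO] obtain L' where L': "nv_form 1 L'" "dv L' = fr ptO + fr ptS + fr ptO + fr (rev ptO)" by blast
  have "dv L - dv L' = fr p + fr (rev p) - (fr ptO + fr ptO)" using L(2) L'(2) by simp
  with Pr_diff[OF L(1) L'(1)] show ?thesis by metis
qed

lemma ec_add_rev: "p \<in> N \<Longrightarrow> proj p \<otimes>\<^bsub>G\<^esub> proj (rev p) = proj ptO"
  using ec_add_iff[of "proj p" "proj (rev p)" "proj ptO"] conj_class by (simp add: rev_N)

lemma comm_group_G: "comm_group G"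
proof (rule comm_groupI)
  fix P Q assume "P \<in> carrier G" "Q \<in> carrier G"
  then show "P \<otimes>\<^bsub>G\<^esub> Q \<in> carrier G" using ec_add_closed by simp
  show "P \<otimes>\<^bsub>G\<^esub> Q = Q \<otimes>\<^bsub>G\<^esub> P" by (simp add: ec_group_def ec_add_def add.commute)
next
  fix P assume P: "P \<in> carrier G"
  then show "\<one>\<^bsub>G\<^esub> \<otimes>\<^bsub>G\<^esub> P = P"
    using ec_add_iff[of "proj ptO" P P] Pr_0 by (simp add: add.commute)
  from P obtain p where p: "p \<in> N" "P = proj p" by (auto elim: E_cases)
  have "proj (rev p) \<otimes>\<^bsub>G\<^esub> P = proj ptO" using ec_add_rev[OF rev_N[OF p(1)]] p by simp
  then show "\<exists>Q\<in>carrier G. Q \<otimes>\<^bsub>G\<^esub> P = \<one>\<^bsub>G\<^esub>" using p rev_N by auto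
next
  fix P Q R assume *: "P \<in> carrier G" "Q \<in> carrier G" "R \<in> carrier G"
  let ?Z = "fr ptO" and ?PQ = "P \<otimes>\<^bsub>G\<^esub> Q" and ?QR = "Q \<otimes>\<^bsub>G\<^esub> R"
  have c: "?PQ \<in> E" "?QR \<in> E" using * ec_add_closed by auto
  have A: "Pr (frag_of P + frag_of Q - (frag_of ?PQ + ?Z))" using * ec_add_closed by simp
  have B: "Pr (frag_of Q + frag_of R - (frag_of ?QR + ?Z))" using * ec_add_closed by simp
  have D: "Pr (frag_of P + frag_of ?QR - (frag_of (P \<otimes>\<^bsub>G\<^esub> ?QR) + ?Z))" using * c ec_add_closed by simp
  have "frag_of ?PQ + frag_of R - (frag_of (P \<otimes>\<^bsub>G\<^esub> ?QR) + ?Z) =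
     (frag_of P + frag_of ?QR - (frag_of (P \<otimes>\<^bsub>G\<^esub> ?QR) + ?Z)) + (frag_of Q + frag_of R - (frag_of ?QR + ?Z))
      - (frag_of P + frag_of Q - (frag_of ?PQ + ?Z))" by simp
  also have "Pr \<dots>" by (intro Pr_sub Pr_add A B D)
  finally show "?PQ \<otimes>\<^bsub>G\<^esub> R = P \<otimes>\<^bsub>G\<^esub> ?QR"
    using ec_add_iff[OF c(1), of R] * c ec_add_closed by simp
qed simp

lemma inv_G:
  assumes "p \<in> N"
  shows "inv\<^bsub>G\<^esub> (proj p) = proj (rev p)"
proof -
  interpret comm_group G by (rule comm_group_G)
  show ?thesis using ec_add_rev[OF rev_N[OF assms]] assms rev_N
    by (intro inv_equality) simp_all
qed

subsection \<open>Sums of hyperplane sections\<close>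

text \<open>The coefficient of the identity is an integer: for n = 0 it is -1 and cancels the point
  O = 0 P.\<close>

lemma pow_class:
  assumes "P \<in> E"
  shows "Pr (frag_cmul (int n) (frag_of P) - (frag_of (P [^]\<^bsub>G\<^esub> n) + frag_cmul (int n - 1) (fr ptO)))"
proof (induction n)
  case 0
  interpret comm_group G by (rule comm_group_G)
  show ?case using Pr_0 by simp
next
  case (Suc n)
  interpret comm_group G by (rule comm_group_G)
  let ?Q = "P [^]\<^bsub>G\<^esub> n"
  have Q: "?Q \<in> E" using nat_pow_closed[of P n] assms by simp
  have "frag_cmul (int (Suc n)) (frag_of P) - (frag_of (P [^]\<^bsub>G\<^esub> Suc n) + frag_cmul (int (Suc n) - 1) (fr ptO)) =
     (frag_cmul (int n) (frag_of P) - (frag_of ?Q + frag_cmul (int n - 1) (fr ptO))) +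
     (frag_of ?Q + frag_of P - (frag_of (?Q \<otimes>\<^bsub>G\<^esub> P) + fr ptO))"
    by (intro poly_mapping_eqI) (simp add: lookup_add lookup_minus algebra_simps)
  also have "Pr \<dots>" by (intro Pr_add Suc ec_add_closed Q assms)
  finally show ?case .
qed

lemma finprod_class:
  assumes "finite A" "A \<subseteq> E"
  shows "finprod G (\<lambda>P. P [^]\<^bsub>G\<^esub> (n P :: nat)) A \<in> E \<and>
    Pr ((\<Sum>P\<in>A. frag_cmul (int (n P)) (frag_of P)) -
      (frag_of (finprod G (\<lambda>P. P [^]\<^bsub>G\<^esub> n P) A) + frag_cmul (int (\<Sum>P\<in>A. n P) - 1) (fr ptO)))"
  using assms
proof (induction A rule: finite_induct)
  case empty
  interpret comm_group G by (rule comm_group_G)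
  show ?case using Pr_0 by (simp add: finprod_empty)
next
  case (insert P A)
  interpret comm_group G by (rule comm_group_G)
  let ?f = "\<lambda>P. P [^]\<^bsub>G\<^esub> n P"
  let ?W = "finprod G ?f A"
  have P: "P \<in> E" "A \<subseteq> E" using insert by auto
  have pc: "Q [^]\<^bsub>G\<^esub> k \<in> E" if "Q \<in> E" for Q and k :: nat using nat_pow_closed[of Q k] that by simp
  have IH: "?W \<in> E" "Pr ((\<Sum>P\<in>A. frag_cmul (int (n P)) (frag_of P)) -
      (frag_of ?W + frag_cmul (int (\<Sum>P\<in>A. n P) - 1) (fr ptO)))" using insert by auto
  have eq: "finprod G ?f (insert P A) = ?f P \<otimes>\<^bsub>G\<^esub> ?W"
    using insert(1,2) P pc by (intro finprod_insert) auto
  have "(\<Sum>P\<in>insert P A. frag_cmul (int (n P)) (frag_of P)) -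
      (frag_of (?f P \<otimes>\<^bsub>G\<^esub> ?W) + frag_cmul (int (\<Sum>P\<in>insert P A. n P) - 1) (fr ptO)) =
     ((\<Sum>P\<in>A. frag_cmul (int (n P)) (frag_of P)) - (frag_of ?W + frag_cmul (int (\<Sum>P\<in>A. n P) - 1) (fr ptO))) +
     (frag_cmul (int (n P)) (frag_of P) - (frag_of (?f P) + frag_cmul (int (n P) - 1) (fr ptO))) +
     (frag_of (?f P) + frag_of ?W - (frag_of (?f P \<otimes>\<^bsub>G\<^esub> ?W) + fr ptO))"
    using insert(1,2) by (intro poly_mapping_eqI) (simp add: lookup_add lookup_minus algebra_simps)
  also have "Pr \<dots>" by (intro Pr_add IH pow_class ec_add_closed P pc)
  finally show ?case unfolding eq using ec_add_closed(1)[OF pc[OF P(1)] IH(1)] by blast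
qed

lemma has_ord_0_nonzero: "p \<in> N \<Longrightarrow> has_ord p f 0 \<Longrightarrow> f p \<noteq> 0"
  using N_subset_C by (fastforce elim!: has_ordE)

lemma keys_dv:
  assumes "nv_form m F"
  shows "Poly_Mapping.keys (dv F) = {P \<in> E. vanishes_at F P}"
proof -
  have "proj p \<in> Poly_Mapping.keys (dv F) \<longleftrightarrow> vanishes_at F (proj p)" if p: "p \<in> N" for p
  proof -
    have fF: "is_form 3 m F" using assms by (simp add: nv_form_def)
    from lookup_dvE[OF assms p] obtain n where n: "has_ord p (meval F) n" "Poly_Mapping.lookup (dv F) (proj p) = int n" .
    have "n = 0 \<longleftrightarrow> meval F p \<noteq> 0"
      using has_ord_0_nonzero[OF p] n(1) has_ord_unique[OF p n(1) has_ord_0[OF form_fun_meval[OF fF]]] by blast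
    with n(2) show ?thesis using vanishes_at_proj[OF fF N_length[OF p]] by (simp add: in_keys_iff)
  qed
  moreover have "Poly_Mapping.keys (dv F) \<subseteq> E" using divisor_on_dv[OF assms] by (simp add: divisor_on_def)
  ultimately show ?thesis by (auto elim!: E_cases)
qed

lemma frag_decomposition: "D = (\<Sum>P\<in>Poly_Mapping.keys D. frag_cmul (Poly_Mapping.lookup D P) (frag_of P))"
  by (rule poly_mapping_eqI) (simp add: lookup_sum lookup_frag_of in_keys_iff if_distrib cong: if_cong)

text \<open>If W is the sum of a section, the section is equivalent to W + 3 O. The plane
  \<open>eta\<close> = 0 cuts out S + 3 O, and all plane sections are equivalent, so W = S by
  uniqueness of points in their classes.\<close>

lemma hyperplane_sections: "hyperplane_sections_sum_to 3 E (proj ptO) (proj ptS)"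
  unfolding hyperplane_sections_sum_to_def
proof (intro allI impI)
  fix L assume "is_form 3 1 L \<and> \<not> vanishes_on L E"
  then have L: "nv_form 1 L" by (simp add: nv_form_iff)
  let ?A = "{P \<in> E. vanishes_at L P}" and ?o = "\<lambda>P. ord_form 3 E P L"
  let ?W = "finprod G (\<lambda>P. P [^]\<^bsub>G\<^esub> ?o P) ?A"
  have lk: "Poly_Mapping.lookup (dv L) P = int (?o P)" if "P \<in> ?A" for P
    using that lookup_dv[OF L] by simp
  have A: "finite ?A" "?A \<subseteq> E" using finite_keys[of "dv L"] unfolding keys_dv[OF L] by auto
  have 1: "(\<Sum>P\<in>?A. frag_cmul (int (?o P)) (frag_of P)) = dv L"
    by (subst (3) frag_decomposition, subst keys_dv[OF L], rule sum.cong) (use lk in auto)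
  have "int (\<Sum>P\<in>?A. ?o P) = (\<Sum>P\<in>?A. Poly_Mapping.lookup (dv L) P)" by (simp add: lk)
  also have "\<dots> = 4" using degree_linear[OF L] unfolding div_degree_def keys_dv[OF L] .
  finally have 2: "int (\<Sum>P\<in>?A. ?o P) = 4" .
  from finprod_class[OF A, of ?o] have W: "?W \<in> E" "Pr (dv L - (frag_of ?W + frag_cmul 3 (fr ptO)))"
    unfolding 1 2 by simp_all
  from pencil_form[OF N_ptO] obtain L' where L': "nv_form 1 L'" "dv L' = fr ptO + fr ptS + fr ptO + fr (rev ptO)" by blast
  have "fr ptS - frag_of ?W = (dv L - (frag_of ?W + frag_cmul 3 (fr ptO))) - (dv L - dv L')"
    unfolding L'(2) by (intro poly_mapping_eqI) (simp add: lookup_add lookup_minus)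
  also have "Pr \<dots>" by (intro Pr_sub W Pr_diff[OF L L'(1)])
  finally have "proj ptS = ?W" by (rule point_eqI[OF proj_in_E[OF N_ptS] W(1)])
  then show "?W = proj ptS" by (rule sym)
qed

lemma embedding: "embedded_by_complete_linear_system 3 E (3 + 1)"
  unfolding embedded_by_complete_linear_system_def
proof (intro conjI allI impI)
  fix L :: "'a mpol" assume L: "is_form 3 1 L \<and> L \<noteq> 0"
  from form_fun_meval[of 1 L] L obtain a b d e where a: "\<And>x. length x = 4 \<Longrightarrow> meval L x = a * x!0 + b * x!1 + d * x!2 + e * x!3"
    unfolding form_fun_1_iff by blast
  from linear_form_nonzero[of L] L obtain x where "length x = 4" "meval L x \<noteq> 0" by blast
  with a have "\<not> (a = 0 \<and> b = 0 \<and> d = 0 \<and> e = 0)" by auto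
  from linear_form_nz[OF this] have "nonvanishing (meval L)" using a C_length by (auto simp: nonvanishing_def)
  then show "\<not> vanishes_on L E" by (simp add: vanishes_on_E)
next
  fix L :: "'a mpol" assume "is_form 3 1 L \<and> \<not> vanishes_on L E"
  then have L: "nv_form 1 L" by (simp add: nv_form_iff)
  show "div_degree (dv L) = int (3 + 1)" using degree_linear[OF L] by simp
  fix D assume "divisor_on E D \<and> effective D \<and> lin_equiv 3 E D (dv L)"
  then show "\<exists>L'. is_form 3 1 L' \<and> \<not> vanishes_on L' E \<and> D = dv L'"
    using linear_system_complete[OF L, of D] unfolding lin_equiv_def nv_form_iff by metis
qed

subsection \<open>Translation by the point of order four\<close>

definition rho :: "'a list \<Rightarrow> 'a list" where "rho x = [x!3, x!0, x!1, x!2]"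

lemma rho_C:
  assumes "x \<in> C"
  shows "rho x \<in> C"
proof -
  obtain x0 x1 x2 x3 where x: "x = [x0, x1, x2, x3]" using C_length[OF assms] by (metis list4_cases)
  from assms C_rel(1)[OF assms] show ?thesis
    by (simp add: z4_cone_def rho_def x add_ac mult_ac) auto
qed

declare on_curve_1_0 [simp] on_curve_1_1 [simp]

lemma N_T [simp]: "pt 1 0 \<in> N" "pt 1 1 \<in> N"
  using on_curve_1_0 on_curve_1_1 by simp_all

lemma has_ord_pos: "p \<in> N \<Longrightarrow> has_ord p f n \<Longrightarrow> f p = 0 \<Longrightarrow> n > 0"
  using has_ord_0_nonzero by (cases n) auto

lemma has_ord_zero: "p \<in> N \<Longrightarrow> has_ord p f n \<Longrightarrow> form_fun m f \<Longrightarrow> f p \<noteq> 0 \<Longrightarrow> n = 0"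
  using has_ord_unique has_ord_0 by blast

text \<open>The conjugate of x3 is x0, and \<open>C_rel\<close> gives c eta x0 x3 = xi (xi + eta)^2.
  As xi + eta is the pencil plane of T = \<open>pt 1 0\<close>, the orders of x0 x3 are known; it
  remains to divide them between x3 and x0.\<close>

lemma x3_form:
  obtains L where "nv_form 1 L" "dv L = fr ptS + fr ptS + fr (pt 1 0) + fr (pt 1 0)"
proof -
  let ?f = "\<lambda>x::'a list. x!3"
  have f: "form_fun 1 ?f" by (rule form_fun_nth) simp
  have nonvanishing: "nonvanishing ?f" by (rule nonvanishingI[of ptO]) (auto simp: ptO_def[symmetric] N_subset_C, simp add: ptO_def)
  from form_fun_obtain_nv_form[OF f nonvanishing] obtain L where L: "nv_form 1 L" "\<And>x. length x = 4 \<Longrightarrow> ?f x = meval L x" by blast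
  have odL: "has_ord p ?f n \<Longrightarrow> has_ord p (meval L) n" for p n by (rule has_ord_meval_cong[OF L(2)])
  have "dv L = fr ptS + fr ptS + fr (pt 1 0) + fr (pt 1 0)"
  proof (rule divisor_eqI)
    fix p assume p: "p \<in> N"
    from has_ord_exists[OF f nonvanishing] p obtain i where i: "has_ord p ?f i" by blast
    from has_ord_exists[OF f nonvanishing] rev_N[OF p] obtain j where j: "has_ord (rev p) ?f j" by blast
    have "has_ord p (\<lambda>x. ?f (rev x)) j" using has_ord_rev[OF j rev_N[OF p]] by simp
    then have 1: "has_ord p (\<lambda>x. c * (pencil ptO x * (?f x * ?f (rev x))))
      ((of_bool (p = ptO) + of_bool (p = ptS) + of_bool (p = ptO) + of_bool (p = rev ptO)) + (i + j))"
      by (intro has_ord_scale has_ord_mult has_ord_pencil p N_ptO i c_nz)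
    have "has_ord p (\<lambda>x. pencil ptS x * (pencil (pt 1 0) x) ^ 2)
      ((of_bool (p = ptO) + of_bool (p = ptS) + of_bool (p = ptS) + of_bool (p = rev ptS)) +
       2 * (of_bool (p = ptO) + of_bool (p = ptS) + of_bool (p = pt 1 0) + of_bool (p = rev (pt 1 0))))"
      by (intro has_ord_mult has_ord_power has_ord_pencil p N_ptS N_T)
    then have 2: "has_ord p (\<lambda>x. c * (pencil ptO x * (?f x * ?f (rev x))))
      ((of_bool (p = ptO) + of_bool (p = ptS) + of_bool (p = ptS) + of_bool (p = rev ptS)) +
       2 * (of_bool (p = ptO) + of_bool (p = ptS) + of_bool (p = pt 1 0) + of_bool (p = rev (pt 1 0))))"
    proof (rule has_ord_eq)
      fix x assume x: "x \<in> C"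
      show "pencil ptS x * (pencil (pt 1 0) x)\<^sup>2 = c * (pencil ptO x * (?f x * ?f (rev x)))"
        using C_rel(5)[OF x] C_length[OF x]
        by (simp add: pencil_def rev_nth minus_is_plus add.commute mult_ac)
    qed
    from has_ord_unique[OF p 1 2] have sum: "i + j = 4 * of_bool (p = ptS) + 2 * of_bool (p = pt 1 0) + 2 * of_bool (p = pt 1 1)"
      by (auto simp: of_bool_def split: if_splits)
    \<comment> \<open>The point \<open>ptS\<close> is its own conjugate, so its share is halved. At
      T the whole share belongs to x3, since x3 does not vanish at the conjugate of T.\<close>
    have "i = 2 * of_bool (p = ptS) + 2 * of_bool (p = pt 1 0)"
    proof (cases "p = ptS")
      case True
      then have "i = j" using has_ord_unique[OF p i] j by simp
      with True sum show ?thesis by simp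
    next
      case nS: False
      show ?thesis
      proof (cases "p = pt 1 0")
        case True
        have "j = 0" by (rule has_ord_zero[OF rev_N[OF p] j f]) (simp add: True)
        with True sum show ?thesis by simp
      next
        case False
        show ?thesis
        proof (cases "p = pt 1 1")
          case True
          have "i = 0" by (rule has_ord_zero[OF p i f]) (simp add: True)
          with True show ?thesis by simp
        qed (use sum nS False in simp)
      qed
    qed
    then show "Poly_Mapping.lookup (dv L) (proj p) = Poly_Mapping.lookup (fr ptS + fr ptS + fr (pt 1 0) + fr (pt 1 0)) (proj p)"
      using lookup_dv_N[OF L(1) p odL[OF i]] by (simp add: lookup_add lookup_frag_N p)
  qed (intro divisor_on_add divisor_on_frag_of divisor_on_dv[OF L(1)] proj_in_E N_ptS N_T)+
  with L(1) show ?thesis by (rule that)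
qed

lemma double_S: "Pr (fr ptS + fr ptS - (fr ptO + fr ptO))"
  using conj_class[OF N_ptS] by simp

text \<open>Comparing the sections x3 = 0 and \<open>eta\<close> = 0 gives 2 T + S equivalent to 3
  O; subtracting the relation 2 S equivalent to 2 O leaves 2 T equivalent to S + O.\<close>

lemma double_T: "Pr (fr (pt 1 0) + fr (pt 1 0) - (fr ptS + fr ptO))"
proof -
  from x3_form obtain L where L: "nv_form 1 L" "dv L = fr ptS + fr ptS + fr (pt 1 0) + fr (pt 1 0)" by blast
  from pencil_form[OF N_ptO] obtain L' where L': "nv_form 1 L'" "dv L' = fr ptO + fr ptS + fr ptO + fr (rev ptO)" by blast
  have "fr (pt 1 0) + fr (pt 1 0) - (fr ptS + fr ptO) = (dv L - dv L') - (fr ptS + fr ptS - (fr ptO + fr ptO))"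
    unfolding L(2) L'(2) by simp
  also have "Pr \<dots>" by (intro Pr_sub Pr_diff[OF L(1) L'(1)] double_S)
  finally show ?thesis .
qed

text \<open>The plane through \<open>ptO\<close>, \<open>T\<close>, \<open>[-1] p\<close> and \<open>rho p\<close>; its divisor is read off
  from the norm of the linear form.\<close>

lemma translation_plane:
  assumes on_curve: "on_curve u y" and u1: "u \<noteq> 1"
  defines "r \<equiv> pt ((y + 1) / y) (u / (1 + u))"
  shows "r \<in> N" "proj r = proj (rho (pt u y))"
    "\<exists>L. nv_form 1 L \<and> dv L = fr ptO + fr (pt 1 0) + fr (rev (pt u y)) + fr r"
proof -
  let ?p = "pt u y"
  have p: "?p \<in> N" using on_curve by simp
  have u0: "u \<noteq> 0" using on_curve on_curve_nz by blast
  have u1': "1 + u \<noteq> 0" using u1 by (simp add: add_eq_0_char2)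
  have cv': "c * u * (y\<^sup>2 + y) = (1 + u)\<^sup>2" using on_curve by (simp add: on_curve_def)
  have y: "y \<noteq> 0" "y + 1 \<noteq> 0"
    using cv' u1' by (auto simp: power2_eq_square add_eq_0_char2)
  have y1: "y \<noteq> 1" using y(2) by auto
  \<comment> \<open>The value of \<open>xi\<close> at \<open>rho (pt u y)\<close> is y + u y.
    Dividing by it yields the affine coordinates of r.\<close>
  have rho: "rho ?p = map ((*) (y * (1 + u))) r"
  proof -
    have "u / (1 + u) + 1 = 1 / (1 + u)" using u1' by (simp add: field_simps)
    then show ?thesis using u1' y by (simp add: r_def pt_def rho_def)
  qed
  have t: "y * (1 + u) \<noteq> 0" using y u1' by simp
  show pr: "proj r = proj (rho ?p)" unfolding rho using proj_scaled[OF t] by simp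
  have "rho ?p \<in> C" by (intro rho_C N_subset_C p)
  then have "r \<in> C" using pr C_iff_E by metis
  moreover have "xi r = 1" by (simp add: r_def)
  ultimately show r: "r \<in> N" using C_affine[of r] by (metis N_pt)
  \<comment> \<open>Vanishing at \<open>ptO\<close> and at T = (1 : 1 : 0 : 0) makes the
    coefficients of x0, x1 and x3 equal. Vanishing at (y, u y, u (y + 1), y + 1) then fixes their
    ratio to the coefficient of x2.\<close>
  let ?f = "\<lambda>x::'a list. u * (y + 1) * (x!0 + x!1 + x!3) + (1 + u * y) * x!2"
  have f: "form_fun 1 ?f" by (intro form_fun_add form_fun_scale form_fun_nth) auto
  have fv: "?f ptO = 0" "?f ptS = 1 + u" "?f (pt 1 0) = 0" "?f (pt 1 1) = 1 + u"
    "?f ?p = u * (1 + u)" "?f (rev ?p) = 0"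
    by (simp_all add: ptO_def ptS_def pt_def algebra_simps)
  have fs: "?f (map ((*) t) x) = t * ?f x" if "length x = 4" for t x
    using that by (simp add: algebra_simps)
  have "y * (1 + u) * ?f r = ?f (rho ?p)" unfolding rho by (rule fs[symmetric]) (simp add: r_def pt_def)
  also have "\<dots> = 0" by (simp add: rho_def pt_def algebra_simps)
  finally have fr: "?f r = 0" using t by simp
  have "y * (1 + u) * ?f (rev r) = ?f (rev (rho ?p))"
    unfolding rho rev_map by (rule fs[symmetric]) (simp add: r_def pt_def)
  also have "\<dots> = (y + 1) * (1 + u)\<^sup>2" by (simp add: rho_def pt_def square_add) (simp add: power2_eq_square algebra_simps)
  finally have frr: "?f (rev r) \<noteq> 0" using y u1' by auto
  have npts: "x \<noteq> pt 1 1 \<and> x \<noteq> ?p \<and> x \<noteq> rev r" if fx: "?f x = 0" for x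
  proof (intro conjI notI)
    assume "x = pt 1 1"
    with fx have "1 + u = 0" by (simp only: fv(4))
    with u1' show False ..
  next
    assume "x = ?p"
    with fx have "u * (1 + u) = 0" by (simp only: fv(5))
    with u0 u1' show False by simp
  next
    assume "x = rev r"
    with fx frr show False by (simp only:)
  qed
  have nonvanishing: "nonvanishing ?f" using fv(5) u0 u1' N_subset_C[OF p] by (intro nonvanishingI[of ?p]) simp_all
  define \<kappa> where "\<kappa> = u * (y + 1) * y"
  have \<kappa>: "\<kappa> \<noteq> 0" using u0 y by (simp add: \<kappa>_def)
  have norm: "pencil ptS x * (?f x * ?f (rev x)) = \<kappa> * (pencil (pt 1 0) x * pencil ?p x * pencil r x)" if "x \<in> C" for x
  proof (rule form_fun_eq_if_affine_eq[OF _ _ _ that])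
    show "form_fun (1 + (1 + 1)) (\<lambda>x. pencil ptS x * (?f x * ?f (rev x)))" by (intro form_fun_mult form_fun_rev form_fun_pencil f)
    have "form_fun (1 + 1 + 1) (\<lambda>x. \<kappa> * (pencil (pt 1 0) x * pencil ?p x * pencil r x))" by (intro form_fun_mult form_fun_scale form_fun_pencil)
    then show "form_fun (1 + (1 + 1)) (\<lambda>x. \<kappa> * (pencil (pt 1 0) x * pencil ?p x * pencil r x))" by simp
    fix x assume x: "x \<in> C" "xi x = 1"
    note a = affine_coords[OF x]
    define U Y where "U = eta x" and "Y = x!3"
    have rx: "rev x ! 3 = Y + 1" "rev x ! 0 = Y" "rev x ! 1 = U * Y" "rev x ! 2 = U * (Y + 1)"
      using C_length[OF x(1)] a by (simp_all add: rev_nth numeral_eq_Suc U_def Y_def)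
    have f1: "?f x = u * (y + 1) * (1 + U) + (1 + u) * U * Y"
      using a by (simp add: U_def[symmetric] Y_def[symmetric]) (simp add: algebra_simps)
    have f2: "?f (rev x) = u * (y + 1) * (1 + U) + (1 + u) * U * (Y + 1)"
      unfolding rx by (simp add: algebra_simps)
    let ?A = "u * (y + 1) * (1 + U)" and ?B = "(1 + u) * U"
    have YY: "c * U * Y\<^sup>2 + c * U * Y = (1 + U)\<^sup>2"
      using a(5) by (simp add: U_def Y_def) 
    have "c * U * (?f x * ?f (rev x)) = c * U * (?A * (?A + ?B)) + ?B\<^sup>2 * (c * U * Y\<^sup>2 + c * U * Y)"
      unfolding f1 f2 by (simp only: power2_eq_square) (simp add: algebra_simps)
    also have "\<dots> = c * U * (?A * (?A + ?B)) + (1 + u)\<^sup>2 * U\<^sup>2 * (1 + U)\<^sup>2"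
      unfolding YY by (simp add: power_mult_distrib)
    \<comment> \<open>Rewriting (1 + u)^2 by the curve equation for p exposes the common factor c U
      u (y + 1) (1 + U). What is left splits into linear factors with roots at the u-coordinates of
      p and r; the factor 1 + U belongs to T.\<close>
    also have "\<dots> = c * U * (u * (y + 1) * (1 + U)) * (u * (y + 1) * (1 + U) + (1 + u) * U + y * U * (1 + U))"
      unfolding cv'[symmetric] by (simp only: power2_eq_square) (simp add: algebra_simps)
    also have "u * (y + 1) * (1 + U) + (1 + u) * U + y * U * (1 + U) = (U + u) * (y * U + (y + 1))"
      by (simp add: algebra_simps)
    also have "y * U + (y + 1) = y * (U + (y + 1) / y)" using y(1) by (simp add: field_simps)
    finally have "c * U * (?f x * ?f (rev x)) = c * U * (\<kappa> * ((U + 1) * (U + u) * (U + (y + 1) / y)))"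
      by (simp add: \<kappa>_def mult_ac add.commute[of 1 U])
    moreover have "c * U \<noteq> 0" using c_nz a(4) by (simp add: U_def)
    ultimately have "?f x * ?f (rev x) = \<kappa> * ((U + 1) * (U + u) * (U + (y + 1) / y))" by simp
    then show "pencil ptS x * (?f x * ?f (rev x)) = \<kappa> * (pencil (pt 1 0) x * pencil ?p x * pencil r x)"
      using x(2) by (simp add: pencil_def r_def minus_is_plus U_def)
  qed
  from form_fun_obtain_nv_form[OF f nonvanishing] obtain L where L: "nv_form 1 L" "\<And>x. length x = 4 \<Longrightarrow> ?f x = meval L x" by blast
  have odL: "has_ord p ?f n \<Longrightarrow> has_ord p (meval L) n" for p n by (rule has_ord_meval_cong[OF L(2)])
  have "dv L = fr ptO + fr (pt 1 0) + fr (rev ?p) + fr r"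
  proof (rule divisor_eqI)
    fix q assume q: "q \<in> N"
    from has_ord_exists[OF f nonvanishing] q obtain i where i: "has_ord q ?f i" by blast
    from has_ord_exists[OF f nonvanishing] rev_N[OF q] obtain j where j: "has_ord (rev q) ?f j" by blast
    have "has_ord q (\<lambda>x. ?f (rev x)) j" using has_ord_rev[OF j rev_N[OF q]] by simp
    then have 1: "has_ord q (\<lambda>x. pencil ptS x * (?f x * ?f (rev x)))
      ((of_bool (q = ptO) + of_bool (q = ptS) + of_bool (q = ptS) + of_bool (q = rev ptS)) + (i + j))"
      by (intro has_ord_mult has_ord_pencil q N_ptS i)
    have "has_ord q (\<lambda>x. \<kappa> * (pencil (pt 1 0) x * pencil ?p x * pencil r x))
      ((of_bool (q = ptO) + of_bool (q = ptS) + of_bool (q = pt 1 0) + of_bool (q = rev (pt 1 0))) +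
       (of_bool (q = ptO) + of_bool (q = ptS) + of_bool (q = ?p) + of_bool (q = rev ?p)) +
       (of_bool (q = ptO) + of_bool (q = ptS) + of_bool (q = r) + of_bool (q = rev r)))"
      by (intro has_ord_scale has_ord_mult has_ord_pencil q N_T p r \<kappa>)
    then have 2: "has_ord q (\<lambda>x. pencil ptS x * (?f x * ?f (rev x)))
      ((of_bool (q = ptO) + of_bool (q = ptS) + of_bool (q = pt 1 0) + of_bool (q = rev (pt 1 0))) +
       (of_bool (q = ptO) + of_bool (q = ptS) + of_bool (q = ?p) + of_bool (q = rev ?p)) +
       (of_bool (q = ptO) + of_bool (q = ptS) + of_bool (q = r) + of_bool (q = rev r)))"
      by (rule has_ord_eq) (erule norm[symmetric])
    have sum: "i + j = 2 * of_bool (q = ptO) + of_bool (q = pt 1 0) + of_bool (q = pt 1 1) + of_bool (q = ?p) +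
       of_bool (q = rev ?p) + of_bool (q = r) + of_bool (q = rev r)"
      using has_ord_unique[OF q 1 2] by simp
    \<comment> \<open>The norm determines only the sum of the orders at q and at its conjugate. At
      \<open>ptO\<close>, which is its own conjugate, the sum is halved. Elsewhere it is decided by
      the fact that the form vanishes at T, \<open>rev ?p\<close> and r but at none of their
      conjugates.\<close>
    have "i = of_bool (q = ptO) + of_bool (q = pt 1 0) + of_bool (q = rev ?p) + of_bool (q = r)"
    proof (cases "q = ptO")
      case True
      then have "i = j" using has_ord_unique[OF q i] j by simp
      with True sum show ?thesis by (simp add: r_def)
    next
      case nO: False
      show ?thesis
      proof (cases "?f q = 0")
        case False
        then have "i = 0" by (rule has_ord_zero[OF q i f])
        moreover have "q \<noteq> pt 1 0" "q \<noteq> rev ?p" "q \<noteq> r" using False fv fr by metis+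
        ultimately show ?thesis using nO by simp
      next
        case fq: True
        have a: "q \<noteq> pt 1 1" "q \<noteq> ?p" "q \<noteq> rev r" using npts[OF fq] by blast+
        show ?thesis
        proof (cases "?f (rev q) = 0")
          case False
          then have "j = 0" by (rule has_ord_zero[OF rev_N[OF q] j f])
          with sum a nO show ?thesis by simp
        next
          case True
          have b: "rev q \<noteq> pt 1 1" "rev q \<noteq> ?p" "rev q \<noteq> rev r" using npts[OF True] by blast+
          then have "q \<noteq> pt 1 0" "q \<noteq> rev ?p" "q \<noteq> r" by auto
          with sum a nO have "i = 0" by simp
          with has_ord_pos[OF q i fq] show ?thesis by simp
        qed
      qed
    qed
    then show "Poly_Mapping.lookup (dv L) (proj q) =
        Poly_Mapping.lookup (frag_of (proj ptO) + frag_of (proj (pt 1 0)) + frag_of (proj (rev ?p)) + frag_of (proj r)) (proj q)"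
      using lookup_dv_N[OF L(1) q odL[OF i]] by (simp add: lookup_add lookup_frag_N q r on_curve rev_N del: rev_pts(3))
  qed (intro divisor_on_add divisor_on_frag_of divisor_on_dv[OF L(1)] proj_in_E N_ptO N_T rev_N p r)+
  with L(1) show "\<exists>L. nv_form 1 L \<and> dv L = frag_of (proj ptO) + frag_of (proj (pt 1 0)) + frag_of (proj (rev ?p)) + frag_of (proj r)" by blast
qed

text \<open>The plane of \<open>translation_plane\<close> requires an affine point with u different
  from 1. The remaining points are O, S, T and the conjugate of T, that is, the multiples of T, for
  which the relations 2 T = S and 2 S = O suffice.\<close>

lemma translation_N:
  assumes "p \<in> N"
  shows "proj p \<otimes>\<^bsub>G\<^esub> proj (pt 1 0) = proj (rho p)"
proof -
  interpret comm_group G by (rule comm_group_G)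
  have T1: "rev (pt 1 0) = (pt 1 1 :: 'a list)" by simp
  from assms show ?thesis
  proof (cases p rule: N_cases)
    case 1
    have "rho ptO = pt 1 0" by (simp add: rho_def ptO_def pt_def)
    moreover have "proj (pt 1 0) \<in> carrier G" by simp
    from l_one[OF this] have "proj ptO \<otimes>\<^bsub>G\<^esub> proj (pt 1 0) = proj (pt 1 0)" unfolding one_G .
    ultimately show ?thesis using 1 by simp
  next
    case 2
    have rho: "rho ptS = pt 1 1" by (simp add: rho_def ptS_def pt_def)
    have "(fr ptS :: 'a pdivisor) + fr (pt 1 0) - (fr (pt 1 1) + fr ptO) = (fr ptS + fr ptS - (fr ptO + fr ptO)) +
       (fr (pt 1 0) + fr (pt 1 0) - (fr ptS + fr ptO)) - (fr (pt 1 0) + fr (rev (pt 1 0)) - (fr ptO + fr ptO))"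
      unfolding T1 by simp
    also have "Pr \<dots>" by (intro Pr_sub Pr_add double_S double_T conj_class N_T)
    finally show ?thesis using 2 rho ec_add_iff[of "proj ptS" "proj (pt 1 0)" "proj (pt 1 1)"] by simp
  next
    case (3 u y)
    show ?thesis
    proof (cases "u = 1")
      case True
      with 3 have "y = 0 \<or> y = 1" using on_curve_same_u[OF on_curve_1_0] by force
      then show ?thesis
      proof
        assume "y = 0"
        moreover have "rho (pt 1 0) = ptS" by (simp add: rho_def ptS_def pt_def)
        ultimately show ?thesis
          using 3 True double_T ec_add_iff[of "proj (pt 1 0)" "proj (pt 1 0)" "proj ptS"] by simp
      next
        assume "y = 1"
        moreover have "rho (pt 1 1) = ptO" by (simp add: rho_def ptO_def pt_def)
        ultimately show ?thesis using 3 True ec_add_rev[of "pt 1 1"] by simp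
      qed
    next
      case False
      note * = translation_plane[OF 3(2) False]
      define r where "r = pt ((y + 1) / y) (u / (1 + u))"
      from * obtain L where r: "r \<in> N" "proj r = proj (rho p)"
        and L: "nv_form 1 L" "dv L = fr ptO + fr (pt 1 0) + fr (rev p) + fr r"
        unfolding r_def 3(1) by blast
      from pencil_form[OF N_ptO] obtain L' where L': "nv_form 1 L'" "dv L' = fr ptO + fr ptS + fr ptO + fr (rev ptO)" by blast
      have "fr p + fr (pt 1 0) - (fr r + fr ptO) = (fr p + fr (rev p) - (fr ptO + fr ptO)) - (dv L - dv L') +
        (fr (pt 1 0) + fr (pt 1 0) - (fr ptS + fr ptO))"
        unfolding L(2) L'(2) by simp
      also have "Pr \<dots>" by (intro Pr_sub Pr_add double_T conj_class Pr_diff[OF L(1) L'(1)] assms)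
      finally show ?thesis using assms ec_add_iff[of "proj p" "proj (pt 1 0)" "proj r"] proj_in_E[OF r(1)]
        unfolding r(2) by simp
    qed
  qed
qed

lemma translation:
  assumes "x \<in> C"
  shows "proj x \<otimes>\<^bsub>G\<^esub> proj (pt 1 0) = proj (rho x)"
proof -
  from assms obtain t p where tp: "t \<noteq> 0" "p \<in> N" "x = map ((*) t) p" by (rule C_cases)
  have "rho x = map ((*) t) (rho p)" using N_length[OF tp(2)] tp(3) by (simp add: rho_def)
  with translation_N[OF tp(2)] tp show ?thesis by (simp add: proj_scaled)
qed

lemma inversion:
  assumes "x \<in> C"
  shows "inv\<^bsub>G\<^esub> (proj x) = proj (rev x)"
proof -
  from assms obtain t p where tp: "t \<noteq> 0" "p \<in> N" "x = map ((*) t) p" by (rule C_cases)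
  with inv_G[OF tp(2)] show ?thesis by (simp add: proj_scaled rev_map)
qed

lemma double_T_eq: "proj (pt 1 0) [^]\<^bsub>G\<^esub> (2::nat) = proj ptS"
proof -
  interpret comm_group G by (rule comm_group_G)
  let ?T = "proj (pt 1 0) :: 'a ppoint"
  have "?T [^]\<^bsub>G\<^esub> (Suc 1) = ?T \<otimes>\<^bsub>G\<^esub> ?T"
    using translation_N[OF N_ptO] by (simp add: rho_def) (simp add: ptO_def pt_def)
  also have "\<dots> = proj ptS" using translation_N[OF N_T(1)] by (simp add: rho_def ptS_def pt_def)
  finally show ?thesis by (simp only: numeral_2_eq_2 One_nat_def)
qed

lemma order_T: "group.ord G (proj (pt 1 0)) = 4"
proof -
  interpret comm_group G by (rule comm_group_G)
  let ?T = "proj (pt 1 0) :: 'a ppoint"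
  have T: "?T \<in> carrier G" by simp
  have p2: "?T [^]\<^bsub>G\<^esub> (2::nat) = proj ptS"
    by (rule double_T_eq)
  have "?T [^]\<^bsub>G\<^esub> Suc 2 = proj (pt 1 1)"
    unfolding nat_pow_Suc p2 translation_N[OF N_ptS] by (simp add: rho_def ptS_def pt_def)
  moreover have "Suc 2 = (3::nat)" by simp
  ultimately have p3: "?T [^]\<^bsub>G\<^esub> (3::nat) = proj (pt 1 1)" by metis
  have four: "(4::nat) = Suc 3" by simp
  have p4: "?T [^]\<^bsub>G\<^esub> (4::nat) = \<one>\<^bsub>G\<^esub>"
    unfolding four nat_pow_Suc p3 one_G translation_N[OF N_T(2)] by (simp add: rho_def ptO_def pt_def)
  have d4: "ord ?T dvd 4" using p4 pow_eq_id[OF T] by blast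
  have d2: "\<not> ord ?T dvd 2" using pow_eq_id[OF T, of 2] p2 by (simp add: proj_inj_N)
  from d4 have "ord ?T \<le> 4" by (rule dvd_imp_le) simp
  moreover from d4 have "ord ?T \<noteq> 0" by (metis dvd_0_left zero_neq_numeral)
  ultimately have "ord ?T = 1 \<or> ord ?T = 2 \<or> ord ?T = 3 \<or> ord ?T = 4" by linarith
  with d2 d4 show ?thesis by (elim disjE) simp_all
qed

end

section \<open>From the curve to its cone, and the degenerate case c = 0\<close>

lemma mem_proj_space: "proj x \<in> proj_space r \<longleftrightarrow> length x = r + 1 \<and> (\<exists>a\<in>set x. a \<noteq> 0)"
proof
  assume "proj x \<in> proj_space r"
  then obtain y where y: "length y = r + 1" "\<exists>a\<in>set y. a \<noteq> 0" "proj x = proj y"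
    by (auto simp: proj_space_def)
  then have "x \<in> proj y" using proj_refl by metis
  with y show "length x = r + 1 \<and> (\<exists>a\<in>set x. a \<noteq> 0)" by (auto simp: proj_def)
qed (auto simp: proj_space_def)

lemma z4_curve_eq: "z4_curve c = proj ` z4_cone (to_ac c)"
proof -
  let ?S = "{(mvar 0 + mvar 1 + mvar 2 + mvar 3) ^ 2 - mconst c * mvar 0 * mvar 2,
      (mvar 0 + mvar 1 + mvar 2 + mvar 3) ^ 2 - mconst c * mvar 1 * mvar 3}"
  have eval: "(\<forall>F\<in>base_change ` ?S. meval F x = 0) \<longleftrightarrow>
     (x!0 + x!1 + x!2 + x!3)\<^sup>2 = to_ac c * x!0 * x!2 \<and> (x!0 + x!1 + x!2 + x!3)\<^sup>2 = to_ac c * x!1 * x!3"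
    if "length x = 4" for x
    using that by (simp add: nth_default_nth)
  have "proj x \<in> z4_curve c \<longleftrightarrow> x \<in> z4_cone (to_ac c)" for x
  proof
    assume *: "proj x \<in> z4_curve c"
    then have "length x = 4 \<and> (\<exists>a\<in>set x. a \<noteq> 0)"
      by (auto simp: z4_curve_def zero_locus_def mem_proj_space)
    moreover from * have "\<forall>F\<in>base_change ` ?S. meval F x = 0"
      using proj_refl unfolding z4_curve_def zero_locus_def vanishes_at_def by blast
    ultimately show "x \<in> z4_cone (to_ac c)" unfolding z4_cone_def using eval by blast
  next
    assume x: "x \<in> z4_cone (to_ac c)"
    then have "proj x \<in> proj_space 3" by (simp add: z4_cone_def mem_proj_space)
    moreover have "vanishes_at F (proj x)" if "F \<in> base_change ` ?S" for F
      unfolding vanishes_at_def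
    proof
      fix y assume "y \<in> proj x"
      then have "y \<in> z4_cone (to_ac c)" using x z4_cone_scaled by (auto simp: proj_def)
      then show "meval F y = 0" using eval[of y] that unfolding z4_cone_def by blast
    qed
    ultimately show "proj x \<in> z4_curve c" by (simp add: z4_curve_def zero_locus_def)
  qed
  moreover have "P \<in> z4_curve c \<Longrightarrow> \<exists>x. P = proj x" for P
    by (auto simp: z4_curve_def zero_locus_def proj_space_def)
  ultimately show ?thesis by blast
qed

lemma form_fun_on_parametrised_line:
  assumes "form_fun m f"
  shows "\<exists>q. \<forall>t. f [poly p0 t, poly p1 t, poly p2 t, poly p3 t] = poly q t"
  using assms
proof (induction rule: form_fun_induct)
  case (zero m)
  show ?case by (intro exI[of _ 0]) simp
next
  case (const a)
  show ?case by (intro exI[of _ "[:a:]"]) simp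
next
  case (var m f i)
  then obtain q where "\<And>t. f [poly p0 t, poly p1 t, poly p2 t, poly p3 t] = poly q t" by blast
  moreover have "i = 0 \<or> i = 1 \<or> i = 2 \<or> i = 3" using var(1) by linarith
  ultimately show ?case by (intro exI[of _ "[p0, p1, p2, p3] ! i * q"]) auto
next
  case (add m f g)
  then obtain q q' where "\<And>t. f [poly p0 t, poly p1 t, poly p2 t, poly p3 t] = poly q t"
    "\<And>t. g [poly p0 t, poly p1 t, poly p2 t, poly p3 t] = poly q' t" by blast
  then show ?case by (intro exI[of _ "q + q'"]) simp
next
  case (cong m f g)
  then show ?case by simp
qed

text \<open>For \<open>c = 0\<close> the equations define a plane, which contains the line
  \<open>X\<^sub>0 = X\<^sub>1, X\<^sub>2 = X\<^sub>3\<close>.\<close>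

lemma z4_curve_parameter_nonzero:
  fixes c :: "'k::field"
  assumes two: "(2 :: 'k alg_closure) = 0" and curve: "proj_curve 3 (z4_curve c)"
  shows "c \<noteq> 0"
proof
  assume "c = 0"
  have add_self: "x + x = 0" for x :: "'k alg_closure" using two by (metis mult_2 mult_zero_left)
  define A where "A = {[a, a, b, b] | a b :: 'k alg_closure. a \<noteq> 0 \<or> b \<noteq> 0}"
  have scaled: "map ((*) t) x \<in> A" if "x \<in> A" "t \<noteq> 0" for x t using that by (auto simp: A_def)
  have vanish: "vanishes_on F (proj ` A) \<longleftrightarrow> (\<forall>x\<in>A. meval F x = 0)" for F
    by (rule vanishes_on_proj_image[OF scaled])
  let ?S = "{mvar 0 + mvar 1, mvar 2 + mvar 3} :: 'k alg_closure mpol set"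
  have "proj_variety 3 (proj ` A)"
    unfolding proj_variety_def
  proof (intro conjI allI impI)
    have "[1, 1, 0, 0] \<in> A" by (simp add: A_def)
    then show "proj ` A \<noteq> {}" by blast
    have "\<forall>F\<in>?S. \<exists>d. is_form 3 d F" by (auto intro!: exI[of _ 1] is_form_add is_form_mvar simp del: One_nat_def)
    moreover have "proj ` A = zero_locus 3 ?S"
    proof (intro equalityI subsetI)
      fix P assume "P \<in> proj ` A"
      then obtain a b where P: "P = proj [a, a, b, b]" "a \<noteq> 0 \<or> b \<noteq> 0" by (auto simp: A_def)
      then have "P \<in> proj_space 3" by (auto simp: mem_proj_space)
      moreover have "\<forall>F\<in>?S. vanishes_at F P"
        by (auto simp: P(1) vanishes_at_def proj_def nth_default_nth add_self)
      ultimately show "P \<in> zero_locus 3 ?S" by (simp add: zero_locus_def)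
    next
      fix P assume P: "P \<in> zero_locus 3 ?S"
      then obtain x where x: "P = proj x" "length x = 4" "\<exists>a\<in>set x. a \<noteq> 0"
        by (auto simp: zero_locus_def proj_space_def)
      then obtain x0 x1 x2 x3 where x4: "x = [x0, x1, x2, x3]" by (metis list4_cases)
      have "\<forall>F\<in>?S. meval F x = 0" using P x(1) proj_refl[of x] by (auto simp: zero_locus_def vanishes_at_def)
      then have "x0 + x1 = 0" "x2 + x3 = 0" by (simp_all add: x4 nth_default_nth)
      then have "x1 = x0" "x3 = x2" by (metis add_self add_left_cancel)+
      with x x4 show "P \<in> proj ` A" by (auto simp: A_def)
    qed
    ultimately show "\<exists>S. (\<forall>F\<in>S. \<exists>d. is_form 3 d F) \<and> proj ` A = zero_locus 3 S" by blast
  next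
    fix F G :: "'k alg_closure mpol" and d e
    assume *: "is_form 3 d F \<and> is_form 3 e G \<and> vanishes_on (F * G) (proj ` A)"
    have line: "\<exists>q. \<forall>t. meval H [1, 1, t, t] = poly q t" "\<exists>q. \<forall>t. meval H [t, t, 1, 1] = poly q t"
      if "is_form 3 m H" for H :: "'k alg_closure mpol" and m
      using form_fun_on_parametrised_line[OF form_fun_meval[OF that], of 1 1 "[:0, 1:]" "[:0, 1:]"]
        form_fun_on_parametrised_line[OF form_fun_meval[OF that], of "[:0, 1:]" "[:0, 1:]" 1 1] by simp_all
    \<comment> \<open>The parameter t in (1 : 1 : t : t) misses one point of the line. On the other
      chart the form is a polynomial in t with all nonzero t as roots, so it vanishes at the missing
      point too.\<close>
    have zero: "\<forall>x\<in>A. meval H x = 0" if H: "is_form 3 m H" "\<And>t. meval H [1, 1, t, t] = 0" for H :: "'k alg_closure mpol" and m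
    proof -
      have scale: "meval H [s * a, s * a, s * b, s * b] = s ^ m * meval H [a, a, b, b]" for s a b
        using form_fun_scaled[OF form_fun_meval[OF H(1)], of "[a, a, b, b]" s] by simp
      have nonvanishing: "meval H [a, a, b, b] = 0" if "a \<noteq> 0" for a b
        using scale[of a 1 "b / a"] H(2) that by simp
      from line(2)[OF H(1)] obtain q where q: "\<And>t. meval H [t, t, 1, 1] = poly q t" by blast
      have "q = 0" by (rule poly_zero_if_cofinite_roots[of "{0}"]) (use nonvanishing in \<open>auto simp: q[symmetric]\<close>)
      then have "meval H [0, 0, b, b] = 0" for b using scale[of b 0 1] q[of 0] by simp
      with nonvanishing show ?thesis by (auto simp: A_def) metis
    qed
    from line(1) * obtain qF qG where q: "\<And>t. meval F [1, 1, t, t] = poly qF t" "\<And>t. meval G [1, 1, t, t] = poly qG t" by metis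
    have "poly (qF * qG) t = 0" for t
    proof -
      have "[1, 1, t, t] \<in> A" by (simp add: A_def)
      with * have "meval (F * G) [1, 1, t, t] = 0" unfolding vanish by blast
      then show ?thesis by (simp flip: q)
    qed
    then have "qF * qG = 0" by (intro poly_zero_if_cofinite_roots[of "{}"]) auto
    then have "qF = 0 \<or> qG = 0" by simp
    then show "vanishes_on F (proj ` A) \<or> vanishes_on G (proj ` A)"
      unfolding vanish using zero[of d F] zero[of e G] * q by auto
  qed
  moreover have "proj ` A \<subset> z4_curve c"
  proof
    show "proj ` A \<subseteq> z4_curve c"
      unfolding z4_curve_eq \<open>c = 0\<close> by (rule image_mono) (auto simp: A_def z4_cone_def add_self)
    have "proj [1, 0, 1, 0] \<notin> proj ` A"
    proof
      assume "proj [1, 0, 1, 0] \<in> proj ` A"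
      then obtain a b :: "'k alg_closure" where "proj [1, 0, 1, 0] = proj [a, a, b, b]" by (auto simp: A_def)
      then have "[1, 0, 1, 0] \<in> proj [a, a, b, b]" using proj_refl by metis
      then show False by (auto simp: proj_def)
    qed
    moreover have "proj [1, 0, 1, 0] \<in> z4_curve c"
      unfolding z4_curve_eq \<open>c = 0\<close> by (rule imageI) (simp add: z4_cone_def add_self)
    ultimately show "proj ` A \<noteq> z4_curve c" by blast
  qed
  moreover have "\<forall>Z. proj_variety 3 Z \<and> Z \<subset> z4_curve c \<longrightarrow> (\<exists>P. Z = {P})"
    using curve unfolding proj_curve_def by (elim conjE)
  \<comment> \<open>A proper irreducible closed subset of a curve must be a single point, but the
    line contains two.\<close>
  ultimately obtain P where P: "proj ` A = {P}" by metis
  have "proj [1, 1, 0, 0] \<in> proj ` A" "proj [0, 0, 1, 1] \<in> proj ` A"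
    by (rule imageI, simp add: A_def)+
  then have "proj [1, 1, 0, 0] = (proj [0, 0, 1, 1] :: 'k alg_closure ppoint)" unfolding P by simp
  then have "[1, 1, 0, 0] \<in> (proj [0, 0, 1, 1] :: 'k alg_closure ppoint)" using proj_refl by metis
  then show False by (auto simp: proj_def)
qed

section \<open>Factorisation through the product of two lines\<close>

definition pair_nz :: "'a::field \<Rightarrow> 'a \<Rightarrow> bool" where "pair_nz a b \<longleftrightarrow> a \<noteq> 0 \<or> b \<noteq> 0"

text \<open>Points are sets of coordinate vectors, so maps on points are defined through an
  arbitrary representative. Independence of the choice is part of \<open>pr1_proj\<close>,
  \<open>pr2_proj\<close> and \<open>skew_segre_proj\<close>.\<close>

definition some_rep :: "'a ppoint \<Rightarrow> 'a list" where "some_rep P = (SOME x. x \<in> P)"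

definition pr1 :: "'a::field ppoint \<Rightarrow> 'a ppoint" where
  "pr1 P = (let x = some_rep P in if pair_nz (x!0) (x!1) then proj [x!0, x!1] else proj [x!3, x!2])"

definition pr2 :: "'a::field ppoint \<Rightarrow> 'a ppoint" where
  "pr2 P = (let x = some_rep P in if pair_nz (x!0) (x!3) then proj [x!0, x!3] else proj [x!1, x!2])"

definition skew :: "'a::field list \<Rightarrow> 'a list \<Rightarrow> 'a list" where
  "skew u v = [u!0 * v!0, u!1 * v!0, u!1 * v!1, u!0 * v!1]"

definition skew_segre :: "'a::field ppoint \<times> 'a ppoint \<Rightarrow> 'a ppoint" where
  "skew_segre PQ = proj (skew (some_rep (fst PQ)) (some_rep (snd PQ)))"

lemma some_rep_proj:
  obtains t where "t \<noteq> 0" "some_rep (proj x) = map ((*) t) x"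
proof -
  have "some_rep (proj x) \<in> proj x" unfolding some_rep_def using proj_refl by (rule someI)
  with that show ?thesis by (auto simp: proj_def)
qed

lemma proj_pair_scaled: "t \<noteq> 0 \<Longrightarrow> proj [t * a, t * b] = proj [a, b]"
  using proj_scaled[of t "[a, b]"] by simp

lemma proj_pair_eq:
  assumes "a * d = b * c" "pair_nz a b" "pair_nz c d"
  shows "proj [a, b] = proj [c, d]"
proof (cases "a = 0")
  case True
  with assms have "b \<noteq> 0" "c = 0" "d \<noteq> 0" by (auto simp: pair_nz_def)
  then show ?thesis using True proj_pair_scaled[of "b / d" 0 d] by simp
next
  case False
  then have "c \<noteq> 0" using assms by (auto simp: pair_nz_def)
  then have "[a, b] = [a / c * c, a / c * d]" using assms(1) by (simp add: field_simps)
  then show ?thesis using proj_pair_scaled[of "a / c" c d] False \<open>c \<noteq> 0\<close> by simp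
qed

text \<open>The quadric x0 x2 = x1 x3 is the proportionality of (x0, x1) and (x3, x2), so the two
  charts agree wherever both are defined. Read the other way, it gives the same for the second
  projection.\<close>

lemma pr1_proj:
  assumes "length x = 4" "x!0 * x!2 = x!1 * x!3"
  shows "pair_nz (x!0) (x!1) \<Longrightarrow> pr1 (proj x) = proj [x!0, x!1]"
    and "pair_nz (x!3) (x!2) \<Longrightarrow> pr1 (proj x) = proj [x!3, x!2]"
proof -
  obtain t where t: "t \<noteq> 0" "some_rep (proj x) = map ((*) t) x" by (rule some_rep_proj)
  have 1: "pr1 (proj x) = (if pair_nz (x!0) (x!1) then proj [x!0, x!1] else proj [x!3, x!2])"
    using t assms(1) by (simp add: pr1_def pair_nz_def proj_pair_scaled)
  then show "pair_nz (x!0) (x!1) \<Longrightarrow> pr1 (proj x) = proj [x!0, x!1]" by simp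
  show "pair_nz (x!3) (x!2) \<Longrightarrow> pr1 (proj x) = proj [x!3, x!2]"
    using 1 proj_pair_eq[of "x!0" "x!2" "x!1" "x!3"] assms(2) by simp
qed

lemma pr2_proj:
  assumes "length x = 4" "x!0 * x!2 = x!1 * x!3"
  shows "pair_nz (x!0) (x!3) \<Longrightarrow> pr2 (proj x) = proj [x!0, x!3]"
    and "pair_nz (x!1) (x!2) \<Longrightarrow> pr2 (proj x) = proj [x!1, x!2]"
proof -
  obtain t where t: "t \<noteq> 0" "some_rep (proj x) = map ((*) t) x" by (rule some_rep_proj)
  have 1: "pr2 (proj x) = (if pair_nz (x!0) (x!3) then proj [x!0, x!3] else proj [x!1, x!2])"
    using t assms(1) by (simp add: pr2_def pair_nz_def proj_pair_scaled)
  then show "pair_nz (x!0) (x!3) \<Longrightarrow> pr2 (proj x) = proj [x!0, x!3]" by simp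
  show "pair_nz (x!1) (x!2) \<Longrightarrow> pr2 (proj x) = proj [x!1, x!2]"
    using 1 proj_pair_eq[of "x!0" "x!2" "x!3" "x!1"] assms(2) by (simp add: mult.commute)
qed

lemma skew_segre_proj:
  assumes "length u = 2" "length v = 2"
  shows "skew_segre (proj u, proj v) = proj (skew u v)"
proof -
  obtain s where s: "s \<noteq> 0" "some_rep (proj u) = map ((*) s) u" by (rule some_rep_proj)
  obtain t where t: "t \<noteq> 0" "some_rep (proj v) = map ((*) t) v" by (rule some_rep_proj)
  have "skew (map ((*) s) u) (map ((*) t) v) = map ((*) (s * t)) (skew u v)"
    using assms by (simp add: skew_def mult_ac)
  then show ?thesis using s t proj_scaled[of "s * t"] by (simp add: skew_segre_def)
qed

lemma proj_space_1_cases: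
  assumes "P \<in> proj_space 1"
  obtains u where "P = proj u" "length u = 2" "pair_nz (u!0) (u!1)"
proof -
  from assms obtain u where "P = proj u" "length u = 1 + 1" "\<exists>a\<in>set u. a \<noteq> 0"
    unfolding proj_space_def by blast
  then have u: "P = proj u" "length u = 2" "\<exists>a\<in>set u. a \<noteq> 0" by simp_all
  then obtain a b where "u = [a, b]" by (auto simp: numeral_2_eq_2 length_Suc_conv)
  with u show ?thesis by (intro that[of u]) (auto simp: pair_nz_def)
qed

lemma proj_pair_in_proj_space: "pair_nz a b \<Longrightarrow> proj [a, b] \<in> proj_space 1"
  by (auto simp: mem_proj_space pair_nz_def)

text \<open>Under the skew-Segre map the sum of the coordinates factors as (u0 + u1)(v0 + v1), and
  x0 x2 and x1 x3 both become u0 u1 v0 v1. The two equations of E therefore collapse into the single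
  equation of the biquadratic curve.\<close>

lemma z4_biquadratic_iff:
  assumes u: "length u = 2" "pair_nz (u!0) (u!1)" and v: "length v = 2" "pair_nz (v!0) (v!1)"
  shows "(proj u, proj v) \<in> z4_biquadratic_curve c \<longleftrightarrow> skew u v \<in> z4_cone (to_ac c)"
proof -
  let ?F = "base_change ((mvar 0 + mvar 1) ^ 2 * (mvar 2 + mvar 3) ^ 2
        - mconst c * mvar 0 * mvar 1 * mvar 2 * mvar 3)"
  have F: "meval ?F (x @ y) = (x!0 + x!1)\<^sup>2 * (y!0 + y!1)\<^sup>2 - to_ac c * x!0 * x!1 * y!0 * y!1"
    if "length x = 2" "length y = 2" for x y
    using that by (simp add: nth_default_nth nth_append)
  have lists: "u = [u!0, u!1]" "v = [v!0, v!1]"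
    using u(1) v(1) by (auto simp: numeral_2_eq_2 length_Suc_conv)
  have nonvanishing: "\<exists>a\<in>set u. a \<noteq> 0" "\<exists>a\<in>set v. a \<noteq> 0"
    using u v by (subst lists, auto simp: pair_nz_def)+
  let ?eq = "(u!0 + u!1)\<^sup>2 * (v!0 + v!1)\<^sup>2 = to_ac c * u!0 * u!1 * v!0 * v!1"
  have scaled: "meval ?F (map ((*) s) u @ map ((*) t) v) = (s * t)\<^sup>2 * meval ?F (u @ v)" for s t
  proof -
    have "meval ?F (map ((*) s) u @ map ((*) t) v) =
       (s * u!0 + s * u!1)\<^sup>2 * (t * v!0 + t * v!1)\<^sup>2 - to_ac c * (s * u!0) * (s * u!1) * (t * v!0) * (t * v!1)"
      by (subst F) (use u(1) v(1) in simp_all)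
    also have "\<dots> = (s * t)\<^sup>2 * meval ?F (u @ v)"
      by (subst F[OF u(1) v(1)]) (simp add: power2_eq_square algebra_simps)
    finally show ?thesis .
  qed
  have "(proj u, proj v) \<in> z4_biquadratic_curve c \<longleftrightarrow> (\<forall>x\<in>proj u. \<forall>y\<in>proj v. meval ?F (x @ y) = 0)"
    using u v nonvanishing by (simp add: z4_biquadratic_curve_def bi_zero_locus_def mem_proj_space)
  also have "\<dots> \<longleftrightarrow> meval ?F (u @ v) = 0"
  proof
    assume "\<forall>x\<in>proj u. \<forall>y\<in>proj v. meval ?F (x @ y) = 0"
    then show "meval ?F (u @ v) = 0" using proj_refl by blast
  next
    assume "meval ?F (u @ v) = 0"
    then show "\<forall>x\<in>proj u. \<forall>y\<in>proj v. meval ?F (x @ y) = 0" using scaled by (auto simp: proj_def simp del: map_append)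
  qed
  also have "\<dots> \<longleftrightarrow> ?eq" using F[OF u(1) v(1)] by simp
  also have "\<dots> \<longleftrightarrow> skew u v \<in> z4_cone (to_ac c)"
  proof -
    have "skew u v ! 0 + skew u v ! 1 + skew u v ! 2 + skew u v ! 3 = (u!0 + u!1) * (v!0 + v!1)"
      by (simp add: skew_def algebra_simps)
    moreover have "\<exists>a\<in>set (skew u v). a \<noteq> 0" using u v by (auto simp: skew_def pair_nz_def)
    ultimately show ?thesis
      by (simp add: z4_cone_def power_mult_distrib) (simp add: skew_def mult_ac)
  qed
  finally show ?thesis .
qed

lemma z4_cone_quadric:
  assumes "x \<in> z4_cone c" "c \<noteq> 0"
  shows "x!0 * x!2 = x!1 * x!3"
proof -
  let ?s = "(x!0 + x!1 + x!2 + x!3)\<^sup>2"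
  have "?s = c * x!0 * x!2" "?s = c * x!1 * x!3" using assms(1) by (auto simp: z4_cone_def)
  with assms(2) show ?thesis by (simp add: mult.assoc)
qed

text \<open>The scalar k is a nonvanishing coordinate of x. Of the charts for the two projections,
  those containing this coordinate are used, and the quadric shows that their skew-Segre image is k
  x.\<close>

lemma factor_point:
  assumes "length x = 4" "\<exists>a\<in>set x. a \<noteq> 0" and q: "x!0 * x!2 = x!1 * x!3"
  obtains u v k where "length u = 2" "pair_nz (u!0) (u!1)" "length v = 2" "pair_nz (v!0) (v!1)"
    "pr1 (proj x) = proj u" "pr2 (proj x) = proj v" "k \<noteq> 0" "skew u v = map ((*) k) x"
proof -
  obtain x0 x1 x2 x3 where x: "x = [x0, x1, x2, x3]" using assms(1) by (metis list4_cases)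
  note p1 = pr1_proj[OF assms(1) q] and p2 = pr2_proj[OF assms(1) q]
  from assms(2) x consider "x0 \<noteq> 0" | "x1 \<noteq> 0" | "x2 \<noteq> 0" | "x3 \<noteq> 0" by auto
  then show ?thesis
  proof cases
    case 1
    show ?thesis
      by (rule that[of "[x0, x1]" "[x0, x3]" x0])
        (use 1 p1(1) p2(1) q x in \<open>simp_all add: pair_nz_def skew_def mult_ac\<close>)
  next
    case 2
    show ?thesis
      by (rule that[of "[x0, x1]" "[x1, x2]" x1])
        (use 2 p1(1) p2(2) q x in \<open>simp_all add: pair_nz_def skew_def mult_ac\<close>)
  next
    case 3
    show ?thesis
      by (rule that[of "[x3, x2]" "[x1, x2]" x2])
        (use 3 p1(2) p2(2) q x in \<open>simp_all add: pair_nz_def skew_def mult_ac\<close>)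
  next
    case 4
    show ?thesis
      by (rule that[of "[x3, x2]" "[x0, x3]" x3])
        (use 4 p1(2) p2(1) q x in \<open>simp_all add: pair_nz_def skew_def mult_ac\<close>)
  qed
qed

lemma factor_skew:
  assumes u: "length u = 2" "pair_nz (u!0) (u!1)" and v: "length v = 2" "pair_nz (v!0) (v!1)"
  shows "pr1 (proj (skew u v)) = proj u" "pr2 (proj (skew u v)) = proj v"
proof -
  have lists: "u = [u!0, u!1]" "v = [v!0, v!1]"
    using u(1) v(1) by (auto simp: numeral_2_eq_2 length_Suc_conv)
  have x: "length (skew u v) = 4" "skew u v ! 0 * skew u v ! 2 = skew u v ! 1 * skew u v ! 3"
    by (simp_all add: skew_def mult_ac)
  show "pr1 (proj (skew u v)) = proj u"
  proof (cases "v!0 = 0")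
    case False
    then show ?thesis using pr1_proj(1)[OF x] u(2) proj_pair_scaled[of "v!0" "u!0" "u!1"] lists(1)
      by (simp add: skew_def pair_nz_def mult.commute)
  next
    case True
    with v(2) have "v!1 \<noteq> 0" by (simp add: pair_nz_def)
    then show ?thesis using pr1_proj(2)[OF x] u(2) proj_pair_scaled[of "v!1" "u!0" "u!1"] lists(1)
      by (simp add: skew_def pair_nz_def mult.commute)
  qed
  show "pr2 (proj (skew u v)) = proj v"
  proof (cases "u!0 = 0")
    case False
    then show ?thesis using pr2_proj(1)[OF x] v(2) proj_pair_scaled[of "u!0" "v!0" "v!1"] lists(2)
      by (simp add: skew_def pair_nz_def)
  next
    case True
    with u(2) have "u!1 \<noteq> 0" by (simp add: pair_nz_def)
    then show ?thesis using pr2_proj(2)[OF x] v(2) proj_pair_scaled[of "u!1" "v!0" "v!1"] lists(2)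
      by (simp add: skew_def pair_nz_def)
  qed
qed

lemma is_biform_mvar_mult:
  "i \<le> 1 \<Longrightarrow> 2 \<le> j \<Longrightarrow> j \<le> 3 \<Longrightarrow> is_biform 1 1 1 1 (mvar i * mvar j :: 'a::field mpol)"
proof -
  assume ij: "i \<le> 1" "2 \<le> j" "j \<le> 3"
  have "mvar i * mvar j = Poly_Mapping.single (Poly_Mapping.single i 1 + Poly_Mapping.single j 1) (1::'a)"
    by (simp add: mvar_def mult_single)
  moreover have "i = 0 \<or> i = 1" "j = 2 \<or> j = 3" using ij by auto
  ultimately show ?thesis using keys_add[of "Poly_Mapping.single i (1::nat)" "Poly_Mapping.single j 1"]
    by (auto simp: is_biform_def lookup_add lookup_single numeral_2_eq_2 numeral_3_eq_3)
qed

lemma meval_ac_mvar [simp]: "meval_ac (mvar i) x = nth_default 0 x i"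
  by (simp add: meval_ac_def)

lemma meval_ac_mult [simp]: "meval_ac (p * q) x = meval_ac p x * meval_ac q x"
  by (simp add: meval_ac_def)

lemma skew_segre_bimorphism:
  "bimorphism_given_by 1 1 (proj_space 1 \<times> proj_space 1) 3 (proj_space 3) skew_segre
     [[mvar 0 * mvar 2, mvar 1 * mvar 2, mvar 1 * mvar 3, mvar 0 * mvar (3::nat) :: 'k::field mpol]]"
proof -
  let ?t = "[mvar 0 * mvar 2, mvar 1 * mvar 2, mvar 1 * mvar 3, mvar 0 * mvar (3::nat) :: 'k::field mpol]"
  have ev: "map (\<lambda>p. meval_ac p (x @ y)) ?t = skew x y" if "length x = 2" "length y = 2" for x y
    using that by (simp add: skew_def nth_default_nth nth_append)
  have nonvanishing: "\<exists>a\<in>set (skew u v). a \<noteq> 0" if "pair_nz (u!0) (u!1)" "pair_nz (v!0) (v!1)" for u v :: "'k alg_closure list"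
    using that by (auto simp: skew_def pair_nz_def)
  have "skew_segre \<in> (proj_space 1 \<times> proj_space 1) \<rightarrow> (proj_space 3 :: 'k alg_closure ppoint set)"
  proof
    fix PQ :: "'k alg_closure ppoint \<times> 'k alg_closure ppoint"
    assume "PQ \<in> proj_space 1 \<times> proj_space 1"
    then obtain P Q where PQ: "PQ = (P, Q)" "P \<in> proj_space 1" "Q \<in> proj_space 1" by blast
    from PQ(2) obtain u where "P = proj u" "length u = 2" "pair_nz (u!0) (u!1)" by (rule proj_space_1_cases)
    moreover from PQ(3) obtain v where "Q = proj v" "length v = 2" "pair_nz (v!0) (v!1)" by (rule proj_space_1_cases)
    ultimately have uv: "PQ = (proj u, proj v)" "length u = 2" "pair_nz (u!0) (u!1)" "length v = 2" "pair_nz (v!0) (v!1)"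
      using PQ(1) by auto
    then show "skew_segre PQ \<in> proj_space 3" using nonvanishing[of u v]
      by (simp add: skew_segre_proj mem_proj_space) (simp add: skew_def)
  qed
  moreover have "\<forall>t\<in>set [?t]. length t = 3 + 1 \<and> (\<exists>d e. \<forall>p\<in>set t. is_biform 1 1 d e p)"
    by (auto intro!: exI[of _ 1] is_biform_mvar_mult simp del: One_nat_def)
  moreover have "(\<exists>t\<in>set [?t]. \<exists>p\<in>set t. meval_ac p (x @ y) \<noteq> 0) \<and>
        (\<forall>t\<in>set [?t]. (\<exists>p\<in>set t. meval_ac p (x @ y) \<noteq> 0) \<longrightarrow>
           skew_segre (P, Q) = proj (map (\<lambda>p. meval_ac p (x @ y)) t))"
    if PQ: "P \<in> proj_space 1" "Q \<in> proj_space 1" and xy: "x \<in> P" "y \<in> Q" for P Q x y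
  proof -
    have "P = proj x" "Q = proj y" using PQ xy proj_eqD by (auto simp: proj_space_def)
    with PQ have l: "length x = 2" "length y = 2" and n: "\<exists>a\<in>set x. a \<noteq> 0" "\<exists>a\<in>set y. a \<noteq> 0"
      by (auto simp: mem_proj_space)
    from l obtain a b a' b' where "x = [a, b]" "y = [a', b']" by (auto simp: numeral_2_eq_2 length_Suc_conv)
    with n nonvanishing[of x y] have "\<exists>z\<in>set (map (\<lambda>p. meval_ac p (x @ y)) ?t). z \<noteq> 0"
      unfolding ev[OF l] by (auto simp: pair_nz_def)
    then have "\<exists>p\<in>set ?t. meval_ac p (x @ y) \<noteq> 0" by (simp only: set_map bex_simps)
    moreover have "skew_segre (P, Q) = proj (map (\<lambda>p. meval_ac p (x @ y)) ?t)"
      unfolding ev[OF l] \<open>P = proj x\<close> \<open>Q = proj y\<close> by (rule skew_segre_proj[OF l])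
    ultimately show ?thesis by simp
  qed
  ultimately show ?thesis unfolding bimorphism_given_by_def by (auto simp del: set_simps)
qed

section \<open>Morphisms read off on the cone, and the model attached to an elliptic curve\<close>

lemma morphism_given_byI:
  assumes "\<And>x. x \<in> A \<Longrightarrow> \<phi> (proj x) \<in> W"
    and A: "\<And>x t. x \<in> A \<Longrightarrow> t \<noteq> 0 \<Longrightarrow> map ((*) t) x \<in> A"
    and "\<And>t p. t \<in> set ts \<Longrightarrow> length t = s + 1"
    and "\<And>t p. t \<in> set ts \<Longrightarrow> p \<in> set t \<Longrightarrow> is_form r d p"
    and "\<And>x. x \<in> A \<Longrightarrow> \<exists>t\<in>set ts. \<exists>p\<in>set t. meval_ac p x \<noteq> 0"
    and "\<And>x t. x \<in> A \<Longrightarrow> t \<in> set ts \<Longrightarrow> \<exists>p\<in>set t. meval_ac p x \<noteq> 0 \<Longrightarrow> \<phi> (proj x) = proj (map (\<lambda>p. meval_ac p x) t)"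
  shows "morphism_given_by r (proj ` A) s W \<phi> ts"
proof -
  have rep: "x \<in> A" "P = proj x" if "P \<in> proj ` A" "x \<in> P" for P x
  proof -
    from that(1) obtain y where y: "y \<in> A" "P = proj y" by blast
    with that(2) obtain t where "t \<noteq> 0" "x = map ((*) t) y" by (auto simp: proj_def)
    with y A show "x \<in> A" "P = proj x" by (simp_all add: proj_scaled)
  qed
  show ?thesis unfolding morphism_given_by_def
  proof (intro conjI ballI impI)
    show "\<phi> \<in> proj ` A \<rightarrow> W" using assms(1) by auto
    show "length t = s + 1" if "t \<in> set ts" for t using assms(3) that .
    show "\<exists>d. \<forall>p\<in>set t. is_form r d p" if "t \<in> set ts" for t using assms(4) that by blast
    show "\<exists>t\<in>set ts. \<exists>p\<in>set t. meval_ac p x \<noteq> 0" if "P \<in> proj ` A" "x \<in> P" for P x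
      using assms(5) rep(1)[OF that] .
    show "\<phi> P = proj (map (\<lambda>p. meval_ac p x) t)"
      if "P \<in> proj ` A" "x \<in> P" "t \<in> set ts" "\<exists>p\<in>set t. meval_ac p x \<noteq> 0" for P x t
      unfolding rep(2)[OF that(1,2)] by (rule assms(6)[OF rep(1)[OF that(1,2)] that(3,4)])
  qed
qed

lemma z4_model_of_elliptic_curve:
  fixes c :: "'k::field"
  assumes "CHAR('k) = 2" and E: "elliptic_curve 3 (z4_curve c) Z"
  shows "z4_model (to_ac c)"
proof
  have "of_nat CHAR('k alg_closure) = (0 :: 'k alg_closure)" by (rule of_nat_CHAR)
  then show two: "(2 :: 'k alg_closure) = 0" using assms(1) by simp
  have curve: "proj_curve 3 (z4_curve c)" using E by (simp add: elliptic_curve_def)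
  then show "to_ac c \<noteq> 0" using z4_curve_parameter_nonzero[OF two] by simp
  fix d e and F G :: "'k alg_closure mpol"
  assume FG: "is_form 3 d F" "is_form 3 e G" "\<forall>x\<in>z4_cone (to_ac c). meval F x * meval G x = 0"
  have vanish: "vanishes_on H (z4_curve c) \<longleftrightarrow> (\<forall>x\<in>z4_cone (to_ac c). meval H x = 0)" for H
    unfolding z4_curve_eq by (rule vanishes_on_proj_image[OF z4_cone_scaled])
  have "vanishes_on (F * G) (z4_curve c)" using FG(3) by (simp add: vanish)
  then have "vanishes_on F (z4_curve c) \<or> vanishes_on G (z4_curve c)"
    using curve FG(1,2) unfolding proj_curve_def proj_variety_def by metis
  then show "(\<forall>x\<in>z4_cone (to_ac c). meval F x = 0) \<or> (\<forall>x\<in>z4_cone (to_ac c). meval G x = 0)"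
    by (simp only: vanish)
qed

lemma rational_point_01:
  "rational_point (proj [1, 1, 0, 0] :: 'k::field alg_closure ppoint)"
  "rational_point (proj [0, 1, 1, 0] :: 'k::field alg_closure ppoint)"
  unfolding rational_point_def
  by (rule exI[of _ "[1, 1, 0, 0]"], simp, rule exI[of _ "[0, 1, 1, 0]"], simp)

lemma projections_morphisms:
  fixes c :: "'k::field"
  assumes "c \<noteq> 0"
  shows "morphism_given_by 3 (z4_curve c) 1 (proj_space 1) pr1 [[mvar 0, mvar 1], [mvar 3, mvar 2]]"
    and "morphism_given_by 3 (z4_curve c) 1 (proj_space 1) pr2 [[mvar 0, mvar 3], [mvar 1, mvar 2]]"
proof -
  let ?C = "z4_cone (to_ac c)"
  have x: "length x = 4" "x!0 * x!2 = x!1 * x!3" "\<exists>a\<in>set x. a \<noteq> 0" if "x \<in> ?C" for x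
    using that z4_cone_quadric[OF that] assms by (auto simp: z4_cone_def)
  have nonvanishing: "(pair_nz (x!0) (x!1) \<or> pair_nz (x!3) (x!2)) \<and> (pair_nz (x!0) (x!3) \<or> pair_nz (x!1) (x!2))"
    if "x \<in> ?C" for x
  proof -
    from x(1)[OF that] obtain a b d e where "x = [a, b, d, e]" by (rule list4_cases)
    with x(3)[OF that] show ?thesis by (auto simp: pair_nz_def)
  qed
  have mem: "pr1 (proj x) \<in> proj_space 1" "pr2 (proj x) \<in> proj_space 1" if "x \<in> ?C" for x
    using nonvanishing[OF that] pr1_proj[OF x(1,2)[OF that]] pr2_proj[OF x(1,2)[OF that]] proj_pair_in_proj_space by metis+
  have ev: "meval_ac (mvar i) x = x ! i" if "x \<in> ?C" "i < 4" for x i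
    using x(1)[OF that(1)] that(2) by (simp add: nth_default_nth)
  show "morphism_given_by 3 (z4_curve c) 1 (proj_space 1) pr1 [[mvar 0, mvar 1], [mvar 3, mvar 2]]"
    unfolding z4_curve_eq
  proof (rule morphism_given_byI[where d = 1])
    fix x assume "x \<in> ?C"
    then show "\<exists>t\<in>set [[mvar 0, mvar 1], [mvar 3, mvar 2]]. \<exists>p\<in>set t. meval_ac p x \<noteq> 0"
      using nonvanishing[of x] by (auto simp: ev pair_nz_def simp del: meval_ac_mvar)
  next
    fix x t assume *: "x \<in> ?C" "t \<in> set [[mvar 0, mvar 1], [mvar 3, mvar 2]]" "\<exists>p\<in>set t. meval_ac p x \<noteq> 0"
    then show "pr1 (proj x) = proj (map (\<lambda>p. meval_ac p x) t)"
      using pr1_proj[OF x(1,2)[OF *(1)]] by (auto simp: ev pair_nz_def simp del: meval_ac_mvar)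
  qed (use mem z4_cone_scaled in \<open>auto simp: is_form_mvar simp del: One_nat_def\<close>)
  show "morphism_given_by 3 (z4_curve c) 1 (proj_space 1) pr2 [[mvar 0, mvar 3], [mvar 1, mvar 2]]"
    unfolding z4_curve_eq
  proof (rule morphism_given_byI[where d = 1])
    fix x assume "x \<in> ?C"
    then show "\<exists>t\<in>set [[mvar 0, mvar 3], [mvar 1, mvar 2]]. \<exists>p\<in>set t. meval_ac p x \<noteq> 0"
      using nonvanishing[of x] by (auto simp: ev pair_nz_def simp del: meval_ac_mvar)
  next
    fix x t assume *: "x \<in> ?C" "t \<in> set [[mvar 0, mvar 3], [mvar 1, mvar 2]]" "\<exists>p\<in>set t. meval_ac p x \<noteq> 0"
    then show "pr2 (proj x) = proj (map (\<lambda>p. meval_ac p x) t)"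
      using pr2_proj[OF x(1,2)[OF *(1)]] by (auto simp: ev pair_nz_def simp del: meval_ac_mvar)
  qed (use mem z4_cone_scaled in \<open>auto simp: is_form_mvar simp del: One_nat_def\<close>)
qed

lemma factorization_inverse:
  fixes c :: "'k::field"
  assumes "c \<noteq> 0"
  shows "P \<in> z4_curve c \<Longrightarrow> (pr1 P, pr2 P) \<in> z4_biquadratic_curve c \<and> skew_segre (pr1 P, pr2 P) = P"
    and "Q \<in> z4_biquadratic_curve c \<Longrightarrow>
      skew_segre Q \<in> z4_curve c \<and> (pr1 (skew_segre Q), pr2 (skew_segre Q)) = Q"
proof -
  let ?C = "z4_cone (to_ac c)"
  assume "P \<in> z4_curve c"
  then obtain x where x: "x \<in> ?C" "P = proj x" by (auto simp: z4_curve_eq)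
  then have "length x = 4" "\<exists>a\<in>set x. a \<noteq> 0" "x!0 * x!2 = x!1 * x!3"
    using z4_cone_quadric[OF x(1)] assms by (auto simp: z4_cone_def)
  then obtain u v k where *: "length u = 2" "pair_nz (u!0) (u!1)" "length v = 2" "pair_nz (v!0) (v!1)"
    "pr1 (proj x) = proj u" "pr2 (proj x) = proj v" "k \<noteq> 0" "skew u v = map ((*) k) x" by (rule factor_point)
  have "skew u v \<in> ?C" unfolding *(8) by (rule z4_cone_scaled[OF x(1) *(7)])
  then show "(pr1 P, pr2 P) \<in> z4_biquadratic_curve c \<and> skew_segre (pr1 P, pr2 P) = P"
    unfolding x(2) *(5,6) using z4_biquadratic_iff[OF *(1-4)] skew_segre_proj[OF *(1,3)] *(8) proj_scaled[OF *(7)] by simp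
next
  assume Q: "Q \<in> z4_biquadratic_curve c"
  obtain Q1 Q2 where Q12: "Q = (Q1, Q2)" by (cases Q)
  with Q have "Q1 \<in> proj_space 1" "Q2 \<in> proj_space 1" by (auto simp: z4_biquadratic_curve_def bi_zero_locus_def)
  from proj_space_1_cases[OF this(1)] obtain u where u: "Q1 = proj u" "length u = 2" "pair_nz (u!0) (u!1)" .
  from proj_space_1_cases[OF \<open>Q2 \<in> proj_space 1\<close>] obtain v where v: "Q2 = proj v" "length v = 2" "pair_nz (v!0) (v!1)" .
  have "skew u v \<in> z4_cone (to_ac c)" using Q z4_biquadratic_iff[OF u(2,3) v(2,3)] unfolding Q12 u(1) v(1) by simp
  moreover have "skew_segre Q = proj (skew u v)" unfolding Q12 u(1) v(1) by (rule skew_segre_proj[OF u(2) v(2)])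
  ultimately show "skew_segre Q \<in> z4_curve c \<and> (pr1 (skew_segre Q), pr2 (skew_segre Q)) = Q"
    using factor_skew[OF u(2,3) v(2,3)] by (simp add: z4_curve_eq Q12 u(1) v(1))
qed

theorem theorem8:
  fixes c :: "'k::field"
  assumes "CHAR('k) = 2"
    and "elliptic_curve 3 (z4_curve c) (proj [1, 0, 0, 1])"
  shows "let E = z4_curve c; E1 = z4_biquadratic_curve c;
      Z = proj [1, 0, 0, 1]; T = proj [1, 1, 0, 0]; S = proj [0, 1, 1, 0];
      G = ec_group 3 E Z
    in
      (is_embedding_divisor_class 3 E Z
          (divisor_class 3 E (frag_cmul 3 (frag_of Z) + frag_of S)) \<and>
       S = T [^]\<^bsub>G\<^esub> (2::nat)) \<and>
      (T \<in> E \<and> rational_point T \<and> group.ord G T = 4) \<and>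
      (morphism_given_by 3 E 3 E (\<lambda>P. P \<otimes>\<^bsub>G\<^esub> T) [[mvar 3, mvar 0, mvar 1, mvar 2]] \<and>
       morphism_given_by 3 E 3 E (\<lambda>P. inv\<^bsub>G\<^esub> P) [[mvar 3, mvar 2, mvar 1, mvar 0]]) \<and>
      (\<exists>\<pi>1 \<pi>2 \<sigma>.
         morphism_given_by 3 E 1 (proj_space 1) \<pi>1 [[mvar 0, mvar 1], [mvar 3, mvar 2]] \<and>
         morphism_given_by 3 E 1 (proj_space 1) \<pi>2 [[mvar 0, mvar 3], [mvar 1, mvar 2]] \<and>
         bimorphism_given_by 1 1 (proj_space 1 \<times> proj_space 1) 3 (proj_space 3) \<sigma>
           [[mvar 0 * mvar 2, mvar 1 * mvar 2, mvar 1 * mvar 3, mvar 0 * mvar 3]] \<and>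
         (\<forall>P\<in>E. (\<pi>1 P, \<pi>2 P) \<in> E1 \<and> \<sigma> (\<pi>1 P, \<pi>2 P) = P) \<and>
         (\<forall>Q\<in>E1. \<sigma> Q \<in> E \<and> (\<pi>1 (\<sigma> Q), \<pi>2 (\<sigma> Q)) = Q))"
proof -
  interpret z4_model "to_ac c" by (rule z4_model_of_elliptic_curve[OF assms])
  have c0: "c \<noteq> 0" using c_nz by simp
  have E: "z4_curve c = E" by (simp add: z4_curve_eq E_def)
  have O: "[1, 0, 0, 1] = (ptO :: 'k alg_closure list)" and S: "[0, 1, 1, 0] = (ptS :: 'k alg_closure list)"
    and T: "[1, 1, 0, 0] = (pt 1 0 :: 'k alg_closure list)"
    by (simp_all add: ptO_def ptS_def pt_def)
  \<comment> \<open>The entries of the tuple are a permutation of the coordinates, so a single tuple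
    is defined on the whole curve.\<close>
  have nonzero: "\<exists>p\<in>set t. meval_ac p x \<noteq> 0" if "x \<in> C" "t = map mvar ks" "set ks = {0, 1, 2, 3}" for x t ks
  proof -
    from C_length[OF that(1)] obtain x0 x1 x2 x3 where x: "x = [x0, x1, x2, x3]" by (rule list4_cases)
    have "\<exists>i\<in>set ks. x ! i \<noteq> 0 \<and> i < 4" using that(1) unfolding that(3) by (auto simp: z4_cone_def x)
    then obtain i where i: "i \<in> set ks" "x ! i \<noteq> 0" "i < 4" by blast
    then show ?thesis using that(2) C_length[OF that(1)]
      by (intro bexI[of _ "mvar i"]) (simp_all add: nth_default_nth)
  qed
  have class_E: "is_embedding_divisor_class 3 E (proj ptO) (divisor_class 3 E (frag_cmul 3 (frag_of (proj ptO)) + frag_of (proj ptS)))"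
    unfolding is_embedding_divisor_class_def
    using embedding hyperplane_sections rational_point_01(2)[where 'k = 'k, unfolded S]
    by (intro conjI bexI[of _ "proj ptS"]) simp_all
  have translation_E: "morphism_given_by 3 E 3 E (\<lambda>P. P \<otimes>\<^bsub>G\<^esub> proj (pt 1 0)) [[mvar 3, mvar 0, mvar 1, mvar 2]]"
    unfolding E_def
  proof (rule morphism_given_byI[where d = 1], fold E_def)
    fix x assume x: "x \<in> C"
    show "proj x \<otimes>\<^bsub>G\<^esub> proj (pt 1 0) \<in> E" unfolding translation[OF x] using rho_C[OF x] C_iff_E by blast
    show "\<exists>t\<in>set [[mvar 3, mvar 0, mvar 1, mvar 2]]. \<exists>p\<in>set t. meval_ac p x \<noteq> 0"
      using nonzero[OF x, of _ "[3, 0, 1, 2]"] by auto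
    fix t assume "t \<in> set [[mvar 3, mvar 0, mvar 1, mvar (2::nat) :: 'k mpol]]"
    then show "proj x \<otimes>\<^bsub>G\<^esub> proj (pt 1 0) = proj (map (\<lambda>p. meval_ac p x) t)"
      unfolding translation[OF x] using C_length[OF x] by (simp add: rho_def nth_default_nth)
  qed (use z4_cone_scaled in \<open>auto simp: is_form_mvar simp del: One_nat_def\<close>)
  have inverse_E: "morphism_given_by 3 E 3 E (\<lambda>P. inv\<^bsub>G\<^esub> P) [[mvar 3, mvar 2, mvar 1, mvar 0]]"
    unfolding E_def
  proof (rule morphism_given_byI[where d = 1], fold E_def)
    fix x assume x: "x \<in> C"
    show "inv\<^bsub>G\<^esub> (proj x) \<in> E" unfolding inversion[OF x] using rev_C[OF x] C_iff_E by blast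
    show "\<exists>t\<in>set [[mvar 3, mvar 2, mvar 1, mvar 0]]. \<exists>p\<in>set t. meval_ac p x \<noteq> 0"
      using nonzero[OF x, of _ "[3, 2, 1, 0]"] by auto
    fix t assume t: "t \<in> set [[mvar 3, mvar 2, mvar 1, mvar (0::nat) :: 'k mpol]]"
    obtain x0 x1 x2 x3 where "x = [x0, x1, x2, x3]" using C_length[OF x] by (metis list4_cases)
    with t show "inv\<^bsub>G\<^esub> (proj x) = proj (map (\<lambda>p. meval_ac p x) t)"
      unfolding inversion[OF x] by (simp add: nth_default_nth)
  qed (use z4_cone_scaled in \<open>auto simp: is_form_mvar simp del: One_nat_def\<close>)
  have factorization: "\<exists>\<pi>1 \<pi>2 \<sigma>.
         morphism_given_by 3 E 1 (proj_space 1) \<pi>1 [[mvar 0, mvar 1], [mvar 3, mvar 2]] \<and>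
         morphism_given_by 3 E 1 (proj_space 1) \<pi>2 [[mvar 0, mvar 3], [mvar 1, mvar 2]] \<and>
         bimorphism_given_by 1 1 (proj_space 1 \<times> proj_space 1) 3 (proj_space 3) \<sigma>
           [[mvar 0 * mvar 2, mvar 1 * mvar 2, mvar 1 * mvar 3, mvar 0 * mvar 3 :: 'k mpol]] \<and>
         (\<forall>P\<in>E. (\<pi>1 P, \<pi>2 P) \<in> z4_biquadratic_curve c \<and> \<sigma> (\<pi>1 P, \<pi>2 P) = P) \<and>
         (\<forall>Q\<in>z4_biquadratic_curve c. \<sigma> Q \<in> E \<and> (\<pi>1 (\<sigma> Q), \<pi>2 (\<sigma> Q)) = Q)"
    using projections_morphisms[OF c0] skew_segre_bimorphism factorization_inverse[OF c0]
    unfolding E by (intro exI[of _ pr1] exI[of _ pr2] exI[of _ skew_segre]) blast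
  show ?thesis
    unfolding Let_def E O S T
    using class_E double_T_eq[symmetric] order_T translation_E inverse_E factorization rational_point_01(1)[where 'k = 'k, unfolded T]
      proj_in_E[OF N_T(1)] by blast
qed

end
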